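(* For any lacunary sequence $(N_k:k\in\mathbb{N})\subseteq\mathbb{N}$ there is a constant $C>0$ such that for any finite set $\Lambda\subset Q_1^{-1}\mathbb{Z}\times Q_2^{-1}\mathbb{Z}$ with $Q_1,Q_2\in\mathbb{N}$ satisfying the separation condition $$\max\{|\lambda_1-\lambda_1'|,|\lambda_2-\lambda_2'|\}\ge 1\quad\text{for all }\lambda=(\lambda_1,\lambda_2),\ \lambda'=(\lambda_1',\lambda_2')\in\Lambda\text{ with }\lambda\ne\lambda',$$ and all $f\in L^2(\mathbb{R}^2)$, $$\Big\|\mathcal{O}\Big(\sum_{\lambda\in\Lambda}\mathcal{F}^{-1}\big(\mathbf{1}_{R^\lambda_{n_1,n_2}}\mathcal{F}f\big):n_1,n_2\in\mathbb{N}_0\Big)\Big\|_{L^2}\le C\Big(\log\log\big(Q_1\sqrt{|\Lambda|}\big)\cdot\log\log\big(Q_2\sqrt{|\Lambda|}\big)\Big)^2\|f\|_{L^2}.$$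
   Context: $\mathbb{N}=\{1,2,\dots\}$ and $\mathbb{N}_0=\mathbb{N}\cup\{0\}$. A sequence $(N_k:k\in\mathbb{N})\subseteq\mathbb{N}$ is lacunary if there is $\tau>1$ with $\tau N_k\le N_{k+1}$ for all $k\in\mathbb{N}$. For a fixed lacunary sequence, the oscillation seminorm of a two-parameter sequence of complex numbers is $$\mathcal{O}(a_{n_1,n_2}:n_1,n_2\in\mathbb{N}_0)=\Big(\sum_{k\in\mathbb{N}}\ \sup_{N_k\le n_1,n_2\le N_{k+1}}|a_{n_1,n_2}-a_{N_k,N_k}|^2\Big)^{1/2},$$ where the supremum is over all integers $n_1,n_2$ both lying in $[N_k,N_{k+1}]$; for a sequence of functions it is applied pointwise. For $n\in\mathbb{N}_0$, $A_n=(-2^{-n-1},2^{-n-1})\subset\mathbb{R}$. For $\lambda\in\mathbb{R}^2$ and $n_1,n_2\in\mathbb{N}_0$, $R^\lambda_{n_1,n_2}=\lambda+A_{n_1}\times A_{n_2}$. $|\Lambda|$ is the cardinality of $\Lambda$, and $\mathbf{1}_E$ is the indicator function of $E$. $\mathcal{F}$ is the Fourier transform on $\mathbb{R}^2$, $\mathcal{F}f(\xi)=\int_{\mathbb{R}^2}e^{-2\pi i\xi\cdot x}f(x)\,dx$ (extended to $L^2$), and $\mathcal{F}^{-1}$ is its inverse. *)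

theory Defs
  imports "HOL-Analysis.Analysis"
begin

text \<open>Sequences are indexed from 0, so \<open>N 0\<close> is the first term \<open>N\<^sub>1\<close>; all terms are positive.\<close>

definition lacunary :: "(nat \<Rightarrow> nat) \<Rightarrow> bool" where
  "lacunary N \<longleftrightarrow> (\<forall>k. N k \<ge> 1) \<and> (\<exists>\<tau>::real. \<tau> > 1 \<and> (\<forall>k. \<tau> * real (N k) \<le> real (N (Suc k))))"

definition esqrt :: "ennreal \<Rightarrow> ennreal" where
  "esqrt x = (if x = \<infinity> then \<infinity> else ennreal (sqrt (enn2real x)))"

text \<open>The oscillation seminorm takes values in \<open>[0, \<infinity>]\<close>: the series may diverge.\<close>

definition oscillation :: "(nat \<Rightarrow> nat) \<Rightarrow> (nat \<Rightarrow> nat \<Rightarrow> complex) \<Rightarrow> ennreal" where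
  "oscillation N a =
     esqrt (\<Sum>k. SUP (n1, n2) \<in> {N k..N (Suc k)} \<times> {N k..N (Suc k)}.
                ennreal ((cmod (a n1 n2 - a (N k) (N k)))\<^sup>2))"

text \<open>\<open>L2_enorm\<close> is the \<open>L\<^sup>2\<close> norm of a function with values in \<open>[0, \<infinity>]\<close>, such as a pointwise
  oscillation; \<open>L2_norm\<close> is that of a complex function.\<close>

definition L2_enorm :: "(real \<times> real \<Rightarrow> ennreal) \<Rightarrow> ennreal" where
  "L2_enorm g = esqrt (\<integral>\<^sup>+ x. (g x)\<^sup>2 \<partial>lborel)"

definition L2_norm :: "(real \<times> real \<Rightarrow> complex) \<Rightarrow> ennreal" where
  "L2_norm f = L2_enorm (\<lambda>x. ennreal (cmod (f x)))"

definition L2 :: "(real \<times> real \<Rightarrow> complex) set" where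
  "L2 = {f \<in> borel_measurable lborel. L2_norm f < \<infinity>}"

definition fourier_L1 :: "(real \<times> real \<Rightarrow> complex) \<Rightarrow> real \<times> real \<Rightarrow> complex" where
  "fourier_L1 f \<xi> =
     (\<integral>x. exp (- 2 * of_real pi * \<i> * of_real (\<xi> \<bullet> x)) * f x \<partial>lborel)"

text \<open>The continuous extension to \<open>L\<^sup>2\<close> of the Fourier integral on \<open>L\<^sup>1 \<inter> L\<^sup>2\<close>. The transform is
  determined only up to a null set; \<open>fourier\<close> and \<open>fourier_inv\<close> pick representatives.\<close>

definition is_fourier_L2 :: "(real \<times> real \<Rightarrow> complex) \<Rightarrow> (real \<times> real \<Rightarrow> complex) \<Rightarrow> bool" where
  "is_fourier_L2 f g \<longleftrightarrow> g \<in> L2 \<and>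
     (\<exists>\<phi>. (\<forall>j. integrable lborel (\<phi> j) \<and> \<phi> j \<in> L2) \<and>
          (\<lambda>j::nat. L2_norm (\<lambda>x. \<phi> j x - f x)) \<longlonglongrightarrow> 0 \<and>
          (\<lambda>j. L2_norm (\<lambda>\<xi>. fourier_L1 (\<phi> j) \<xi> - g \<xi>)) \<longlonglongrightarrow> 0)"

definition fourier :: "(real \<times> real \<Rightarrow> complex) \<Rightarrow> real \<times> real \<Rightarrow> complex" where
  "fourier f = (SOME g. is_fourier_L2 f g)"

definition fourier_inv :: "(real \<times> real \<Rightarrow> complex) \<Rightarrow> real \<times> real \<Rightarrow> complex" where
  "fourier_inv g = (SOME h. h \<in> L2 \<and> (AE \<xi> in lborel. fourier h \<xi> = g \<xi>))"

definition A_int :: "nat \<Rightarrow> real set" where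
  "A_int n = {- (1 / 2 ^ (n + 1)) <..< 1 / 2 ^ (n + 1)}"

definition R_rect :: "real \<times> real \<Rightarrow> nat \<Rightarrow> nat \<Rightarrow> (real \<times> real) set" where
  "R_rect l n1 n2 = (\<lambda>v. l + v) ` (A_int n1 \<times> A_int n2)"

definition freq_grid :: "nat \<Rightarrow> nat \<Rightarrow> (real \<times> real) set" where
  "freq_grid Q1 Q2 = {(of_int a / of_nat Q1, of_int b / of_nat Q2) | a b :: int. True}"

definition separated :: "(real \<times> real) set \<Rightarrow> bool" where
  "separated \<Lambda> \<longleftrightarrow> (\<forall>l\<in>\<Lambda>. \<forall>l'\<in>\<Lambda>. l \<noteq> l' \<longrightarrow>
     max \<bar>fst l - fst l'\<bar> \<bar>snd l - snd l'\<bar> \<ge> 1)"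

definition multi_freq_proj ::
  "(real \<times> real) set \<Rightarrow> (real \<times> real \<Rightarrow> complex) \<Rightarrow> nat \<Rightarrow> nat \<Rightarrow> real \<times> real \<Rightarrow> complex" where
  "multi_freq_proj \<Lambda> f n1 n2 x =
     (\<Sum>l\<in>\<Lambda>. fourier_inv (\<lambda>\<xi>. indicator (R_rect l n1 n2) \<xi> * fourier f \<xi>) x)"

text \<open>The real-valued \<open>ln\<close> has \<open>ln 0 = 0\<close>, which would make \<open>ln (ln 1)\<close> vanish. The extended
  logarithm has \<open>log 0 = -\<infinity>\<close> instead, so that \<open>(loglog 1)\<^sup>2 = \<infinity>\<close>. The value \<open>-\<infinity>\<close> at negative
  arguments is arbitrary; \<open>loglog x\<close> reaches it only for \<open>x < 1\<close>.\<close>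

definition eln :: "ereal \<Rightarrow> ereal" where
  "eln x = (if x \<le> 0 then -\<infinity> else if x = \<infinity> then \<infinity> else ereal (ln (real_of_ereal x)))"

definition loglog :: "real \<Rightarrow> ereal" where
  "loglog x = eln (eln (ereal x))"

end

theory Submission
  imports Defs "HOL-Probability.Characteristic_Functions"
begin

text \<open>By separation, the union of the rectangles \<open>R\<^bsub>n1,n2\<^esub>\<close> around \<open>\<Lambda>\<close> is \<open>V\<^bsub>n1\<^esub> \<inter> W\<^bsub>n2\<^esub>\<close> for two
  decreasing sequences of sets, so that the operators are products of commuting nested frequency
  projections, and the oscillation over orthogonal blocks is controlled by the strong maximal
  function \<open>sup |P\<^bsub>n1\<^esub> R\<^bsub>n2\<^esub> f|\<close>. This is bounded one parameter at a time. The scales with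
  \<open>2 ^ n \<le> Q\<close> number about \<open>log Q\<close> and cost a factor \<open>log log Q\<close> by the Rademacher--Menshov argument.
  At the finer scales the cut-off is \<open>1 / Q\<close>-periodic; it differs by a bounded square function
  from averages over translations by multiples of \<open>Q\<close>, to which Hopf's maximal ergodic
  inequality applies, so these scales cost \<open>O(1)\<close>. Both comparisons allow arbitrary further
  cut-offs in the other variable, hence the iteration.

  On the Fourier side, boundedness up to a constant and inversion suffice; sharp constants in
  Plancherel's theorem are not needed.\<close>

section \<open>Square integrable functions\<close>

text \<open>\<open>fourier\<close> and \<open>fourier_inv\<close> are arbitrary representatives, so
  linearity, modulation and inversion hold only almost everywhere, with an exceptional set that
  depends on the function. Every supremum therefore runs over a countable index set, and the
  countably many exceptional sets are discarded together before anything is estimated pointwise.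
  Norms are squared and valued in \<open>ennreal\<close>: series, suprema and integrals then exist
  without side conditions, and the squared norms of pieces on disjoint frequency sets add up. The
  price is a factor 2 for each triangle inequality, harmless except in the dyadic recursion, where a
  weight has to vary with the level. If \<open>Q \<le> 2 ^ (2 ^ m)\<close>, one parameter costs a
  multiple of \<open>m + 1\<close> in norm. The right-hand side has to dominate this even where
  \<open>loglog\<close> is small: its argument is the root of an integer, which keeps it away from
  the zero at Euler's number, and for the least \<open>m\<close> it grows at least linearly in
  \<open>m\<close>.\<close>

abbreviation sq_abs :: "complex \<Rightarrow> ennreal" where
  "sq_abs z \<equiv> ennreal ((cmod z)\<^sup>2)"

definition L2_sq :: "(real \<times> real \<Rightarrow> complex) \<Rightarrow> ennreal" where
  "L2_sq f = (\<integral>\<^sup>+x. sq_abs (f x) \<partial>lborel)"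

lemma esqrt_power2: "(esqrt x)\<^sup>2 = x"
  by (cases x) (auto simp: esqrt_def power2_eq_square ennreal_mult_top ennreal_top_mult
    simp flip: ennreal_mult)

lemma esqrt_mono: "x \<le> y \<Longrightarrow> esqrt x \<le> esqrt y"
  by (cases x; cases y) (auto simp: esqrt_def top_unique)

lemma esqrt_power2_ennreal: "esqrt (x\<^sup>2) = x"
  by (cases x) (auto simp: esqrt_def ennreal_power power2_eq_square ennreal_mult_top
    simp flip: ennreal_mult)

lemma esqrt_mult: "esqrt (ennreal (K\<^sup>2) * x) = ennreal \<bar>K\<bar> * esqrt x"
proof -
  have "ennreal (K\<^sup>2) * x = (ennreal \<bar>K\<bar> * esqrt x)\<^sup>2"
    by (simp add: power_mult_distrib esqrt_power2 ennreal_power)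
  then show ?thesis by (simp add: esqrt_power2_ennreal)
qed

lemma esqrt_0 [simp]: "esqrt 0 = 0"
  by (simp add: esqrt_def)

lemma esqrt_less_top: "esqrt x < \<infinity> \<longleftrightarrow> x < \<infinity>"
  by (cases x) (auto simp: esqrt_def)

lemma esqrt_tendsto_0_iff:
  "((\<lambda>j::nat. esqrt (a j)) \<longlonglongrightarrow> 0) \<longleftrightarrow> (a \<longlonglongrightarrow> 0)"
proof
  assume "a \<longlonglongrightarrow> 0"
  show "(\<lambda>j. esqrt (a j)) \<longlonglongrightarrow> 0"
  proof (rule order_tendstoI)
    fix e :: ennreal assume "0 < e"
    then have "0 < e\<^sup>2" by (simp add: power2_eq_square ennreal_zero_less_mult_iff)
    with \<open>a \<longlonglongrightarrow> 0\<close> have "eventually (\<lambda>j. a j < e\<^sup>2) sequentially" by (rule order_tendstoD)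
    then show "eventually (\<lambda>j. esqrt (a j) < e) sequentially"
    proof eventually_elim
      fix j assume "a j < e\<^sup>2"
      show "esqrt (a j) < e"
      proof (rule ccontr)
        assume "\<not> esqrt (a j) < e"
        then have "e\<^sup>2 \<le> (esqrt (a j))\<^sup>2" by (intro power_mono) auto
        with \<open>a j < e\<^sup>2\<close> show False by (simp add: esqrt_power2)
      qed
    qed
  qed simp
next
  assume "(\<lambda>j. esqrt (a j)) \<longlonglongrightarrow> 0"
  then have "(\<lambda>j. esqrt (a j) * esqrt (a j)) \<longlonglongrightarrow> 0 * 0"
    by (intro tendsto_mult_ennreal) auto
  then show "a \<longlonglongrightarrow> 0" by (simp add: esqrt_power2 flip: power2_eq_square)
qed

lemma L2_norm_L2_sq: "L2_norm f = esqrt (L2_sq f)"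
  by (simp add: L2_norm_def L2_enorm_def L2_sq_def ennreal_power)

lemma L2_iff: "f \<in> L2 \<longleftrightarrow> f \<in> borel_measurable borel \<and> L2_sq f < \<infinity>"
  using esqrt_less_top[of "L2_sq f"] by (simp add: L2_def L2_norm_L2_sq)

lemma L2_measurable [measurable_dest]: "f \<in> L2 \<Longrightarrow> f \<in> borel_measurable borel"
  by (simp add: L2_iff)

lemma L2_sq_add_le:
  assumes [measurable]: "f \<in> borel_measurable borel" "g \<in> borel_measurable borel"
  shows "L2_sq (\<lambda>x. f x + g x) \<le> 2 * L2_sq f + 2 * L2_sq g"
proof -
  have "L2_sq (\<lambda>x. f x + g x)
    \<le> (\<integral>\<^sup>+x. 2 * sq_abs (f x) + 2 * sq_abs (g x) \<partial>lborel)"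
    unfolding L2_sq_def
  proof (rule nn_integral_mono)
    fix x
    have "(cmod (f x + g x))\<^sup>2 \<le> (cmod (f x) + cmod (g x))\<^sup>2"
      by (intro power_mono norm_triangle_ineq) auto
    also have "\<dots> \<le> 2 * (cmod (f x))\<^sup>2 + 2 * (cmod (g x))\<^sup>2"
      using sum_squares_bound[of "cmod (f x)" "cmod (g x)"] by (simp add: power2_sum)
    finally show "sq_abs (f x + g x)
        \<le> 2 * sq_abs (f x) + 2 * sq_abs (g x)"
      by (auto simp flip: ennreal_plus ennreal_numeral ennreal_mult intro!: ennreal_leI)
  qed
  also have "\<dots> = 2 * L2_sq f + 2 * L2_sq g"
    by (simp add: nn_integral_add nn_integral_cmult L2_sq_def)
  finally show ?thesis .
qed

lemma L2_sq_mult: "f \<in> borel_measurable borel \<Longrightarrow> L2_sq (\<lambda>x. c * f x) = sq_abs c * L2_sq f"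
  by (simp add: L2_sq_def norm_mult power_mult_distrib ennreal_mult nn_integral_cmult)

lemma L2_sq_minus: "L2_sq (\<lambda>x. - f x) = L2_sq f"
  by (simp add: L2_sq_def)

lemma L2_sq_diff_le:
  assumes "f \<in> borel_measurable borel" "g \<in> borel_measurable borel"
  shows "L2_sq (\<lambda>x. f x - g x) \<le> 2 * L2_sq f + 2 * L2_sq g"
  using L2_sq_add_le[of f "\<lambda>x. - g x"] assms by (simp add: L2_sq_minus)

lemma L2_sq_diff_commute: "L2_sq (\<lambda>x. f x - g x) = L2_sq (\<lambda>x. g x - f x)"
  by (simp add: L2_sq_def norm_minus_commute)

lemma L2_sq_triangle:
  assumes [measurable]: "f \<in> borel_measurable borel" "g \<in> borel_measurable borel" "h \<in> borel_measurable borel"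
  shows "L2_sq (\<lambda>x. f x - h x) \<le> 2 * L2_sq (\<lambda>x. f x - g x) + 2 * L2_sq (\<lambda>x. g x - h x)"
  using L2_sq_add_le[of "\<lambda>x. f x - g x" "\<lambda>x. g x - h x"] by simp

lemma L2_sq_cong_AE: "AE x in lborel. f x = g x \<Longrightarrow> L2_sq f = L2_sq g"
  unfolding L2_sq_def by (rule nn_integral_cong_AE) auto

lemma L2_sq_mono: "(\<And>x. cmod (f x) \<le> cmod (g x)) \<Longrightarrow> L2_sq f \<le> L2_sq g"
  unfolding L2_sq_def by (intro nn_integral_mono ennreal_leI power_mono) auto

lemma L2_sq_eq_0_iff: "f \<in> borel_measurable borel \<Longrightarrow> L2_sq f = 0 \<longleftrightarrow> (AE x in lborel. f x = 0)"
  by (simp add: L2_sq_def nn_integral_0_iff_AE)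

lemma L2_sq_diff_eq_0D:
  assumes "f \<in> borel_measurable borel" "g \<in> borel_measurable borel" "L2_sq (\<lambda>x. f x - g x) = 0"
  shows "AE x in lborel. f x = g x"
  using assms by (subst (asm) L2_sq_eq_0_iff) auto

lemma L2_add [intro]: "f \<in> L2 \<Longrightarrow> g \<in> L2 \<Longrightarrow> (\<lambda>x. f x + g x) \<in> L2"
  using L2_sq_add_le[of f g]
  by (auto simp: L2_iff intro!: le_less_trans[OF L2_sq_add_le] simp: ennreal_mult_less_top)

lemma L2_diff [intro]: "f \<in> L2 \<Longrightarrow> g \<in> L2 \<Longrightarrow> (\<lambda>x. f x - g x) \<in> L2"
  by (auto simp: L2_iff intro!: le_less_trans[OF L2_sq_diff_le] simp: ennreal_mult_less_top)

lemma L2_mult: "f \<in> L2 \<Longrightarrow> (\<lambda>x. c * f x) \<in> L2"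
  by (auto simp: L2_iff L2_sq_mult ennreal_mult_less_top)

lemma L2_bounded_mult:
  assumes [measurable]: "m \<in> borel_measurable borel" and "\<And>x. cmod (m x) \<le> 1" and f: "f \<in> L2"
  shows "(\<lambda>x. m x * f x) \<in> L2"
proof -
  have "cmod (m x * f x) \<le> cmod (f x)" for x
    using assms(2)[of x] by (simp add: norm_mult mult_left_le_one_le)
  then have "L2_sq (\<lambda>x. m x * f x) \<le> L2_sq f" by (rule L2_sq_mono)
  with f show ?thesis by (auto simp: L2_iff)
qed

lemma nn_integral_lborel_affine:
  fixes f :: "real \<times> real \<Rightarrow> ennreal"
  assumes [measurable]: "f \<in> borel_measurable borel" and c: "c \<noteq> 0"
  shows "(\<integral>\<^sup>+x. f x \<partial>lborel) = ennreal (c\<^sup>2) * (\<integral>\<^sup>+x. f (t + c *\<^sub>R x) \<partial>lborel)"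
  by (subst lborel_affine[OF c, of t])
     (simp add: nn_integral_density nn_integral_distr nn_integral_cmult power2_eq_square)

lemma nn_integral_lborel_shift:
  fixes f :: "real \<times> real \<Rightarrow> ennreal"
  shows "f \<in> borel_measurable borel \<Longrightarrow> (\<integral>\<^sup>+x. f (x + t) \<partial>lborel) = (\<integral>\<^sup>+x. f x \<partial>lborel)"
  using nn_integral_lborel_affine[of f 1 t] by (simp add: add.commute)

lemma nn_integral_lborel_reflect:
  fixes f :: "real \<times> real \<Rightarrow> ennreal"
  shows "f \<in> borel_measurable borel \<Longrightarrow> (\<integral>\<^sup>+x. f (- x) \<partial>lborel) = (\<integral>\<^sup>+x. f x \<partial>lborel)"
  using nn_integral_lborel_affine[of f "-1" 0] by simp

lemma L2_sq_shift: "f \<in> borel_measurable borel \<Longrightarrow> L2_sq (\<lambda>x. f (x + t)) = L2_sq f"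
  unfolding L2_sq_def by (rule nn_integral_lborel_shift) simp

lemma L2_sq_reflect: "f \<in> borel_measurable borel \<Longrightarrow> L2_sq (\<lambda>x. f (- x)) = L2_sq f"
  unfolding L2_sq_def by (rule nn_integral_lborel_reflect) simp

lemma L2_shift: "f \<in> L2 \<Longrightarrow> (\<lambda>x. f (x + t)) \<in> L2"
  by (auto simp: L2_iff L2_sq_shift)

lemma L2_reflect: "f \<in> L2 \<Longrightarrow> (\<lambda>x. f (- x)) \<in> L2"
  by (auto simp: L2_iff L2_sq_reflect)

lemma AE_lborel_shift:
  fixes P :: "real \<times> real \<Rightarrow> bool"
  assumes "AE x in lborel. P x"
  shows "AE x in lborel. P (x + t)"
proof -
  from assms obtain N where N: "{x. \<not> P x} \<subseteq> N" "N \<in> null_sets lborel"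
    by (auto simp: eventually_ae_filter)
  then have [measurable]: "N \<in> sets borel" by auto
  have "(\<integral>\<^sup>+x. indicator N (x + t) \<partial>lborel) = (\<integral>\<^sup>+x. indicator N x \<partial>lborel)"
    by (rule nn_integral_lborel_shift) simp
  also have "\<dots> = 0" using N by auto
  finally have "AE x in lborel. indicator N (x + t) = (0::ennreal)"
    by (subst (asm) nn_integral_0_iff_AE) auto
  then show ?thesis by (rule eventually_mono) (use N(1) in \<open>auto simp: indicator_def split: if_splits\<close>)
qed

lemma AE_lborel_reflect:
  fixes P :: "real \<times> real \<Rightarrow> bool"
  assumes "AE x in lborel. P x"
  shows "AE x in lborel. P (- x)"
proof -
  from assms obtain N where N: "{x. \<not> P x} \<subseteq> N" "N \<in> null_sets lborel"
    by (auto simp: eventually_ae_filter)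
  then have [measurable]: "N \<in> sets borel" by auto
  have "(\<integral>\<^sup>+x. indicator N (- x) \<partial>lborel) = (\<integral>\<^sup>+x. indicator N x \<partial>lborel)"
    by (rule nn_integral_lborel_reflect) simp
  also have "\<dots> = 0" using N by auto
  finally have "AE x in lborel. indicator N (- x) = (0::ennreal)"
    by (subst (asm) nn_integral_0_iff_AE) auto
  then show ?thesis by (rule eventually_mono) (use N(1) in \<open>auto simp: indicator_def split: if_splits\<close>)
qed

section \<open>The Fourier transform on L1\<close>

lemma measurable_fst_borel [measurable]: "fst \<in> (borel :: (real \<times> real) measure) \<rightarrow>\<^sub>M borel"
  and measurable_snd_borel [measurable]: "snd \<in> (borel :: (real \<times> real) measure) \<rightarrow>\<^sub>M borel"
  and measurable_cnj [measurable]: "cnj \<in> borel \<rightarrow>\<^sub>M borel"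
  by (auto intro!: borel_measurable_continuous_onI continuous_intros)

definition echar :: "real \<Rightarrow> complex" where
  "echar t = exp (- 2 * of_real pi * \<i> * of_real t)"

lemma echar_cis: "echar t = cis (- 2 * pi * t)"
  by (simp add: echar_def cis_conv_exp mult_ac)

lemma norm_echar [simp]: "cmod (echar t) = 1"
  by (simp add: echar_cis)

lemma echar_add: "echar (s + t) = echar s * echar t"
  by (simp add: echar_cis cis_mult algebra_simps)

lemma echar_0 [simp]: "echar 0 = 1"
  by (simp add: echar_def)

lemma cnj_echar: "cnj (echar t) = echar (- t)"
  by (simp add: echar_cis cis_cnj)

lemma measurable_echar [measurable]: "echar \<in> borel_measurable borel"
  unfolding echar_def by measurable

lemma fourier_L1_echar: "fourier_L1 f \<xi> = (\<integral>x. echar (\<xi> \<bullet> x) * f x \<partial>lborel)"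
  by (simp add: fourier_L1_def echar_def)

lemma integrable_bounded_mult:
  fixes f :: "'a \<Rightarrow> complex"
  assumes f: "integrable M f" and "m \<in> borel_measurable M" "\<And>x. cmod (m x) \<le> B"
  shows "integrable M (\<lambda>x. m x * f x)"
proof (rule Bochner_Integration.integrable_bound)
  show "integrable M (\<lambda>x. B * cmod (f x))" using f by simp
  show "(\<lambda>x. m x * f x) \<in> borel_measurable M" using assms by simp
  have "cmod (m x * f x) \<le> norm (B * cmod (f x))" for x
  proof -
    have "cmod (m x * f x) \<le> B * cmod (f x)"
      unfolding norm_mult by (intro mult_right_mono assms) simp
    then show ?thesis by simp
  qed
  then show "AE x in M. cmod (m x * f x) \<le> norm (B * cmod (f x))" by simp
qed

lemma integrable_echar: "integrable lborel f \<Longrightarrow> integrable lborel (\<lambda>x. echar (\<xi> \<bullet> x) * f x)"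
  by (rule integrable_bounded_mult[where B = 1]) auto

lemma fourier_L1_measurable [measurable]:
  assumes [measurable]: "f \<in> borel_measurable borel"
  shows "fourier_L1 f \<in> borel_measurable borel"
  unfolding fourier_L1_echar[abs_def] by measurable

lemma norm_fourier_L1_le: "integrable lborel f \<Longrightarrow> cmod (fourier_L1 f \<xi>) \<le> (\<integral>x. cmod (f x) \<partial>lborel)"
  unfolding fourier_L1_echar
  by (rule order_trans[OF integral_norm_bound]) (simp add: norm_mult)

lemma fourier_L1_add:
  "integrable lborel f \<Longrightarrow> integrable lborel g \<Longrightarrow>
    fourier_L1 (\<lambda>x. f x + g x) \<xi> = fourier_L1 f \<xi> + fourier_L1 g \<xi>"
  by (simp add: fourier_L1_echar distrib_left integrable_echar)

lemma fourier_L1_diff: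
  "integrable lborel f \<Longrightarrow> integrable lborel g \<Longrightarrow>
    fourier_L1 (\<lambda>x. f x - g x) \<xi> = fourier_L1 f \<xi> - fourier_L1 g \<xi>"
  by (simp add: fourier_L1_echar right_diff_distrib integrable_echar)

lemma fourier_L1_mult: "fourier_L1 (\<lambda>x. c * f x) \<xi> = c * fourier_L1 f \<xi>"
  by (simp add: fourier_L1_echar mult.left_commute)

lemma fourier_L1_modulate: "fourier_L1 (\<lambda>x. echar (v \<bullet> x) * f x) \<xi> = fourier_L1 f (\<xi> + v)"
  by (simp add: fourier_L1_echar inner_add_left echar_add mult_ac)

lemma lborel_integral_reflect:
  fixes f :: "real \<times> real \<Rightarrow> complex"
  shows "f \<in> borel_measurable borel \<Longrightarrow> (\<integral>x. f (- x) \<partial>lborel) = (\<integral>x. f x \<partial>lborel)"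
proof -
  assume [measurable]: "f \<in> borel_measurable borel"
  have "distr lborel borel (\<lambda>x::real \<times> real. - x) = lborel"
    using lborel_affine[of "-1" "0 :: real \<times> real"] by (simp add: density_1)
  then have "(\<integral>x. f x \<partial>lborel) = (\<integral>x. f x \<partial>distr lborel borel (\<lambda>x::real \<times> real. - x))" by simp
  also have "\<dots> = (\<integral>x. f (- x) \<partial>lborel)" by (rule integral_distr) auto
  finally show ?thesis by simp
qed

lemma fourier_L1_reflect:
  assumes [measurable]: "f \<in> borel_measurable borel"
  shows "fourier_L1 (\<lambda>x. f (- x)) \<xi> = fourier_L1 f (- \<xi>)"
  using lborel_integral_reflect[of "\<lambda>x. echar (- \<xi> \<bullet> x) * f x"] by (simp add: fourier_L1_echar)

lemma integrable_pair_mult: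
  fixes f :: "'a::euclidean_space \<Rightarrow> complex" and h :: "'b::euclidean_space \<Rightarrow> complex"
  assumes f: "integrable lborel f" and h: "integrable lborel h"
  shows "integrable (lborel \<Otimes>\<^sub>M lborel) (\<lambda>(x, y). f x * h y)"
proof (rule lborel_pair.Fubini_integrable)
  note [measurable] = borel_measurable_integrable[OF f] borel_measurable_integrable[OF h]
  show "(\<lambda>(x, y). f x * h y) \<in> borel_measurable (lborel \<Otimes>\<^sub>M lborel)" by measurable
  show "integrable lborel (\<lambda>x. \<integral>y. cmod (case (x, y) of (x, y) \<Rightarrow> f x * h y) \<partial>lborel)"
    using f by (simp add: norm_mult)
  show "AE x in lborel. integrable lborel (\<lambda>y. case (x, y) of (x, y) \<Rightarrow> f x * h y)"
    using h by simp
qed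

lemma integral_pair_mult:
  fixes f :: "'a::euclidean_space \<Rightarrow> complex" and h :: "'b::euclidean_space \<Rightarrow> complex"
  assumes f: "integrable lborel f" and h: "integrable lborel h"
  shows "(\<integral>z. f (fst z) * h (snd z) \<partial>lborel) = (\<integral>x. f x \<partial>lborel) * (\<integral>y. h y \<partial>lborel)"
proof -
  have "(\<integral>z. f (fst z) * h (snd z) \<partial>lborel) = (\<integral>(x, y). f x * h y \<partial>(lborel \<Otimes>\<^sub>M lborel))"
    by (simp add: lborel_prod split_beta')
  also have "\<dots> = (\<integral>x. (\<integral>y. f x * h y \<partial>lborel) \<partial>lborel)"
    by (rule lborel_pair.integral_fst[symmetric]) (rule integrable_pair_mult[OF f h])
  finally show ?thesis by simp
qed

lemma fourier_L1_mult_formula: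
  assumes f: "integrable lborel f" and h: "integrable lborel h"
  shows "(\<integral>\<xi>. fourier_L1 f \<xi> * h \<xi> \<partial>lborel) = (\<integral>x. f x * fourier_L1 h x \<partial>lborel)"
proof -
  note [measurable] = borel_measurable_integrable[OF f] borel_measurable_integrable[OF h]
  have i: "integrable (lborel \<Otimes>\<^sub>M lborel) (\<lambda>(x, \<xi>). echar (\<xi> \<bullet> x) * (f x * h \<xi>))"
    using integrable_bounded_mult[OF integrable_pair_mult[OF f h], of "\<lambda>(x, \<xi>). echar (\<xi> \<bullet> x)" 1]
    by (simp add: split_beta')
  have "(\<integral>\<xi>. fourier_L1 f \<xi> * h \<xi> \<partial>lborel)
      = (\<integral>\<xi>. (\<integral>x. echar (\<xi> \<bullet> x) * (f x * h \<xi>) \<partial>lborel) \<partial>lborel)"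
    unfolding fourier_L1_echar by (simp flip: mult.assoc)
  also have "\<dots> = (\<integral>x. (\<integral>\<xi>. echar (\<xi> \<bullet> x) * (f x * h \<xi>) \<partial>lborel) \<partial>lborel)"
    by (rule lborel_pair.Fubini_integral[OF i])
  also have "\<dots> = (\<integral>x. f x * fourier_L1 h x \<partial>lborel)"
    unfolding fourier_L1_echar by (simp add: mult.left_commute inner_commute)
  finally show ?thesis .
qed

section \<open>Gaussian regularization and the L2 bound for integrable functions\<close>

definition gauss_ft :: "real \<Rightarrow> real \<times> real \<Rightarrow> real" where
  "gauss_ft \<sigma> \<xi> = exp (- (2 * pi * \<sigma> * fst \<xi>)\<^sup>2 / 2) * exp (- (2 * pi * \<sigma> * snd \<xi>)\<^sup>2 / 2)"

text \<open>The two Gaussians are matched: \<open>gauss_ft \<sigma>\<close> is the Fourier transform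
  of the probability density \<open>gauss \<sigma>\<close>. As \<open>\<sigma>\<close> decreases to
  0 the former tends to 1 pointwise and the latter concentrates at the origin.\<close>

definition gauss :: "real \<Rightarrow> real \<times> real \<Rightarrow> real" where
  "gauss \<sigma> y = normal_density 0 \<sigma> (fst y) * normal_density 0 \<sigma> (snd y)"

lemma gauss_ft_measurable [measurable]: "gauss_ft \<sigma> \<in> borel_measurable borel"
  unfolding gauss_ft_def by measurable

lemma gauss_measurable [measurable]: "gauss \<sigma> \<in> borel_measurable borel"
  unfolding gauss_def by measurable

lemma gauss_ft_nonneg [simp]: "0 \<le> gauss_ft \<sigma> \<xi>" and gauss_ft_le_1: "gauss_ft \<sigma> \<xi> \<le> 1"
  by (auto simp: gauss_ft_def intro!: mult_le_one)

lemma gauss_nonneg [simp]: "0 \<le> gauss \<sigma> y"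
  by (simp add: gauss_def)

lemma gauss_minus: "gauss \<sigma> (- y) = gauss \<sigma> y"
  by (simp add: gauss_def normal_density_def)

text \<open>The integral is the characteristic function of the standard normal law at
  \<open>- y / \<sigma>\<close> after the substitution \<open>x = 2 * pi * \<sigma> * t\<close>; the
  factor \<open>sqrt (2 * pi)\<close> undoes the normalisation of the density.\<close>

lemma fourier_gauss_1:
  assumes \<sigma>: "\<sigma> > 0"
  shows "(\<integral>t. echar (y * t) * of_real (exp (- (2 * pi * \<sigma> * t)\<^sup>2 / 2)) \<partial>lborel) = of_real (normal_density 0 \<sigma> y)"
    and "integrable lborel (\<lambda>t. echar (y * t) * of_real (exp (- (2 * pi * \<sigma> * t)\<^sup>2 / 2)))"
proof -
  define c where "c = 2 * pi * \<sigma>"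
  have c: "c > 0" using \<sigma> by (simp add: c_def)
  define F where "F = (\<lambda>x. of_real (std_normal_density x) * iexp (- y / \<sigma> * x) :: complex)"
  have iF: "integrable lborel F"
    unfolding F_def
    by (rule Bochner_Integration.integrable_bound[of _ "std_normal_density"]) (auto simp: norm_mult)
  have "complex_of_real (exp (- ((- y / \<sigma>)\<^sup>2) / 2)) = char std_normal_distribution (- y / \<sigma>)"
    by (simp add: char_std_normal_distribution)
  also have "\<dots> = (\<integral>x. F x \<partial>lborel)"
    unfolding char_def F_def
    by (subst integral_density) (auto simp: scaleR_conv_of_real)
  also have "\<dots> = \<bar>c\<bar> *\<^sub>R (\<integral>t. F (0 + c * t) \<partial>lborel)"
    using c by (intro lborel_integral_real_affine) simp
  finally have *: "complex_of_real (exp (- ((- y / \<sigma>)\<^sup>2) / 2)) = \<bar>c\<bar> *\<^sub>R (\<integral>t. F (c * t) \<partial>lborel)"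
    by simp
  have eq: "echar (y * t) * of_real (exp (- (2 * pi * \<sigma> * t)\<^sup>2 / 2)) = of_real (sqrt (2 * pi)) * F (c * t)" for t
    using \<sigma> unfolding F_def std_normal_density_def echar_def c_def by (simp add: field_simps)
  have "integrable lborel (\<lambda>t. F (0 + c * t))"
    using c iF by (intro lborel_integrable_real_affine) auto
  then show "integrable lborel (\<lambda>t. echar (y * t) * of_real (exp (- (2 * pi * \<sigma> * t)\<^sup>2 / 2)))"
    unfolding eq by simp
  have "(\<integral>t. echar (y * t) * of_real (exp (- (2 * pi * \<sigma> * t)\<^sup>2 / 2)) \<partial>lborel)
      = of_real (sqrt (2 * pi)) * (\<integral>t. F (c * t) \<partial>lborel)"
    unfolding eq by simp
  also have "(\<integral>t. F (c * t) \<partial>lborel) = of_real (exp (- ((- y / \<sigma>)\<^sup>2) / 2) / c)"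
    using * c by (simp add: field_simps scaleR_conv_of_real)
  also have "of_real (sqrt (2 * pi)) * complex_of_real (exp (- ((- y / \<sigma>)\<^sup>2) / 2) / c)
      = of_real (sqrt (2 * pi) * (exp (- ((- y / \<sigma>)\<^sup>2) / 2) / c))" by simp
  also have "sqrt (2 * pi) * (exp (- ((- y / \<sigma>)\<^sup>2) / 2) / c) = normal_density 0 \<sigma> y"
    using \<sigma> real_sqrt_mult_self[of "2 * pi"] unfolding normal_density_def c_def
    by (simp add: real_sqrt_mult field_simps power_divide)
  finally show "(\<integral>t. echar (y * t) * of_real (exp (- (2 * pi * \<sigma> * t)\<^sup>2 / 2)) \<partial>lborel) = of_real (normal_density 0 \<sigma> y)" .
qed

lemma
  assumes \<sigma>: "\<sigma> > 0"
  shows fourier_L1_gauss_ft: "fourier_L1 (\<lambda>\<xi>. of_real (gauss_ft \<sigma> \<xi>)) y = of_real (gauss \<sigma> y)"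
    and integrable_gauss_ft: "integrable lborel (\<lambda>\<xi>. complex_of_real (gauss_ft \<sigma> \<xi>))"
proof -
  have eq: "echar (y \<bullet> \<xi>) * of_real (gauss_ft \<sigma> \<xi>)
     = (echar (fst y * fst \<xi>) * of_real (exp (- (2 * pi * \<sigma> * fst \<xi>)\<^sup>2 / 2)))
      * (echar (snd y * snd \<xi>) * of_real (exp (- (2 * pi * \<sigma> * snd \<xi>)\<^sup>2 / 2)))" for y \<xi>
    by (simp add: gauss_ft_def inner_prod_def echar_add mult_ac)
  show "fourier_L1 (\<lambda>\<xi>. of_real (gauss_ft \<sigma> \<xi>)) y = of_real (gauss \<sigma> y)"
    unfolding fourier_L1_echar eq
    by (subst integral_pair_mult[OF fourier_gauss_1(2)[OF \<sigma>] fourier_gauss_1(2)[OF \<sigma>]])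
      (simp only: fourier_gauss_1(1)[OF \<sigma>] gauss_def of_real_mult)
  show "integrable lborel (\<lambda>\<xi>. complex_of_real (gauss_ft \<sigma> \<xi>))"
    using integrable_pair_mult[OF fourier_gauss_1(2)[OF \<sigma>, of 0] fourier_gauss_1(2)[OF \<sigma>, of 0]]
    by (simp add: gauss_ft_def lborel_prod split_beta')
qed

lemma nn_integral_gauss: 
  assumes \<sigma>: "\<sigma> > 0" shows "(\<integral>\<^sup>+y. ennreal (gauss \<sigma> y) \<partial>lborel) = 1"
proof -
  have 1: "(\<integral>\<^sup>+y. ennreal (normal_density 0 \<sigma> y) \<partial>lborel) = 1"
    using \<sigma> by (subst nn_integral_eq_integral) auto
  have "(\<integral>\<^sup>+y. ennreal (gauss \<sigma> y) \<partial>lborel)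
     = (\<integral>\<^sup>+z. ennreal (gauss \<sigma> z) \<partial>(lborel \<Otimes>\<^sub>M lborel))"
    by (simp add: lborel_prod)
  also have "\<dots> = (\<integral>\<^sup>+x. \<integral>\<^sup>+y. ennreal (gauss \<sigma> (x, y)) \<partial>lborel \<partial>lborel)"
    by (rule lborel.nn_integral_fst[symmetric]) (simp add: lborel_prod)
  also have "\<dots> = 1"
    by (simp add: gauss_def ennreal_mult nn_integral_cmult nn_integral_multc 1)
  finally show ?thesis .
qed

text \<open>Fourier inversion damped by a Gaussian: the multiplication formula is applied to
  \<open>f\<close> and a modulated Gaussian, whose transform is the Gaussian density centred at
  \<open>x\<close>.\<close>

lemma gauss_regularize:
  assumes f: "integrable lborel f" and \<sigma>: "\<sigma> > 0"
  shows "(\<integral>\<xi>. echar (- (x \<bullet> \<xi>)) * (of_real (gauss_ft \<sigma> \<xi>) * fourier_L1 f \<xi>) \<partial>lborel)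
     = (\<integral>y. f y * of_real (gauss \<sigma> (x - y)) \<partial>lborel)"
proof -
  define h where "h = (\<lambda>\<xi>. echar (- x \<bullet> \<xi>) * complex_of_real (gauss_ft \<sigma> \<xi>))"
  have h: "integrable lborel h"
    unfolding h_def by (intro integrable_echar integrable_gauss_ft \<sigma>)
  have "fourier_L1 h y = of_real (gauss \<sigma> (x - y))" for y
    unfolding h_def fourier_L1_modulate fourier_L1_gauss_ft[OF \<sigma>]
    using gauss_minus[of \<sigma> "x - y"] by simp
  then show ?thesis
    using fourier_L1_mult_formula[OF f h] by (simp add: h_def mult_ac)
qed

text \<open>The damped norm of the transform is the pairing of \<open>f\<close> with the conjugate
  of its own Gaussian average. The kernel is symmetric of mass 1, so Schur's test in its simplest
  form bounds the pairing: \<open>|f x| * |f y|\<close> is at most the mean of the two squares, and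
  each half integrates to half of \<open>L2_sq f\<close>.\<close>

lemma L2_sq_fourier_L1_gauss_ft_le:
  assumes f: "integrable lborel f" and \<sigma>: "\<sigma> > 0"
  shows "(\<integral>\<^sup>+\<xi>. ennreal (gauss_ft \<sigma> \<xi> * (cmod (fourier_L1 f \<xi>))\<^sup>2) \<partial>lborel) \<le> L2_sq f"
proof -
  note [measurable] = borel_measurable_integrable[OF f]
  define h where "h = (\<lambda>\<xi>. complex_of_real (gauss_ft \<sigma> \<xi>) * cnj (fourier_L1 f \<xi>))"
  define B where "B = (\<integral>x. cmod (f x) \<partial>lborel)"
  have B: "cmod (fourier_L1 f \<xi>) \<le> B" for \<xi>
    unfolding B_def by (rule norm_fourier_L1_le[OF f])
  have h: "integrable lborel h"
    unfolding h_def mult.commute[of "complex_of_real _"]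
    by (rule integrable_bounded_mult[where B = B]) (auto simp: integrable_gauss_ft \<sigma> B)
  have fh: "integrable lborel (\<lambda>\<xi>. fourier_L1 f \<xi> * h \<xi>)"
    by (rule integrable_bounded_mult[where B = B]) (auto simp: h B)
  have eq: "fourier_L1 f \<xi> * h \<xi> = of_real (gauss_ft \<sigma> \<xi> * (cmod (fourier_L1 f \<xi>))\<^sup>2)" for \<xi>
    using complex_norm_square[of "fourier_L1 f \<xi>"] by (simp add: h_def mult_ac)
  have hh: "fourier_L1 h x = cnj (\<integral>y. f y * of_real (gauss \<sigma> (x - y)) \<partial>lborel)" for x
    unfolding gauss_regularize[OF f \<sigma>, symmetric]
    by (subst Bochner_Integration.integral_cnj[symmetric], subst fourier_L1_echar) (simp add: h_def cnj_echar)
  have i2: "integrable lborel (\<lambda>x. f x * fourier_L1 h x)"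
    using integrable_bounded_mult[OF f, of "fourier_L1 h"] norm_fourier_L1_le[OF h] h
    by (auto simp: mult.commute)
  have "(\<integral>\<^sup>+\<xi>. ennreal (gauss_ft \<sigma> \<xi> * (cmod (fourier_L1 f \<xi>))\<^sup>2) \<partial>lborel)
      = ennreal (\<integral>\<xi>. gauss_ft \<sigma> \<xi> * (cmod (fourier_L1 f \<xi>))\<^sup>2 \<partial>lborel)"
    using integrable_Re[OF fh] unfolding eq by (intro nn_integral_eq_integral) (auto simp del: of_real_mult of_real_power)
  also have "\<dots> = ennreal (cmod (\<integral>\<xi>. fourier_L1 f \<xi> * h \<xi> \<partial>lborel))"
    unfolding eq integral_complex_of_real norm_of_real by (simp add: Bochner_Integration.integral_nonneg)
  also have "\<dots> = ennreal (cmod (\<integral>x. f x * fourier_L1 h x \<partial>lborel))"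
    by (simp add: fourier_L1_mult_formula[OF f h])
  also have "\<dots> \<le> (\<integral>\<^sup>+x. ennreal (cmod (f x * fourier_L1 h x)) \<partial>lborel)"
    by (rule integral_norm_bound_ennreal[OF i2])
  also have "\<dots> \<le> (\<integral>\<^sup>+x. \<integral>\<^sup>+y. ennreal (cmod (f x)) * ennreal (cmod (f y) * gauss \<sigma> (x - y)) \<partial>lborel \<partial>lborel)"
  proof (rule nn_integral_mono)
    fix x
    have "ennreal (cmod (fourier_L1 h x)) \<le> (\<integral>\<^sup>+y. ennreal (cmod (f y) * gauss \<sigma> (x - y)) \<partial>lborel)"
    proof (cases "integrable lborel (\<lambda>y. f y * of_real (gauss \<sigma> (x - y)))")
      case True
      from integral_norm_bound_ennreal[OF this] show ?thesis
        by (simp add: hh norm_mult)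
    next
      \<comment> \<open>A function that is not integrable has Bochner integral 0, so the bound is
        trivial.\<close>
      case False
      then show ?thesis by (simp add: hh not_integrable_integral_eq)
    qed
    then show "ennreal (cmod (f x * fourier_L1 h x))
        \<le> (\<integral>\<^sup>+y. ennreal (cmod (f x)) * ennreal (cmod (f y) * gauss \<sigma> (x - y)) \<partial>lborel)"
      by (simp add: norm_mult ennreal_mult nn_integral_cmult mult_left_mono)
  qed
  also have "\<dots> \<le> (\<integral>\<^sup>+x. \<integral>\<^sup>+y. ennreal ((cmod (f x))\<^sup>2 / 2) * ennreal (gauss \<sigma> (x - y))
        + ennreal ((cmod (f y))\<^sup>2 / 2) * ennreal (gauss \<sigma> (x - y)) \<partial>lborel \<partial>lborel)"
  proof (intro nn_integral_mono)
    fix x y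
    have "cmod (f x) * cmod (f y) \<le> (cmod (f x))\<^sup>2 / 2 + (cmod (f y))\<^sup>2 / 2"
      using sum_squares_bound[of "cmod (f x)" "cmod (f y)"] by simp
    from mult_right_mono[OF this gauss_nonneg[of \<sigma> "x - y"]]
    show "ennreal (cmod (f x)) * ennreal (cmod (f y) * gauss \<sigma> (x - y))
        \<le> ennreal ((cmod (f x))\<^sup>2 / 2) * ennreal (gauss \<sigma> (x - y))
        + ennreal ((cmod (f y))\<^sup>2 / 2) * ennreal (gauss \<sigma> (x - y))"
      by (simp add: algebra_simps flip: ennreal_mult ennreal_plus)
  qed
  also have "\<dots> = (\<integral>\<^sup>+x. \<integral>\<^sup>+y. ennreal ((cmod (f x))\<^sup>2 / 2) * ennreal (gauss \<sigma> (x - y)) \<partial>lborel \<partial>lborel)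
       + (\<integral>\<^sup>+x. \<integral>\<^sup>+y. ennreal ((cmod (f y))\<^sup>2 / 2) * ennreal (gauss \<sigma> (x - y)) \<partial>lborel \<partial>lborel)"
    by (simp add: nn_integral_add)
  also have "(\<integral>\<^sup>+x. \<integral>\<^sup>+y. ennreal ((cmod (f y))\<^sup>2 / 2) * ennreal (gauss \<sigma> (x - y)) \<partial>lborel \<partial>lborel)
      = (\<integral>\<^sup>+y. \<integral>\<^sup>+x. ennreal ((cmod (f y))\<^sup>2 / 2) * ennreal (gauss \<sigma> (x - y)) \<partial>lborel \<partial>lborel)"
    by (rule lborel_pair.Fubini') simp
  also have "(\<integral>\<^sup>+y. \<integral>\<^sup>+x. ennreal ((cmod (f y))\<^sup>2 / 2) * ennreal (gauss \<sigma> (x - y)) \<partial>lborel \<partial>lborel)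
      = (\<integral>\<^sup>+y. ennreal ((cmod (f y))\<^sup>2 / 2) \<partial>lborel)"
  proof (rule nn_integral_cong)
    fix y
    have "(\<integral>\<^sup>+x. ennreal (gauss \<sigma> (x + (- y))) \<partial>lborel) = 1"
      by (subst nn_integral_lborel_shift) (auto simp: nn_integral_gauss \<sigma>)
    then show "(\<integral>\<^sup>+x. ennreal ((cmod (f y))\<^sup>2 / 2) * ennreal (gauss \<sigma> (x - y)) \<partial>lborel) = ennreal ((cmod (f y))\<^sup>2 / 2)"
      by (simp add: nn_integral_cmult)
  qed
  also have "(\<integral>\<^sup>+x. \<integral>\<^sup>+y. ennreal ((cmod (f x))\<^sup>2 / 2) * ennreal (gauss \<sigma> (x - y)) \<partial>lborel \<partial>lborel)
      = (\<integral>\<^sup>+x. ennreal ((cmod (f x))\<^sup>2 / 2) \<partial>lborel)"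
  proof (rule nn_integral_cong)
    fix x
    have "(\<integral>\<^sup>+y. ennreal (gauss \<sigma> (y + (- x))) \<partial>lborel) = 1"
      by (subst nn_integral_lborel_shift) (auto simp: nn_integral_gauss \<sigma>)
    moreover have "gauss \<sigma> (y + (- x)) = gauss \<sigma> (x - y)" for y
      using gauss_minus[of \<sigma> "x - y"] by simp
    ultimately show "(\<integral>\<^sup>+y. ennreal ((cmod (f x))\<^sup>2 / 2) * ennreal (gauss \<sigma> (x - y)) \<partial>lborel) = ennreal ((cmod (f x))\<^sup>2 / 2)"
      by (simp add: nn_integral_cmult)
  qed
  also have "(\<integral>\<^sup>+x. ennreal ((cmod (f x))\<^sup>2 / 2) \<partial>lborel) + (\<integral>\<^sup>+x. ennreal ((cmod (f x))\<^sup>2 / 2) \<partial>lborel) = L2_sq f"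
    by (simp add: L2_sq_def flip: nn_integral_add ennreal_plus)
  finally show ?thesis .
qed

lemma gauss_ft_tendsto_1: "(\<lambda>n. gauss_ft (1 / real (Suc n)) \<xi>) \<longlonglongrightarrow> 1"
proof -
  have "(\<lambda>n. 1 / real (Suc n)) \<longlonglongrightarrow> 0" by (rule lim_1_over_n[THEN LIMSEQ_Suc])
  then have "(\<lambda>n. gauss_ft (1 / real (Suc n)) \<xi>) \<longlonglongrightarrow> gauss_ft 0 \<xi>"
    unfolding gauss_ft_def by (intro tendsto_intros) auto
  then show ?thesis by (simp add: gauss_ft_def)
qed

text \<open>Fatou's lemma along \<open>\<sigma> = 1 / (n + 1)\<close>: the Gaussian weights tend to
  1 pointwise while the damped integrals stay below \<open>L2_sq f\<close>.\<close>

lemma L2_sq_fourier_L1_le: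
  assumes f: "integrable lborel f"
  shows "L2_sq (fourier_L1 f) \<le> L2_sq f"
proof -
  note [measurable] = borel_measurable_integrable[OF f]
  define u where "u = (\<lambda>n \<xi>. ennreal (gauss_ft (1 / real (Suc n)) \<xi> * (cmod (fourier_L1 f \<xi>))\<^sup>2))"
  have "L2_sq (fourier_L1 f) = (\<integral>\<^sup>+\<xi>. liminf (\<lambda>n. u n \<xi>) \<partial>lborel)"
    unfolding L2_sq_def
  proof (rule nn_integral_cong)
    fix \<xi>
    have "(\<lambda>n. u n \<xi>) \<longlonglongrightarrow> ennreal (1 * (cmod (fourier_L1 f \<xi>))\<^sup>2)"
      unfolding u_def by (intro tendsto_ennrealI tendsto_mult gauss_ft_tendsto_1 tendsto_const)
    from lim_imp_Liminf[OF _ this] show "sq_abs (fourier_L1 f \<xi>) = liminf (\<lambda>n. u n \<xi>)"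
      by simp
  qed
  also have "\<dots> \<le> liminf (\<lambda>n. \<integral>\<^sup>+\<xi>. u n \<xi> \<partial>lborel)"
    by (rule nn_integral_liminf) (simp add: u_def)
  also have "\<dots> \<le> L2_sq f"
    by (rule Liminf_le) (auto simp: u_def L2_sq_fourier_L1_gauss_ft_le[OF f])
  finally show ?thesis .
qed

section \<open>The Fourier transform on L2\<close>

lemma is_fourier_L2_iff:
  "is_fourier_L2 f g \<longleftrightarrow> g \<in> L2 \<and>
     (\<exists>\<phi>. (\<forall>j. integrable lborel (\<phi> j) \<and> \<phi> j \<in> L2) \<and>
          (\<lambda>j::nat. L2_sq (\<lambda>x. \<phi> j x - f x)) \<longlonglongrightarrow> 0 \<and>
          (\<lambda>j. L2_sq (\<lambda>\<xi>. fourier_L1 (\<phi> j) \<xi> - g \<xi>)) \<longlonglongrightarrow> 0)"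
  by (simp add: is_fourier_L2_def L2_norm_L2_sq esqrt_tendsto_0_iff)

lemma is_fourier_L2E:
  assumes "is_fourier_L2 f g"
  obtains \<phi> where "g \<in> L2" "\<And>j. integrable lborel (\<phi> j)" "\<And>j. \<phi> j \<in> L2"
    "(\<lambda>j::nat. L2_sq (\<lambda>x. \<phi> j x - f x)) \<longlonglongrightarrow> 0" "(\<lambda>j. L2_sq (\<lambda>\<xi>. fourier_L1 (\<phi> j) \<xi> - g \<xi>)) \<longlonglongrightarrow> 0"
  using assms unfolding is_fourier_L2_iff by blast

lemma fourier_L1_in_L2: "integrable lborel f \<Longrightarrow> f \<in> L2 \<Longrightarrow> fourier_L1 f \<in> L2"
  using L2_sq_fourier_L1_le[of f] fourier_L1_measurable[of f] by (auto simp: L2_iff)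

lemma is_fourier_L2_L1: "integrable lborel f \<Longrightarrow> f \<in> L2 \<Longrightarrow> is_fourier_L2 f (fourier_L1 f)"
  by (auto simp: is_fourier_L2_iff fourier_L1_in_L2 L2_sq_def intro!: exI[of _ "\<lambda>_. f"])

lemma tendsto_0_ennreal_bound:
  fixes a b c :: "nat \<Rightarrow> ennreal"
  assumes "\<And>j. c j \<le> of_nat m * a j + of_nat n * b j" "a \<longlonglongrightarrow> 0" "b \<longlonglongrightarrow> 0"
  shows "c \<longlonglongrightarrow> 0"
proof (rule tendsto_sandwich[OF _ _ tendsto_const])
  have "(\<lambda>j. of_nat m * a j + of_nat n * b j) \<longlonglongrightarrow> of_nat m * 0 + of_nat n * 0"
    by (intro tendsto_add tendsto_mult_ennreal tendsto_const assms) auto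
  then show "(\<lambda>j. of_nat m * a j + of_nat n * b j) \<longlonglongrightarrow> 0" by simp
qed (use assms in auto)

lemma is_fourier_L2_add:
  assumes f[measurable]: "f \<in> L2" "f' \<in> L2" and F: "is_fourier_L2 f g" "is_fourier_L2 f' g'"
  shows "is_fourier_L2 (\<lambda>x. f x + f' x) (\<lambda>x. g x + g' x)"
proof -
  from F(1) obtain \<phi> where gL: "g \<in> L2"
    and \<phi>: "\<And>j. integrable lborel (\<phi> j)" "\<And>j. \<phi> j \<in> L2"
      "(\<lambda>j::nat. L2_sq (\<lambda>x. \<phi> j x - f x)) \<longlonglongrightarrow> 0" "(\<lambda>j. L2_sq (\<lambda>\<xi>. fourier_L1 (\<phi> j) \<xi> - g \<xi>)) \<longlonglongrightarrow> 0"
    by (rule is_fourier_L2E) blast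
  from F(2) obtain \<phi>' where gL': "g' \<in> L2"
    and \<phi>': "\<And>j. integrable lborel (\<phi>' j)" "\<And>j. \<phi>' j \<in> L2"
      "(\<lambda>j::nat. L2_sq (\<lambda>x. \<phi>' j x - f' x)) \<longlonglongrightarrow> 0" "(\<lambda>j. L2_sq (\<lambda>\<xi>. fourier_L1 (\<phi>' j) \<xi> - g' \<xi>)) \<longlonglongrightarrow> 0"
    by (rule is_fourier_L2E) blast
  note gL = gL gL'
  note [measurable] = gL \<phi>(2) \<phi>'(2)
  show ?thesis
    unfolding is_fourier_L2_iff
  proof (intro conjI exI[of _ "\<lambda>j x. \<phi> j x + \<phi>' j x"] allI)
    show "(\<lambda>x. g x + g' x) \<in> L2" using gL by auto
    fix j show "integrable lborel (\<lambda>x. \<phi> j x + \<phi>' j x)" using \<phi> \<phi>' by auto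
    show "(\<lambda>x. \<phi> j x + \<phi>' j x) \<in> L2" using \<phi> \<phi>' by auto
  next
    show "(\<lambda>j. L2_sq (\<lambda>x. \<phi> j x + \<phi>' j x - (f x + f' x))) \<longlonglongrightarrow> 0"
    proof (rule tendsto_0_ennreal_bound[OF _ \<phi>(3) \<phi>'(3)])
      fix j show "L2_sq (\<lambda>x. \<phi> j x + \<phi>' j x - (f x + f' x))
        \<le> of_nat 2 * L2_sq (\<lambda>x. \<phi> j x - f x) + of_nat 2 * L2_sq (\<lambda>x. \<phi>' j x - f' x)"
        using L2_sq_add_le[of "\<lambda>x. \<phi> j x - f x" "\<lambda>x. \<phi>' j x - f' x"]
        by (simp add: add_diff_add)
    qed
    show "(\<lambda>j. L2_sq (\<lambda>x. fourier_L1 (\<lambda>x. \<phi> j x + \<phi>' j x) x - (g x + g' x))) \<longlonglongrightarrow> 0"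
    proof (rule tendsto_0_ennreal_bound[OF _ \<phi>(4) \<phi>'(4)])
      fix j show "L2_sq (\<lambda>x. fourier_L1 (\<lambda>x. \<phi> j x + \<phi>' j x) x - (g x + g' x))
        \<le> of_nat 2 * L2_sq (\<lambda>x. fourier_L1 (\<phi> j) x - g x) + of_nat 2 * L2_sq (\<lambda>x. fourier_L1 (\<phi>' j) x - g' x)"
        using L2_sq_add_le[of "\<lambda>x. fourier_L1 (\<phi> j) x - g x" "\<lambda>x. fourier_L1 (\<phi>' j) x - g' x"]
        by (simp add: fourier_L1_add \<phi> \<phi>' add_diff_add)
    qed
  qed
qed

text \<open>Carries an approximating sequence of \<open>f\<close> to one of \<open>A f\<close>. The
  operators \<open>A\<close> in space and \<open>B\<close> in frequency are intertwined by the
  Fourier integral, and both are Lipschitz at the given functions. Scalar multiples, modulations and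
  reflections are the instances.\<close>

lemma is_fourier_L2_transfer:
  assumes F: "is_fourier_L2 f g" and B: "B g \<in> L2" and K: "K < \<infinity>"
    and A: "\<And>\<phi>. integrable lborel \<phi> \<Longrightarrow> \<phi> \<in> L2 \<Longrightarrow>
      integrable lborel (A \<phi>) \<and> A \<phi> \<in> L2 \<and> fourier_L1 (A \<phi>) = B (fourier_L1 \<phi>)"
    and A_le: "\<And>\<phi>. \<phi> \<in> L2 \<Longrightarrow> L2_sq (\<lambda>x. A \<phi> x - A f x) \<le> K * L2_sq (\<lambda>x. \<phi> x - f x)"
    and B_le: "\<And>u. u \<in> L2 \<Longrightarrow> L2_sq (\<lambda>x. B u x - B g x) \<le> K * L2_sq (\<lambda>x. u x - g x)"
  shows "is_fourier_L2 (A f) (B g)"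
proof -
  obtain \<phi> where \<phi>: "\<And>j. integrable lborel (\<phi> j)" "\<And>j. \<phi> j \<in> L2"
      "(\<lambda>j::nat. L2_sq (\<lambda>x. \<phi> j x - f x)) \<longlonglongrightarrow> 0" "(\<lambda>j. L2_sq (\<lambda>\<xi>. fourier_L1 (\<phi> j) \<xi> - g \<xi>)) \<longlonglongrightarrow> 0"
    using F by (rule is_fourier_L2E) blast
  have lim: "c \<longlonglongrightarrow> 0" if "\<And>j. c j \<le> K * a j" "a \<longlonglongrightarrow> 0" for a c :: "nat \<Rightarrow> ennreal"
  proof (rule tendsto_sandwich[OF _ _ tendsto_const])
    have "(\<lambda>j. K * a j) \<longlonglongrightarrow> K * 0"
      using K by (intro tendsto_mult_ennreal tendsto_const that) auto
    then show "(\<lambda>j. K * a j) \<longlonglongrightarrow> 0" by simp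
  qed (use that in auto)
  have 1: "(\<lambda>j. L2_sq (\<lambda>x. A (\<phi> j) x - A f x)) \<longlonglongrightarrow> 0"
    by (rule lim[OF A_le[OF \<phi>(2)] \<phi>(3)])
  have 2: "(\<lambda>j. L2_sq (\<lambda>x. B (fourier_L1 (\<phi> j)) x - B g x)) \<longlonglongrightarrow> 0"
    by (rule lim[OF B_le[OF fourier_L1_in_L2[OF \<phi>(1,2)]] \<phi>(4)])
  show ?thesis
    unfolding is_fourier_L2_iff using A[OF \<phi>(1,2)] B 1 2
    by (intro conjI exI[of _ "\<lambda>j. A (\<phi> j)"]) auto
qed

lemma is_fourier_L2_mult:
  assumes f: "f \<in> L2" and F: "is_fourier_L2 f g"
  shows "is_fourier_L2 (\<lambda>x. c * f x) (\<lambda>x. c * g x)"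
proof -
  have g: "g \<in> L2" using F by (simp add: is_fourier_L2_def)
  have le: "L2_sq (\<lambda>x. c * u x - c * v x) \<le> sq_abs c * L2_sq (\<lambda>x. u x - v x)"
    if "u \<in> L2" "v \<in> L2" for u v
    using L2_sq_mult[OF L2_measurable[OF L2_diff[OF that]], of c] by (simp add: right_diff_distrib)
  show ?thesis
    by (rule is_fourier_L2_transfer[OF F, where A = "\<lambda>u x. c * u x" and B = "\<lambda>u x. c * u x"])
      (auto intro: le f g L2_mult simp: fourier_L1_mult)
qed

lemma is_fourier_L2_diff:
  assumes f: "f \<in> L2" "f' \<in> L2" and F: "is_fourier_L2 f g" "is_fourier_L2 f' g'"
  shows "is_fourier_L2 (\<lambda>x. f x - f' x) (\<lambda>x. g x - g' x)"
  using is_fourier_L2_add[OF f(1) L2_mult[OF f(2)] F(1) is_fourier_L2_mult[OF f(2) F(2)], of "-1"]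
  by simp

text \<open>The triangle inequality for squares is applied once in frequency and once in space, each
  time with a factor 2; hence 4 in place of the sharp constant 1.\<close>

lemma is_fourier_L2_bound:
  assumes f[measurable]: "f \<in> L2" and F: "is_fourier_L2 f g"
  shows "L2_sq g \<le> 4 * L2_sq f"
proof -
  from F obtain \<phi> where gL: "g \<in> L2"
    and \<phi>: "\<And>j. integrable lborel (\<phi> j)" "\<And>j. \<phi> j \<in> L2"
      "(\<lambda>j::nat. L2_sq (\<lambda>x. \<phi> j x - f x)) \<longlonglongrightarrow> 0" "(\<lambda>j. L2_sq (\<lambda>\<xi>. fourier_L1 (\<phi> j) \<xi> - g \<xi>)) \<longlonglongrightarrow> 0"
    by (rule is_fourier_L2E) blast
  note [measurable] = gL \<phi>(2)
  have "L2_sq g \<le> 4 * L2_sq f + (4 * L2_sq (\<lambda>x. \<phi> j x - f x) + 2 * L2_sq (\<lambda>\<xi>. fourier_L1 (\<phi> j) \<xi> - g \<xi>))" for j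
  proof -
    have "L2_sq g \<le> 2 * L2_sq (fourier_L1 (\<phi> j)) + 2 * L2_sq (\<lambda>\<xi>. fourier_L1 (\<phi> j) \<xi> - g \<xi>)"
      using L2_sq_diff_le[of "fourier_L1 (\<phi> j)" "\<lambda>\<xi>. fourier_L1 (\<phi> j) \<xi> - g \<xi>"] by simp
    also have "\<dots> \<le> 2 * (2 * L2_sq (\<lambda>x. \<phi> j x - f x) + 2 * L2_sq f) + 2 * L2_sq (\<lambda>\<xi>. fourier_L1 (\<phi> j) \<xi> - g \<xi>)"
      using L2_sq_add_le[of "\<lambda>x. \<phi> j x - f x" f] L2_sq_fourier_L1_le[OF \<phi>(1), of j]
      by (intro add_mono mult_left_mono) auto
    also have "\<dots> = 4 * L2_sq f + (4 * L2_sq (\<lambda>x. \<phi> j x - f x) + 2 * L2_sq (\<lambda>\<xi>. fourier_L1 (\<phi> j) \<xi> - g \<xi>))"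
      by (simp add: algebra_simps)
    finally show ?thesis .
  qed
  moreover have "(\<lambda>j. 4 * L2_sq f + (4 * L2_sq (\<lambda>x. \<phi> j x - f x) + 2 * L2_sq (\<lambda>\<xi>. fourier_L1 (\<phi> j) \<xi> - g \<xi>)))
     \<longlonglongrightarrow> 4 * L2_sq f + (4 * 0 + 2 * 0)"
    by (intro tendsto_add tendsto_mult_ennreal tendsto_const \<phi>) auto
  ultimately show ?thesis by (intro LIMSEQ_le_const[of _ "4 * L2_sq f"]) auto
qed

text \<open>The difference of two candidates is a transform of \<open>f - f\<close>, and the bound
  makes it vanish.\<close>

lemma is_fourier_L2_unique:
  assumes f: "f \<in> L2" and F: "is_fourier_L2 f g" "is_fourier_L2 f g'"
  shows "AE x in lborel. g x = g' x"
proof -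
  have "L2_sq (\<lambda>x. g x - g' x) \<le> 4 * L2_sq (\<lambda>x. f x - f x)"
    by (intro is_fourier_L2_bound is_fourier_L2_diff L2_diff F f)
  then have "L2_sq (\<lambda>x. g x - g' x) = 0" by (simp add: L2_sq_def)
  moreover have "g \<in> borel_measurable borel" "g' \<in> borel_measurable borel"
    using F by (auto simp: is_fourier_L2_def)
  ultimately show ?thesis by (intro L2_sq_diff_eq_0D[of g g'])
qed

text \<open>Completeness for rapidly Cauchy sequences. The weights \<open>4 ^ j\<close> in
  \<open>D\<close> still leave an integrable sum, and where \<open>D\<close> is finite they force
  the increments down to a multiple of \<open>(1/2) ^ j\<close>. So the limit exists there pointwise
  with an explicit rate, which is then integrated.\<close>

lemma L2_complete:
  assumes u: "\<And>j. u j \<in> L2" and d: "\<And>j. L2_sq (\<lambda>x. u (Suc j) x - u j x) \<le> ennreal ((1/16)^j)"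
  shows "\<exists>g\<in>L2. (\<lambda>j. L2_sq (\<lambda>x. u j x - g x)) \<longlonglongrightarrow> 0"
proof -
  note [measurable] = u
  define D where "D = (\<lambda>x. \<Sum>j. ennreal (4^j * (cmod (u (Suc j) x - u j x))\<^sup>2))"
  have [measurable]: "D \<in> borel_measurable borel" unfolding D_def by measurable
  have "(\<integral>\<^sup>+x. D x \<partial>lborel) = (\<Sum>j. ennreal (4^j) * L2_sq (\<lambda>x. u (Suc j) x - u j x))"
    unfolding D_def L2_sq_def by (simp add: nn_integral_suminf ennreal_mult nn_integral_cmult)
  also have "\<dots> \<le> (\<Sum>j. ennreal ((1/4)^j))"
  proof (intro suminf_le)
    fix j
    have "ennreal (4^j) * L2_sq (\<lambda>x. u (Suc j) x - u j x) \<le> ennreal (4^j) * ennreal ((1/16)^j)"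
      by (intro mult_left_mono d) simp
    also have "\<dots> = ennreal ((1/4)^j)"
      by (simp flip: ennreal_mult power_mult_distrib)
    finally show "ennreal (4^j) * L2_sq (\<lambda>x. u (Suc j) x - u j x) \<le> ennreal ((1/4)^j)" .
  qed auto
  also have "\<dots> = ennreal (\<Sum>j. (1/4)^j)"
    by (rule suminf_ennreal2) (auto intro: summable_geometric)
  finally have ID: "(\<integral>\<^sup>+x. D x \<partial>lborel) < \<infinity>"
    by (rule le_less_trans) simp
  have AED: "AE x in lborel. D x \<noteq> \<infinity>"
    using ID by (intro nn_integral_PInf_AE) auto
  \<comment> \<open>Where the sequence diverges the value of \<open>lim\<close> is unspecified; this
    happens only in the null set on which \<open>D\<close> is infinite.\<close>
  define g where "g = (\<lambda>x. lim (\<lambda>j. u j x))"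
  have gm[measurable]: "g \<in> borel_measurable borel"
    unfolding g_def by measurable
  have bd: "(cmod (u j x - g x))\<^sup>2 \<le> 4 * (1/4)^j * enn2real (D x)" if "D x \<noteq> \<infinity>" for x j
  proof -
    define r where "r = sqrt (enn2real (D x))"
    have r0: "0 \<le> r" by (simp add: r_def)
    have pw: "(1/2)^i * (1/2)^i = (1/4::real)^i" for i
      by (subst power_mult_distrib[symmetric]) simp
    have Dr: "D x = ennreal (r\<^sup>2)" using that by (simp add: r_def less_top)
    have c: "cmod (u (Suc i) x - u i x) \<le> r * (1/2)^i" for i
    proof (rule power2_le_imp_le)
      have "ennreal (4^i * (cmod (u (Suc i) x - u i x))\<^sup>2) \<le> D x"
        unfolding D_def by (rule order_trans[OF _ sum_le_suminf[of _ "{i}"]]) auto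
      then have "4^i * (cmod (u (Suc i) x - u i x))\<^sup>2 \<le> r\<^sup>2"
        by (simp add: Dr)
      then have "(cmod (u (Suc i) x - u i x))\<^sup>2 \<le> r\<^sup>2 * (1/4)^i"
        by (simp add: field_simps power_divide)
      also have "\<dots> = (r * (1/2)^i)\<^sup>2"
        using pw[of i] by (simp add: power2_eq_square mult_ac)
      finally show "(cmod (u (Suc i) x - u i x))\<^sup>2 \<le> (r * (1/2)^i)\<^sup>2" .
    qed (use r0 in simp)
    have s1: "summable (\<lambda>i. r * (1/2)^i)" by (intro summable_mult summable_geometric) simp
    have s: "summable (\<lambda>i. u (Suc i) x - u i x)"
      by (rule summable_comparison_test'[OF s1, of 0]) (use c in auto)
    have tel: "(\<lambda>n. \<Sum>i<n. u (Suc i) x - u i x) = (\<lambda>n. u n x - u 0 x)"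
      by (rule ext) (rule sum_lessThan_telescope)
    from s have cv: "convergent (\<lambda>j. u j x)"
      unfolding summable_iff_convergent tel convergent_diff_const_right_iff .
    then have lg: "(\<lambda>j. u j x) \<longlonglongrightarrow> g x" by (simp add: g_def convergent_LIMSEQ_iff)
    have fin: "cmod (u (j + k) x - u j x) \<le> 2 * r * (1/2)^j" for k
    proof -
      \<comment> \<open>The factor \<open>1 - (1/2) ^ k\<close> is that of a partial geometric sum;
        the induction needs this sharper form.\<close>
      have "cmod (u (j + k) x - u j x) \<le> 2 * r * (1/2)^j * (1 - (1/2)^k)"
      proof (induction k)
        case (Suc k)
        have "cmod (u (j + Suc k) x - u j x) \<le> cmod (u (Suc (j + k)) x - u (j + k) x) + cmod (u (j + k) x - u j x)"
          using norm_triangle_ineq[of "u (Suc (j + k)) x - u (j + k) x" "u (j + k) x - u j x"] by simp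
        also have "\<dots> \<le> r * (1/2)^(j+k) + 2 * r * (1/2)^j * (1 - (1/2)^k)"
          by (intro add_mono c Suc)
        also have "\<dots> = 2 * r * (1/2)^j * (1 - (1/2)^Suc k)"
          by (simp add: power_add algebra_simps)
        finally show ?case .
      qed simp
      also have "\<dots> \<le> 2 * r * (1/2)^j * 1"
        using r0 by (intro mult_left_mono) auto
      finally show ?thesis by simp
    qed
    have "cmod (g x - u j x) \<le> 2 * r * (1/2)^j"
    proof (rule LIMSEQ_le_const2)
      show "(\<lambda>k. cmod (u (j + k) x - u j x)) \<longlonglongrightarrow> cmod (g x - u j x)"
        using LIMSEQ_ignore_initial_segment[OF lg, of j]
        by (intro tendsto_intros) (simp add: add.commute)
    qed (use fin in auto)
    then have "(cmod (g x - u j x))\<^sup>2 \<le> (2 * r * (1/2)^j)\<^sup>2" by (intro power_mono) auto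
    also have "\<dots> = 4 * (1/4)^j * r\<^sup>2"
      unfolding pw[of j, symmetric] by (simp add: power2_eq_square)
    finally show ?thesis by (simp add: Dr norm_minus_commute)
  qed
  have sb: "L2_sq (\<lambda>x. u j x - g x) \<le> ennreal (4 * (1/4)^j) * (\<integral>\<^sup>+x. D x \<partial>lborel)" for j
  proof -
    have "L2_sq (\<lambda>x. u j x - g x) \<le> (\<integral>\<^sup>+x. ennreal (4 * (1/4)^j) * D x \<partial>lborel)"
      unfolding L2_sq_def
    proof (rule nn_integral_mono_AE)
      show "AE x in lborel. sq_abs (u j x - g x) \<le> ennreal (4 * (1/4)^j) * D x"
        using AED
      proof eventually_elim
        case (elim x)
        have "sq_abs (u j x - g x) \<le> ennreal (4 * (1/4)^j * enn2real (D x))"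
          by (intro ennreal_leI bd elim)
        also have "\<dots> = ennreal (4 * (1/4)^j) * D x"
          using elim by (simp add: ennreal_mult less_top)
        finally show ?case .
      qed
    qed
    then show ?thesis by (simp add: nn_integral_cmult)
  qed
  have t: "(\<lambda>j. ennreal (4 * (1/4)^j) * (\<integral>\<^sup>+x. D x \<partial>lborel)) \<longlonglongrightarrow> 0"
  proof -
    have "(\<lambda>j. 4 * (1/4::real)^j) \<longlonglongrightarrow> 4 * 0"
      by (intro tendsto_mult tendsto_const LIMSEQ_power_zero) simp
    then have "(\<lambda>j. ennreal (4 * (1/4)^j)) \<longlonglongrightarrow> ennreal (4 * 0)" by (rule tendsto_ennrealI)
    from tendsto_mult_ennreal[OF this tendsto_const, of "\<integral>\<^sup>+x. D x \<partial>lborel"] ID show ?thesis by simp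
  qed
  have lim: "(\<lambda>j. L2_sq (\<lambda>x. u j x - g x)) \<longlonglongrightarrow> 0"
    by (rule tendsto_sandwich[OF _ _ tendsto_const t]) (auto simp: sb)
  have "ennreal (4 * (1/4)^0) * (\<integral>\<^sup>+x. D x \<partial>lborel) < \<infinity>"
    using ID by (simp add: ennreal_mult_less_top)
  with sb[of 0] have "L2_sq (\<lambda>x. u 0 x - g x) < \<infinity>" by (rule le_less_trans)
  then have "(\<lambda>x. u 0 x - g x) \<in> L2" by (simp add: L2_iff)
  from L2_diff[OF u[of 0] this] have "g \<in> L2" by simp
  with lim show ?thesis by blast
qed

section \<open>Truncation, existence of the L2 transform and its elementary rules\<close>

definition trunc :: "nat \<Rightarrow> (real \<times> real \<Rightarrow> complex) \<Rightarrow> real \<times> real \<Rightarrow> complex" where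
  "trunc n f x = indicator (cball 0 (real n)) x * f x"

lemma L2_trunc: "f \<in> L2 \<Longrightarrow> trunc n f \<in> L2"
  unfolding trunc_def[abs_def] by (rule L2_bounded_mult) (auto simp: indicator_def)

text \<open>On \<open>A\<close> the modulus is dominated by \<open>1 + |f|\<^sup>2\<close>, which is
  integrable there because \<open>A\<close> has finite measure.\<close>

lemma integrable_bounded_support_L2:
  assumes [measurable]: "A \<in> sets borel" and A: "emeasure lborel A < \<infinity>" and f: "f \<in> L2"
  shows "integrable lborel (\<lambda>x. indicator A x * f x)"
proof (rule Bochner_Integration.integrable_bound)
  note [measurable] = f
  have "(\<integral>\<^sup>+x. ennreal (norm ((cmod (f x))\<^sup>2)) \<partial>lborel) < \<infinity>"
    using f by (simp add: L2_iff L2_sq_def)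
  then have "integrable lborel (\<lambda>x. (cmod (f x))\<^sup>2)"
    by (intro integrableI_bounded) auto
  then show "integrable lborel (\<lambda>x. indicator A x + (cmod (f x))\<^sup>2 :: real)"
    using A by auto
  have "t \<le> 1 + t\<^sup>2" for t :: real
    using sum_squares_bound[of 1 t] by simp (smt (verit) zero_le_power2)
  then show "AE x in lborel. norm (indicator A x * f x) \<le> norm (indicator A x + (cmod (f x))\<^sup>2 :: real)"
    by (auto simp: indicator_def)
qed (use f in simp)

lemma integrable_trunc: "f \<in> L2 \<Longrightarrow> integrable lborel (trunc n f)"
  unfolding trunc_def[abs_def]
  by (rule integrable_bounded_support_L2) (use emeasure_bounded_finite[of "cball 0 (real n) :: (real \<times> real) set"] in auto)

lemma L2_sq_trunc_tendsto:
  assumes f: "f \<in> L2"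
  shows "(\<lambda>n. L2_sq (\<lambda>x. trunc n f x - f x)) \<longlonglongrightarrow> 0"
proof -
  note [measurable] = f
  have "(\<lambda>n. \<integral>\<^sup>+x. sq_abs (trunc n f x - f x) \<partial>lborel) \<longlonglongrightarrow> (\<integral>\<^sup>+x. 0 \<partial>(lborel :: (real \<times> real) measure))"
  proof (rule nn_integral_dominated_convergence[where w = "\<lambda>x. sq_abs (f x)"])
    show "AE x in lborel. (\<lambda>n. sq_abs (trunc n f x - f x)) \<longlonglongrightarrow> 0"
    proof (intro AE_I2 tendsto_eventually)
      fix x :: "real \<times> real"
      obtain n0 :: nat where "norm x \<le> real n0" using real_arch_simple by blast
      show "eventually (\<lambda>n. sq_abs (trunc n f x - f x) = 0) sequentially"
        by (rule eventually_mono[OF eventually_ge_at_top[of n0]])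
          (use \<open>norm x \<le> real n0\<close> in \<open>auto simp: trunc_def indicator_def\<close>)
    qed
    show "(\<integral>\<^sup>+x. sq_abs (f x) \<partial>lborel) < \<infinity>" using f by (simp add: L2_iff L2_sq_def)
    fix n show "AE x in lborel. sq_abs (trunc n f x - f x) \<le> sq_abs (f x)"
      by (auto simp: trunc_def indicator_def)
    show "(\<lambda>x. sq_abs (trunc n f x - f x)) \<in> borel_measurable lborel"
      using L2_measurable[OF L2_trunc[OF f]] by measurable
  qed simp_all
  then show ?thesis by (simp add: L2_sq_def)
qed

lemma is_fourier_L2_exists:
  assumes f: "f \<in> L2"
  shows "\<exists>g. is_fourier_L2 f g"
proof -
  \<comment> \<open>With errors below \<open>(1/16) ^ j / 4\<close> consecutive truncations differ
    by at most \<open>(1/16) ^ j * (1/2 + 1/32)\<close> in squared norm, within the margin of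
    \<open>L2_complete\<close>.\<close>
  have "\<exists>n. L2_sq (\<lambda>x. trunc n f x - f x) < ennreal ((1/16)^j / 4)" for j
    using order_tendstoD(2)[OF L2_sq_trunc_tendsto[OF f], of "ennreal ((1/16)^j / 4)"]
    by (auto simp: eventually_sequentially)
  then obtain n where n: "\<And>j. L2_sq (\<lambda>x. trunc (n j) f x - f x) < ennreal ((1/16)^j / 4)" by metis
  define \<phi> where "\<phi> = (\<lambda>j. trunc (n j) f)"
  have \<phi>: "\<phi> j \<in> L2" "integrable lborel (\<phi> j)" for j
    by (auto simp: \<phi>_def L2_trunc integrable_trunc f)
  note [measurable] = f \<phi>(1)
  have \<phi>s: "L2_sq (\<lambda>x. \<phi> j x - f x) \<le> ennreal ((1/16)^j / 4)" for j
    using n[of j] by (simp add: \<phi>_def)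
  have tw: "2 * ennreal a + 2 * ennreal b = ennreal (2 * a + 2 * b)" if "0 \<le> a" "0 \<le> b" for a b
    using that by (simp add: ennreal_mult)
  have "\<exists>g\<in>L2. (\<lambda>j. L2_sq (\<lambda>x. fourier_L1 (\<phi> j) x - g x)) \<longlonglongrightarrow> 0"
  proof (rule L2_complete)
    fix j
    show "fourier_L1 (\<phi> j) \<in> L2" by (intro fourier_L1_in_L2 \<phi>)
    have "L2_sq (\<lambda>x. fourier_L1 (\<phi> (Suc j)) x - fourier_L1 (\<phi> j) x)
       = L2_sq (fourier_L1 (\<lambda>x. \<phi> (Suc j) x - \<phi> j x))"
      by (intro arg_cong[where f = L2_sq] ext, simp add: fourier_L1_diff \<phi>)
    also have "\<dots> \<le> L2_sq (\<lambda>x. \<phi> (Suc j) x - \<phi> j x)"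
      by (intro L2_sq_fourier_L1_le) (auto simp: \<phi>)
    also have "\<dots> \<le> 2 * L2_sq (\<lambda>x. \<phi> (Suc j) x - f x) + 2 * L2_sq (\<lambda>x. f x - \<phi> j x)"
      by (rule L2_sq_triangle) auto
    also have "\<dots> \<le> 2 * ennreal ((1/16)^Suc j / 4) + 2 * ennreal ((1/16)^j / 4)"
      by (subst L2_sq_diff_commute[of f]) (intro add_mono mult_left_mono \<phi>s, auto)
    also have "\<dots> = ennreal (2 * ((1/16)^Suc j / 4) + 2 * ((1/16)^j / 4))"
      using tw[of "(1/16)^Suc j / 4" "(1/16)^j / 4"] by simp
    also have "\<dots> \<le> ennreal ((1/16)^j)"
      by (intro ennreal_leI) simp
    finally show "L2_sq (\<lambda>x. fourier_L1 (\<phi> (Suc j)) x - fourier_L1 (\<phi> j) x) \<le> ennreal ((1/16)^j)" .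
  qed
  then obtain g where g: "g \<in> L2" "(\<lambda>j. L2_sq (\<lambda>x. fourier_L1 (\<phi> j) x - g x)) \<longlonglongrightarrow> 0" by blast
  have "(\<lambda>j. (1/16::real)^j / 4) \<longlonglongrightarrow> 0"
    using tendsto_divide[OF LIMSEQ_power_zero[of "1/16::real"] tendsto_const[of "4::real"]] by simp
  then have "(\<lambda>j. ennreal ((1/16)^j / 4)) \<longlonglongrightarrow> ennreal 0" by (rule tendsto_ennrealI)
  then have lim0: "(\<lambda>j. ennreal ((1/16)^j / 4)) \<longlonglongrightarrow> 0" by simp
  have \<phi>lim: "(\<lambda>j. L2_sq (\<lambda>x. \<phi> j x - f x)) \<longlonglongrightarrow> 0"
    by (rule tendsto_sandwich[OF _ _ tendsto_const lim0]) (simp_all add: \<phi>s)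
  show ?thesis
    unfolding is_fourier_L2_iff using g \<phi> \<phi>lim by (intro exI[of _ g] conjI exI[of _ \<phi>]) simp_all
qed

lemma is_fourier_L2_fourier: "f \<in> L2 \<Longrightarrow> is_fourier_L2 f (fourier f)"
  using someI_ex[OF is_fourier_L2_exists, of f] by (simp add: fourier_def)

lemma fourier_in_L2: "f \<in> L2 \<Longrightarrow> fourier f \<in> L2"
  using is_fourier_L2_fourier by (auto simp: is_fourier_L2_def)

lemma fourier_eqI: "f \<in> L2 \<Longrightarrow> is_fourier_L2 f g \<Longrightarrow> AE x in lborel. fourier f x = g x"
  by (rule is_fourier_L2_unique[OF _ is_fourier_L2_fourier])

lemma L2_sq_fourier_le: "f \<in> L2 \<Longrightarrow> L2_sq (fourier f) \<le> 4 * L2_sq f"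
  by (intro is_fourier_L2_bound is_fourier_L2_fourier)

lemma fourier_add:
  "f \<in> L2 \<Longrightarrow> g \<in> L2 \<Longrightarrow> AE x in lborel. fourier (\<lambda>x. f x + g x) x = fourier f x + fourier g x"
  by (intro fourier_eqI is_fourier_L2_add is_fourier_L2_fourier L2_add)

lemma fourier_diff:
  "f \<in> L2 \<Longrightarrow> g \<in> L2 \<Longrightarrow> AE x in lborel. fourier (\<lambda>x. f x - g x) x = fourier f x - fourier g x"
  by (intro fourier_eqI is_fourier_L2_diff is_fourier_L2_fourier L2_diff)

lemma fourier_mult:
  "f \<in> L2 \<Longrightarrow> AE x in lborel. fourier (\<lambda>x. c * f x) x = c * fourier f x"
  by (intro fourier_eqI is_fourier_L2_mult is_fourier_L2_fourier L2_mult)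

lemma fourier_cong_AE:
  assumes "f \<in> L2" "g \<in> L2" "AE x in lborel. f x = g x"
  shows "AE x in lborel. fourier f x = fourier g x"
proof -
  have "L2_sq (\<lambda>x. \<phi> x - f x) = L2_sq (\<lambda>x. \<phi> x - g x)" for \<phi>
    using assms(3) by (intro L2_sq_cong_AE) auto
  then have "is_fourier_L2 f (fourier g)"
    using is_fourier_L2_fourier[OF assms(2)] by (simp add: is_fourier_L2_iff)
  then show ?thesis using assms by (intro fourier_eqI)
qed

lemma fourier_modulate:
  assumes f: "f \<in> L2"
  shows "AE \<xi> in lborel. fourier (\<lambda>x. echar (v \<bullet> x) * f x) \<xi> = fourier f (\<xi> + v)"
proof (rule fourier_eqI)
  have L2: "(\<lambda>x. echar (v \<bullet> x) * u x) \<in> L2" if "u \<in> L2" for u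
    by (intro L2_bounded_mult that) auto
  then show "(\<lambda>x. echar (v \<bullet> x) * f x) \<in> L2" using f .
  have 1: "L2_sq (\<lambda>x. echar (v \<bullet> x) * u x - echar (v \<bullet> x) * f x) \<le> 1 * L2_sq (\<lambda>x. u x - f x)" for u
    by (simp add: L2_sq_def norm_mult flip: right_diff_distrib)
  have 2: "L2_sq (\<lambda>\<xi>. u (\<xi> + v) - fourier f (\<xi> + v)) \<le> 1 * L2_sq (\<lambda>\<xi>. u \<xi> - fourier f \<xi>)"
    if "u \<in> L2" for u
    using L2_sq_shift[OF L2_measurable[OF L2_diff[OF that fourier_in_L2[OF f]]]] by simp
  show "is_fourier_L2 (\<lambda>x. echar (v \<bullet> x) * f x) (\<lambda>\<xi>. fourier f (\<xi> + v))"
    by (rule is_fourier_L2_transfer[OF is_fourier_L2_fourier[OF f], where K = 1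
        and A = "\<lambda>u x. echar (v \<bullet> x) * u x" and B = "\<lambda>u \<xi>. u (\<xi> + v)"])
      (auto simp: L2_shift fourier_in_L2 f integrable_echar fourier_L1_modulate intro: L2 1[simplified] 2[simplified])
qed

lemma fourier_reflect:
  assumes f: "f \<in> L2"
  shows "AE \<xi> in lborel. fourier (\<lambda>x. f (- x)) \<xi> = fourier f (- \<xi>)"
proof (rule fourier_eqI)
  show "(\<lambda>x. f (- x)) \<in> L2" by (intro L2_reflect f)
  have le: "L2_sq (\<lambda>x. u (- x) - w (- x)) \<le> 1 * L2_sq (\<lambda>x. u x - w x)" if "u \<in> L2" "w \<in> L2" for u w
    using L2_sq_reflect[OF L2_measurable[OF L2_diff[OF that]]] by simp
  have int: "integrable lborel (\<lambda>x. \<phi> (- x))" if "integrable lborel \<phi>" "\<phi> \<in> L2" for \<phi> :: "real \<times> real \<Rightarrow> complex"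
  proof (rule integrableI_bounded)
    have "(\<integral>\<^sup>+x. ennreal (cmod (\<phi> (- x))) \<partial>lborel) = (\<integral>\<^sup>+x. ennreal (cmod (\<phi> x)) \<partial>lborel)"
      using L2_measurable[OF that(2)] by (intro nn_integral_lborel_reflect) measurable
    also have "\<dots> < \<infinity>" using that by (simp add: integrable_iff_bounded)
    finally show "(\<integral>\<^sup>+x. ennreal (cmod (\<phi> (- x))) \<partial>lborel) < \<infinity>" .
  qed (use L2_measurable[OF L2_reflect[OF that(2)]] in simp)
  show "is_fourier_L2 (\<lambda>x. f (- x)) (\<lambda>\<xi>. fourier f (- \<xi>))"
    by (rule is_fourier_L2_transfer[OF is_fourier_L2_fourier[OF f], where K = 1
        and A = "\<lambda>u x. u (- x)" and B = "\<lambda>u x. u (- x)"])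
      (auto simp: L2_reflect fourier_in_L2 f fourier_L1_reflect L2_measurable intro: int le[simplified])
qed

section \<open>Fourier inversion on L2\<close>

lemma lborel_integral_affine:
  fixes f :: "real \<times> real \<Rightarrow> complex"
  assumes [measurable]: "f \<in> borel_measurable borel" and c: "c \<noteq> 0"
  shows "(\<integral>x. f x \<partial>lborel) = of_real (c\<^sup>2) * (\<integral>x. f (t + c *\<^sub>R x) \<partial>lborel)"
proof -
  have "(\<integral>x. f x \<partial>lborel)
    = (\<integral>x. f x \<partial>density (distr lborel borel (\<lambda>x. t + c *\<^sub>R x)) (\<lambda>_. ennreal (\<bar>c\<bar> ^ DIM(real \<times> real))))"
    by (subst lborel_affine[OF c, of t]) simp
  also have "\<dots> = of_real (c\<^sup>2) * (\<integral>x. f (t + c *\<^sub>R x) \<partial>lborel)"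
    by (subst integral_density) (auto simp: integral_distr scaleR_conv_of_real power2_eq_square)
  finally show ?thesis .
qed

text \<open>Cauchy--Schwarz against the indicator of \<open>A\<close>.\<close>

lemma L2_limit_integral:
  assumes u: "\<And>n. u n \<in> L2" and w: "w \<in> L2" and lim: "(\<lambda>n. L2_sq (\<lambda>x. u n x - w x)) \<longlonglongrightarrow> 0"
    and [measurable]: "A \<in> sets borel" and A: "emeasure lborel A < \<infinity>"
  shows "(\<lambda>n. \<integral>x. indicator A x * u n x \<partial>lborel) \<longlonglongrightarrow> (\<integral>x. indicator A x * w x \<partial>lborel)"
proof -
  note [measurable] = u w
  define d where "d = (\<lambda>n. (\<integral>x. indicator A x * u n x \<partial>lborel) - (\<integral>x. indicator A x * w x \<partial>lborel))"
  have d: "d n = (\<integral>x. indicator A x * (u n x - w x) \<partial>lborel)" for n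
    unfolding d_def right_diff_distrib
    by (intro Bochner_Integration.integral_diff[symmetric] integrable_bounded_support_L2 u w A) auto
  have le: "sq_abs (d n) \<le> L2_sq (\<lambda>x. u n x - w x) * emeasure lborel A" for n
  proof -
    have "ennreal (cmod (d n)) \<le> (\<integral>\<^sup>+x. ennreal (cmod (indicator A x * (u n x - w x))) \<partial>lborel)"
      unfolding d by (intro integral_norm_bound_ennreal integrable_bounded_support_L2 L2_diff u w A) auto
    also have "\<dots> = (\<integral>\<^sup>+x. ennreal (cmod (u n x - w x)) * indicator A x \<partial>lborel)"
      by (intro nn_integral_cong) (auto simp: indicator_def)
    finally have "(ennreal (cmod (d n)))\<^sup>2 \<le> (\<integral>\<^sup>+x. ennreal (cmod (u n x - w x)) * indicator A x \<partial>lborel)\<^sup>2"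
      by (intro power_mono) auto
    also have "\<dots> \<le> (\<integral>\<^sup>+x. (ennreal (cmod (u n x - w x)))\<^sup>2 \<partial>lborel) * (\<integral>\<^sup>+x. (indicator A x)\<^sup>2 \<partial>lborel)"
      by (rule Cauchy_Schwarz_nn_integral) auto
    also have "(\<integral>\<^sup>+x. (indicator A x :: ennreal)\<^sup>2 \<partial>lborel) = (\<integral>\<^sup>+x. indicator A x \<partial>lborel)"
      by (intro nn_integral_cong) (auto simp: indicator_def)
    finally show ?thesis by (simp add: L2_sq_def ennreal_power)
  qed
  have "(\<lambda>n. L2_sq (\<lambda>x. u n x - w x) * emeasure lborel A) \<longlonglongrightarrow> 0 * emeasure lborel A"
    by (rule tendsto_mult_ennreal[OF lim tendsto_const]) (use A in auto)
  then have lim0: "(\<lambda>n. L2_sq (\<lambda>x. u n x - w x) * emeasure lborel A) \<longlonglongrightarrow> 0" by simp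
  have "(\<lambda>n. sq_abs (d n)) \<longlonglongrightarrow> 0"
    by (rule tendsto_sandwich[OF _ _ tendsto_const lim0]) (simp_all add: le)
  then have "(\<lambda>n. (cmod (d n))\<^sup>2) \<longlonglongrightarrow> 0"
    by (subst tendsto_ennreal_iff[symmetric]) auto
  then have "(\<lambda>n. sqrt ((cmod (d n))\<^sup>2)) \<longlonglongrightarrow> sqrt 0" by (rule tendsto_real_sqrt)
  then have "d \<longlonglongrightarrow> 0" by (simp add: tendsto_norm_zero_iff)
  then show ?thesis unfolding d_def by (rule LIM_zero_cancel)
qed

text \<open>Boxes generate the Borel sets and are stable under intersection, so a Dynkin argument
  extends the vanishing to all Borel sets. It is carried out inside a fixed bounded box
  \<open>K n\<close>, where \<open>v\<close> is integrable and passing to complements is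
  legitimate.\<close>

lemma AE_zero_of_box_integrals:
  assumes v: "v \<in> L2" and 0: "\<And>a b. (\<integral>x. indicator (box a b) x * v x \<partial>lborel) = 0"
  shows "AE x in lborel. v x = 0"
proof -
  note [measurable] = v
  define K where "K = (\<lambda>n. box (- (real n, real n)) (real n, real n))"
  have AEK: "AE x in lborel. indicator (K n) x * v x = 0" for n
  proof (rule sigma_finite_measure.density_zero[OF lborel.sigma_finite_measure_axioms])
    show i: "integrable lborel (\<lambda>x. indicator (K n) x * v x)"
      unfolding K_def by (intro integrable_bounded_support_L2 v) (auto simp: emeasure_lborel_box_eq)
    fix A :: "(real \<times> real) set" assume "A \<in> sets lborel"
    let ?f = "\<lambda>x. indicator (K n) x * v x" and ?G = "range (\<lambda>(a, b). box a b :: (real \<times> real) set)"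
    have borel_eq: "sets borel = sigma_sets UNIV ?G" by (simp add: borel_eq_box)
    have "Int_stable ?G" by (auto simp: Int_stable_def box_Int_box)
    moreover have "?G \<subseteq> Pow UNIV" by simp
    moreover have "A \<in> sigma_sets UNIV ?G" using \<open>A \<in> sets lborel\<close> by (simp add: borel_eq_box)
    ultimately show "set_lebesgue_integral lborel A ?f = 0"
    proof (induction rule: sigma_sets_induct_disjoint[consumes 3])
      case (basic A)
      then obtain a b where A: "A = box a b" by auto
      obtain c d where cd: "box a b \<inter> K n = box c d"
        unfolding K_def box_Int_box by blast
      have "set_lebesgue_integral lborel A ?f = (\<integral>x. indicator (box a b \<inter> K n) x * v x \<partial>lborel)"
        unfolding set_lebesgue_integral_def A
        by (intro Bochner_Integration.integral_cong) (auto simp: indicator_def)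
      then show ?case by (simp add: cd 0)
    next
      case empty
      show ?case by (simp add: set_lebesgue_integral_def)
    next
      case (compl A)
      then have A: "A \<in> sets lborel" using borel_eq by simp
      have "set_lebesgue_integral lborel (UNIV - A) ?f
          = set_lebesgue_integral lborel UNIV ?f - set_lebesgue_integral lborel A ?f"
      proof -
        have "set_lebesgue_integral lborel (A \<union> (UNIV - A)) ?f
          = set_lebesgue_integral lborel A ?f + set_lebesgue_integral lborel (UNIV - A) ?f"
          using A i by (intro set_integral_Un) (auto simp: set_integrable_def intro!: integrable_mult_indicator)
        then show ?thesis by simp
      qed
      moreover have "set_lebesgue_integral lborel UNIV ?f = 0"
        by (simp add: set_lebesgue_integral_def K_def 0)
      ultimately show ?case using compl by simp
    next
      case (union A)
      then have A: "A i \<in> sets lborel" for i using borel_eq by auto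
      have "set_lebesgue_integral lborel (\<Union>i. A i) ?f = (\<Sum>i. set_lebesgue_integral lborel (A i) ?f)"
        using A union(1) i
        by (intro lebesgue_integral_countable_add)
          (auto simp: set_integrable_def disjoint_family_on_def intro!: integrable_mult_indicator)
      then show ?case using union(3) by simp
    qed
  qed
  have "AE x in lborel. \<forall>n. indicator (K n) x * v x = 0"
    unfolding AE_all_countable using AEK by blast
  then show ?thesis
  proof (rule eventually_mono)
    fix x assume x: "\<forall>n. indicator (K n) x * v x = 0"
    obtain n :: nat where "max \<bar>fst x\<bar> \<bar>snd x\<bar> < real n" using reals_Archimedean2 by blast
    then have "x \<in> K n" by (cases x) (auto simp: K_def mem_box Basis_prod_def)
    with x show "v x = 0" by (metis indicator_simps(1) mult_1)
  qed
qed

lemma gauss_scale: "\<sigma> > 0 \<Longrightarrow> \<sigma>\<^sup>2 * gauss \<sigma> (\<sigma> *\<^sub>R s) = gauss 1 s"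
  by (simp add: gauss_def normal_density_def real_sqrt_mult power_mult_distrib power2_eq_square)

lemma integrable_gauss: "\<sigma> > 0 \<Longrightarrow> integrable lborel (gauss \<sigma>)"
  by (rule integrableI_bounded) (simp_all add: nn_integral_gauss)

text \<open>An approximate identity acting on a box. After the substitution
  \<open>z = y - \<sigma> * s\<close> the Gaussian is fixed and the indicator moves. Off the
  boundary of the box the indicator is locally constant at \<open>y\<close>, and dominated
  convergence applies.\<close>

lemma box_gauss_convolution_tendsto:
  assumes \<sigma>: "\<And>n. \<sigma> n > 0" "\<sigma> \<longlonglongrightarrow> 0" and y: "y \<notin> cbox a b - box a b"
  shows "(\<lambda>n. \<integral>z. indicator (box a b) z * of_real (gauss (\<sigma> n) (y - z)) \<partial>lborel)
     \<longlonglongrightarrow> (indicator (box a b) y :: complex)"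
    and "cmod (\<integral>z. indicator (box a b) z * of_real (gauss (\<sigma> n) (y - z)) \<partial>lborel) \<le> 1"
proof -
  have eq: "(\<integral>z. indicator (box a b) z * of_real (gauss (\<sigma> n) (y - z)) \<partial>lborel)
     = (\<integral>s. indicator (box a b) (y + (- \<sigma> n) *\<^sub>R s) * complex_of_real (gauss 1 s) \<partial>lborel)" for n
  proof -
    have "(\<integral>z. indicator (box a b) z * of_real (gauss (\<sigma> n) (y - z)) \<partial>lborel)
      = of_real ((- \<sigma> n)\<^sup>2) * (\<integral>s. indicator (box a b) (y + (- \<sigma> n) *\<^sub>R s)
          * complex_of_real (gauss (\<sigma> n) (y - (y + (- \<sigma> n) *\<^sub>R s))) \<partial>lborel)"
      using \<sigma>(1)[of n] by (intro lborel_integral_affine) auto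
    also have "\<dots> = (\<integral>s. indicator (box a b) (y + (- \<sigma> n) *\<^sub>R s)
          * complex_of_real ((\<sigma> n)\<^sup>2 * gauss (\<sigma> n) (\<sigma> n *\<^sub>R s)) \<partial>lborel)"
      by (subst integral_mult_right_zero[symmetric]) (simp add: mult_ac)
    finally show ?thesis by (simp only: gauss_scale[OF \<sigma>(1)])
  qed
  have ig: "integrable lborel (gauss 1)" by (simp add: integrable_gauss)
  have gi: "(\<integral>s. gauss 1 s \<partial>lborel) = 1"
    using nn_integral_eq_integral[OF ig] by (simp add: nn_integral_gauss)
  show "cmod (\<integral>z. indicator (box a b) z * of_real (gauss (\<sigma> n) (y - z)) \<partial>lborel) \<le> 1"
  proof -
    have "cmod (\<integral>s. indicator (box a b) (y + (- \<sigma> n) *\<^sub>R s) * complex_of_real (gauss 1 s) \<partial>lborel)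
       \<le> (\<integral>s. gauss 1 s \<partial>lborel)"
    proof (rule Bochner_Integration.integral_norm_bound_integral[OF _ ig])
      show "integrable lborel (\<lambda>s. indicator (box a b) (y + (- \<sigma> n) *\<^sub>R s) * complex_of_real (gauss 1 s))"
        by (rule integrable_bounded_mult[where B = 1]) (use ig in \<open>auto simp: indicator_def\<close>)
    qed (auto simp: indicator_def norm_mult)
    then show ?thesis unfolding eq gi .
  qed
  have "(\<lambda>n. \<integral>s. indicator (box a b) (y + (- \<sigma> n) *\<^sub>R s) * complex_of_real (gauss 1 s) \<partial>lborel)
     \<longlonglongrightarrow> (\<integral>s. indicator (box a b) y * complex_of_real (gauss 1 s) \<partial>lborel)"
  proof (rule integral_dominated_convergence[OF _ _ ig])
    show "AE s in lborel. (\<lambda>n. indicator (box a b) (y + (- \<sigma> n) *\<^sub>R s) * complex_of_real (gauss 1 s))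
        \<longlonglongrightarrow> indicator (box a b) y * complex_of_real (gauss 1 s)"
    proof (intro AE_I2 tendsto_mult tendsto_const)
      fix s :: "real \<times> real"
      have lim: "(\<lambda>n. y + (- \<sigma> n) *\<^sub>R s) \<longlonglongrightarrow> y + (- 0) *\<^sub>R s"
        by (intro tendsto_intros \<sigma>)
      have "eventually (\<lambda>n. indicator (box a b) (y + (- \<sigma> n) *\<^sub>R s) = (indicator (box a b) y :: complex)) sequentially"
      proof (cases "y \<in> box a b")
        case True
        with lim have "eventually (\<lambda>n. y + (- \<sigma> n) *\<^sub>R s \<in> box a b) sequentially"
          by (intro topological_tendstoD[OF lim open_box]) simp
        then show ?thesis by eventually_elim (use True in simp)
      next
        case False
        then have "y \<in> - cbox a b" using y by auto
        with lim have "eventually (\<lambda>n. y + (- \<sigma> n) *\<^sub>R s \<in> - cbox a b) sequentially"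
          by (intro topological_tendstoD[OF lim]) auto
        then show ?thesis
          by (rule eventually_mono) (use False box_subset_cbox[of a b] in \<open>auto simp: indicator_def\<close>)
      qed
      then show "(\<lambda>n. indicator (box a b) (y + (- \<sigma> n) *\<^sub>R s)) \<longlonglongrightarrow> (indicator (box a b) y :: complex)"
        by (rule tendsto_eventually)
    qed
    show "AE s in lborel. norm (indicator (box a b) (y + (- \<sigma> n) *\<^sub>R s) * complex_of_real (gauss 1 s)) \<le> gauss 1 s" for n
      by (auto simp: indicator_def norm_mult)
  qed simp_all
  also have "(\<integral>s. indicator (box a b) y * complex_of_real (gauss 1 s) \<partial>lborel) = indicator (box a b) y"
    by (simp add: gi)
  finally show "(\<lambda>n. \<integral>z. indicator (box a b) z * of_real (gauss (\<sigma> n) (y - z)) \<partial>lborel)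
     \<longlonglongrightarrow> (indicator (box a b) y :: complex)" unfolding eq .
qed

text \<open>The reflection is there because \<open>fourier_fourier_L1\<close> evaluates the Gaussian
  average of a box at \<open>- y\<close>.\<close>

lemma AE_not_box_boundary: "AE y in lborel. - y \<notin> cbox a b - box (a :: real \<times> real) b"
proof -
  have "cbox a b - box a b \<in> null_sets lborel"
    by (auto simp: null_sets_def emeasure_Diff emeasure_lborel_box_eq emeasure_lborel_cbox_eq box_subset_cbox
       split: if_splits)
  then have "AE y in lborel. y \<notin> cbox a b - box a b" by (rule AE_not_in)
  then show ?thesis by (rule AE_lborel_reflect)
qed

text \<open>The transform \<open>G\<close> of \<open>g\<close> need not be integrable, so it is
  damped by Gaussians to \<open>h n\<close>. These tend to \<open>G\<close> in L2, hence their
  Fourier integrals tend to \<open>fourier G\<close> in L2. Tested against a box, two uses of the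
  multiplication formula move both transforms off \<open>g\<close>, and what remains is
  \<open>g\<close> against Gaussian averages of the reflected indicator.\<close>

lemma fourier_fourier_L1:
  assumes i: "integrable lborel g" and g: "g \<in> L2"
  shows "AE x in lborel. fourier (fourier_L1 g) x = g (- x)"
proof -
  note [measurable] = g
  define G where "G = fourier_L1 g"
  have G: "G \<in> L2" unfolding G_def by (rule fourier_L1_in_L2[OF i g])
  note [measurable] = G
  define B where "B = (\<integral>x. cmod (g x) \<partial>lborel)"
  have B: "cmod (G \<xi>) \<le> B" for \<xi> unfolding B_def G_def by (rule norm_fourier_L1_le[OF i])
  define \<sigma> where "\<sigma> = (\<lambda>n. 1 / real (Suc n))"
  have \<sigma>: "\<sigma> n > 0" "\<sigma> \<longlonglongrightarrow> 0" for n
    unfolding \<sigma>_def by (simp, rule lim_1_over_n[THEN LIMSEQ_Suc])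
  define h where "h = (\<lambda>n \<xi>. complex_of_real (gauss_ft (\<sigma> n) \<xi>) * G \<xi>)"
  have hL2: "h n \<in> L2" for n
    unfolding h_def by (rule L2_bounded_mult[OF _ _ G]) (auto simp: gauss_ft_le_1)
  have hi: "integrable lborel (h n)" for n
    unfolding h_def mult.commute[of "complex_of_real _"]
    by (rule integrable_bounded_mult[OF integrable_gauss_ft _ B]) (simp_all add: \<sigma>)
  note [measurable] = hL2
  have hG: "(\<lambda>n. L2_sq (\<lambda>\<xi>. h n \<xi> - G \<xi>)) \<longlonglongrightarrow> 0"
  proof -
    have "(\<lambda>n. \<integral>\<^sup>+\<xi>. sq_abs (h n \<xi> - G \<xi>) \<partial>lborel) \<longlonglongrightarrow> (\<integral>\<^sup>+\<xi>. 0 \<partial>(lborel :: (real \<times> real) measure))"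
    proof (rule nn_integral_dominated_convergence[where w = "\<lambda>\<xi>. sq_abs (G \<xi>)"])
      show "AE \<xi> in lborel. (\<lambda>n. sq_abs (h n \<xi> - G \<xi>)) \<longlonglongrightarrow> 0"
      proof (rule AE_I2)
        fix \<xi>
        have "(\<lambda>n. sq_abs (complex_of_real (gauss_ft (\<sigma> n) \<xi>) * G \<xi> - G \<xi>))
           \<longlonglongrightarrow> sq_abs (complex_of_real 1 * G \<xi> - G \<xi>)"
          unfolding \<sigma>_def by (intro tendsto_ennrealI tendsto_intros gauss_ft_tendsto_1)
        then show "(\<lambda>n. sq_abs (h n \<xi> - G \<xi>)) \<longlonglongrightarrow> 0" by (simp add: h_def)
      qed
      show "(\<integral>\<^sup>+x. sq_abs (G x) \<partial>lborel) < \<infinity>" using G by (simp add: L2_iff L2_sq_def)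
      fix n show "AE \<xi> in lborel. sq_abs (h n \<xi> - G \<xi>) \<le> sq_abs (G \<xi>)"
      proof (intro AE_I2 ennreal_leI power_mono)
        fix \<xi>
        have "h n \<xi> - G \<xi> = of_real (gauss_ft (\<sigma> n) \<xi> - 1) * G \<xi>" by (simp add: h_def algebra_simps)
        then have "cmod (h n \<xi> - G \<xi>) = (1 - gauss_ft (\<sigma> n) \<xi>) * cmod (G \<xi>)"
          using gauss_ft_le_1[of "\<sigma> n" \<xi>] by (simp add: norm_mult del: of_real_diff)
        also have "\<dots> \<le> 1 * cmod (G \<xi>)" by (intro mult_right_mono) auto
        finally show "cmod (h n \<xi> - G \<xi>) \<le> cmod (G \<xi>)" by simp
      qed simp
    qed simp_all
    then show ?thesis by (simp add: L2_sq_def)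
  qed
  define w where "w = fourier G"
  have w: "w \<in> L2" unfolding w_def by (rule fourier_in_L2[OF G])
  note [measurable] = w
  have uL2: "fourier_L1 (h n) \<in> L2" for n by (rule fourier_L1_in_L2[OF hi hL2])
  have uw: "(\<lambda>n. L2_sq (\<lambda>x. fourier_L1 (h n) x - w x)) \<longlonglongrightarrow> 0"
  proof (rule tendsto_0_ennreal_bound[OF _ hG hG])
    fix n
    have "is_fourier_L2 (\<lambda>x. h n x - G x) (\<lambda>x. fourier_L1 (h n) x - w x)"
      unfolding w_def
      by (rule is_fourier_L2_diff[OF hL2 G is_fourier_L2_L1[OF hi hL2] is_fourier_L2_fourier[OF G]])
    from is_fourier_L2_bound[OF _ this]
    show "L2_sq (\<lambda>x. fourier_L1 (h n) x - w x) \<le> of_nat 4 * L2_sq (\<lambda>x. h n x - G x) + of_nat 0 * L2_sq (\<lambda>x. h n x - G x)"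
      using hL2 G by auto
  qed
  have box: "(\<integral>x. indicator (box a b) x * (w x - g (- x)) \<partial>lborel) = 0" for a b
  proof -
    let ?I = "indicator (box a b) :: real \<times> real \<Rightarrow> complex"
    have ebox: "emeasure lborel (box a b) < \<infinity>" by (simp add: emeasure_lborel_box_eq)
    have Ii: "integrable lborel ?I"
    proof -
      have "integrable lborel (\<lambda>x. complex_of_real (indicator (box a b) x))"
        using ebox by (intro integrable_of_real) auto
      moreover have "(\<lambda>x. complex_of_real (indicator (box a b) x)) = ?I" by (auto simp: indicator_def)
      ultimately show ?thesis by simp
    qed
    have Ib: "\<exists>C. \<forall>x. cmod (fourier_L1 ?I x) \<le> C" using norm_fourier_L1_le[OF Ii] by blast
    then obtain C where C: "\<And>x. cmod (fourier_L1 ?I x) \<le> C" by blast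
    \<comment> \<open>The Gaussian factor is handed over from the transform of \<open>g\<close> to
      that of the indicator; the product is integrable, so the multiplication formula applies a
      second time.\<close>
    define k where "k = (\<lambda>n \<xi>. complex_of_real (gauss_ft (\<sigma> n) \<xi>) * fourier_L1 ?I \<xi>)"
    have ki: "integrable lborel (k n)" for n
      unfolding k_def mult.commute[of "complex_of_real _"]
      by (rule integrable_bounded_mult[OF integrable_gauss_ft _ C]) (simp_all add: \<sigma>)
    define \<psi> where "\<psi> = (\<lambda>n y. \<integral>z. ?I z * of_real (gauss (\<sigma> n) (- y - z)) \<partial>lborel)"
    have kF: "fourier_L1 (k n) y = \<psi> n y" for n y
      using gauss_regularize[OF Ii \<sigma>(1), of "- y" n] by (subst fourier_L1_echar) (simp add: k_def \<psi>_def)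
    have eq: "(\<integral>x. ?I x * fourier_L1 (h n) x \<partial>lborel) = (\<integral>y. g y * \<psi> n y \<partial>lborel)" for n
    proof -
      have "(\<integral>x. ?I x * fourier_L1 (h n) x \<partial>lborel) = (\<integral>x. h n x * fourier_L1 ?I x \<partial>lborel)"
        using fourier_L1_mult_formula[OF hi Ii, of n] by (simp add: mult.commute)
      also have "\<dots> = (\<integral>x. fourier_L1 g x * k n x \<partial>lborel)"
        by (simp add: h_def k_def G_def mult_ac)
      also have "\<dots> = (\<integral>y. g y * \<psi> n y \<partial>lborel)"
        unfolding fourier_L1_mult_formula[OF i ki] kF ..
      finally show ?thesis .
    qed
    have \<psi>m[measurable]: "\<psi> n \<in> borel_measurable borel" for n
      using fourier_L1_measurable[OF borel_measurable_integrable[OF ki[of n], simplified]]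
      by (simp add: kF[abs_def])
    have "(\<lambda>n. \<integral>y. g y * \<psi> n y \<partial>lborel) \<longlonglongrightarrow> (\<integral>y. g y * ?I (- y) \<partial>lborel)"
    proof (rule integral_dominated_convergence[where w = "\<lambda>y. cmod (g y)"])
      show "AE y in lborel. (\<lambda>n. g y * \<psi> n y) \<longlonglongrightarrow> g y * ?I (- y)"
        using AE_not_box_boundary[of a b]
      proof (rule eventually_mono)
        fix y assume "- y \<notin> cbox a b - box a b"
        from box_gauss_convolution_tendsto(1)[OF \<sigma> this]
        show "(\<lambda>n. g y * \<psi> n y) \<longlonglongrightarrow> g y * ?I (- y)"
          unfolding \<psi>_def by (intro tendsto_mult tendsto_const)
      qed
      fix n show "AE y in lborel. cmod (g y * \<psi> n y) \<le> cmod (g y)"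
        using AE_not_box_boundary[of a b]
      proof (rule eventually_mono)
        fix y assume "- y \<notin> cbox a b - box a b"
        from box_gauss_convolution_tendsto(2)[OF \<sigma> this, of n]
        show "cmod (g y * \<psi> n y) \<le> cmod (g y)"
          unfolding \<psi>_def norm_mult by (rule mult_left_le) simp
      qed
    qed (use i in auto)
    then have "(\<lambda>n. \<integral>x. ?I x * fourier_L1 (h n) x \<partial>lborel) \<longlonglongrightarrow> (\<integral>y. g y * ?I (- y) \<partial>lborel)"
      unfolding eq .
    moreover have "(\<lambda>n. \<integral>x. ?I x * fourier_L1 (h n) x \<partial>lborel) \<longlonglongrightarrow> (\<integral>x. ?I x * w x \<partial>lborel)"
      by (rule L2_limit_integral[OF uL2 w uw _ ebox]) simp
    ultimately have "(\<integral>x. ?I x * w x \<partial>lborel) = (\<integral>y. g y * ?I (- y) \<partial>lborel)"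
      by (rule LIMSEQ_unique[rotated])
    also have "\<dots> = (\<integral>x. ?I x * g (- x) \<partial>lborel)"
      using lborel_integral_reflect[of "\<lambda>y. ?I y * g (- y)"] L2_measurable[OF L2_reflect[OF g]]
      by (simp add: mult.commute)
    finally have "(\<integral>x. ?I x * w x \<partial>lborel) - (\<integral>x. ?I x * g (- x) \<partial>lborel) = 0" by simp
    moreover have "(\<integral>x. ?I x * w x \<partial>lborel) - (\<integral>x. ?I x * g (- x) \<partial>lborel)
       = (\<integral>x. ?I x * (w x - g (- x)) \<partial>lborel)"
      unfolding right_diff_distrib
      by (intro Bochner_Integration.integral_diff[symmetric] integrable_bounded_support_L2 w L2_reflect g ebox) auto
    ultimately show ?thesis by simp
  qed
  have "AE x in lborel. w x - g (- x) = 0"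
    by (intro AE_zero_of_box_integrals box L2_diff w L2_reflect g)
  then show ?thesis by (simp add: w_def G_def)
qed

text \<open>Both sides depend continuously on \<open>g\<close> in L2, and truncations are dense and
  covered by \<open>fourier_fourier_L1\<close>. The constant is \<open>34 = 2 * (4 * 4) + 2\<close>:
  the bound for the transform used twice, then one triangle inequality.\<close>

lemma fourier_fourier:
  assumes g: "g \<in> L2"
  shows "AE x in lborel. fourier (fourier g) x = g (- x)"
proof -
  define \<phi> where "\<phi> = (\<lambda>n. trunc n g)"
  have \<phi>: "\<phi> n \<in> L2" "integrable lborel (\<phi> n)" for n
    by (auto simp: \<phi>_def L2_trunc integrable_trunc g)
  define w where "w = fourier (fourier g)"
  have w: "w \<in> L2" unfolding w_def by (intro fourier_in_L2 g)
  have Fg: "fourier g \<in> L2" by (intro fourier_in_L2 g)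
  have F\<phi>: "fourier_L1 (\<phi> n) \<in> L2" for n by (intro fourier_L1_in_L2 \<phi>)
  have gr: "(\<lambda>x. g (- x)) \<in> L2" by (intro L2_reflect g)
  have \<phi>r: "(\<lambda>x. \<phi> n (- x)) \<in> L2" for n by (intro L2_reflect \<phi>)
  note [measurable] = g w \<phi>(1) L2_measurable[OF gr] L2_measurable[OF \<phi>r]
  have "L2_sq (\<lambda>x. w x - g (- x)) \<le> 34 * L2_sq (\<lambda>x. \<phi> n x - g x)" for n
  proof -
    have 1: "is_fourier_L2 (\<lambda>x. g x - \<phi> n x) (\<lambda>x. fourier g x - fourier_L1 (\<phi> n) x)"
      by (intro is_fourier_L2_diff is_fourier_L2_fourier is_fourier_L2_L1 \<phi> g)
    have 2: "is_fourier_L2 (\<lambda>x. fourier g x - fourier_L1 (\<phi> n) x) (\<lambda>x. w x - fourier (fourier_L1 (\<phi> n)) x)"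
      unfolding w_def by (intro is_fourier_L2_diff is_fourier_L2_fourier Fg F\<phi>)
    have "L2_sq (\<lambda>x. w x - fourier (fourier_L1 (\<phi> n)) x) \<le> 4 * L2_sq (\<lambda>x. fourier g x - fourier_L1 (\<phi> n) x)"
      by (intro is_fourier_L2_bound[OF _ 2] L2_diff Fg F\<phi>)
    also have "\<dots> \<le> 4 * (4 * L2_sq (\<lambda>x. g x - \<phi> n x))"
      by (intro mult_left_mono is_fourier_L2_bound[OF _ 1] L2_diff g \<phi>) simp
    also have "L2_sq (\<lambda>x. w x - fourier (fourier_L1 (\<phi> n)) x) = L2_sq (\<lambda>x. w x - \<phi> n (- x))"
      using fourier_fourier_L1[OF \<phi>(2,1), of n] by (intro L2_sq_cong_AE) auto
    finally have 3: "L2_sq (\<lambda>x. w x - \<phi> n (- x)) \<le> 16 * L2_sq (\<lambda>x. \<phi> n x - g x)"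
      by (simp add: L2_sq_diff_commute[of g] mult.assoc[symmetric])
    have 4: "L2_sq (\<lambda>x. \<phi> n (- x) - g (- x)) = L2_sq (\<lambda>x. \<phi> n x - g x)"
      by (rule L2_sq_reflect[of "\<lambda>x. \<phi> n x - g x"]) simp
    have "L2_sq (\<lambda>x. w x - g (- x)) \<le> 2 * L2_sq (\<lambda>x. w x - \<phi> n (- x)) + 2 * L2_sq (\<lambda>x. \<phi> n (- x) - g (- x))"
      by (rule L2_sq_triangle) simp_all
    also have "\<dots> \<le> 2 * (16 * L2_sq (\<lambda>x. \<phi> n x - g x)) + 2 * L2_sq (\<lambda>x. \<phi> n x - g x)"
      unfolding 4 by (intro add_mono mult_left_mono 3) auto
    also have "\<dots> = (2 * 16 + 2) * L2_sq (\<lambda>x. \<phi> n x - g x)"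
      by (simp only: distrib_right mult.assoc)
    finally show ?thesis by simp
  qed
  moreover have "(\<lambda>n. 34 * L2_sq (\<lambda>x. \<phi> n x - g x)) \<longlonglongrightarrow> 34 * 0"
    unfolding \<phi>_def by (intro tendsto_mult_ennreal tendsto_const L2_sq_trunc_tendsto g) auto
  ultimately have "L2_sq (\<lambda>x. w x - g (- x)) \<le> 34 * 0"
    by (intro LIMSEQ_le_const) auto
  then have "AE x in lborel. w x = g (- x)"
    by (intro L2_sq_diff_eq_0D) (use w gr in auto)
  then show ?thesis by (simp add: w_def)
qed

text \<open>By inversion the reflected transform qualifies for the choice in
  \<open>fourier_inv\<close>. Whatever is chosen has transform \<open>g\<close> almost everywhere;
  transforming once more and inverting identifies it with the reflected transform.\<close>

lemma
  assumes g: "g \<in> L2"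
  shows fourier_inv_in_L2: "fourier_inv g \<in> L2"
    and fourier_inv_AE: "AE x in lborel. fourier_inv g x = fourier g (- x)"
proof -
  let ?h = "\<lambda>x. fourier g (- x)"
  have hL: "?h \<in> L2" by (intro L2_reflect fourier_in_L2 g)
  have "AE \<xi> in lborel. fourier ?h \<xi> = fourier (fourier g) (- \<xi>)"
    by (intro fourier_reflect fourier_in_L2 g)
  moreover have "AE \<xi> in lborel. fourier (fourier g) (- \<xi>) = g (- (- \<xi>))"
    by (rule AE_lborel_reflect[OF fourier_fourier[OF g]])
  ultimately have "AE \<xi> in lborel. fourier ?h \<xi> = g \<xi>" by auto
  with hL have "?h \<in> L2 \<and> (AE \<xi> in lborel. fourier ?h \<xi> = g \<xi>)" by blast
  then have *: "fourier_inv g \<in> L2 \<and> (AE \<xi> in lborel. fourier (fourier_inv g) \<xi> = g \<xi>)"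
    unfolding fourier_inv_def by (rule someI[where x = ?h])
  then show L: "fourier_inv g \<in> L2" by simp
  have "AE x in lborel. fourier (fourier (fourier_inv g)) x = fourier g x"
    using * by (intro fourier_cong_AE fourier_in_L2 g) auto
  moreover have "AE x in lborel. fourier (fourier (fourier_inv g)) x = fourier_inv g (- x)"
    by (rule fourier_fourier[OF L])
  ultimately have "AE x in lborel. fourier_inv g (- x) = fourier g x" by auto
  from AE_lborel_reflect[OF this] show "AE x in lborel. fourier_inv g x = fourier g (- x)" by simp
qed

lemma L2_sq_fourier_inv_le: "g \<in> L2 \<Longrightarrow> L2_sq (fourier_inv g) \<le> 4 * L2_sq g"
  using L2_sq_cong_AE[OF fourier_inv_AE, of g] L2_sq_reflect[of "fourier g"] L2_sq_fourier_le[of g]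
    L2_measurable[OF fourier_in_L2, of g]
  by simp

lemma fourier_inv_add:
  "f \<in> L2 \<Longrightarrow> g \<in> L2 \<Longrightarrow> AE x in lborel. fourier_inv (\<lambda>x. f x + g x) x = fourier_inv f x + fourier_inv g x"
  using fourier_inv_AE[OF L2_add, of f g] fourier_inv_AE[of f] fourier_inv_AE[of g] AE_lborel_reflect[OF fourier_add, of f g]
  by auto

lemma fourier_inv_mult:
  "f \<in> L2 \<Longrightarrow> AE x in lborel. fourier_inv (\<lambda>x. c * f x) x = c * fourier_inv f x"
  using fourier_inv_AE[OF L2_mult, of f c] fourier_inv_AE[of f] AE_lborel_reflect[OF fourier_mult, of f c]
  by auto

lemma fourier_inv_diff:
  "f \<in> L2 \<Longrightarrow> g \<in> L2 \<Longrightarrow> AE x in lborel. fourier_inv (\<lambda>x. f x - g x) x = fourier_inv f x - fourier_inv g x"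
  using fourier_inv_AE[OF L2_diff, of f g] fourier_inv_AE[of f] fourier_inv_AE[of g] AE_lborel_reflect[OF fourier_diff, of f g]
  by auto

lemma fourier_inv_modulate:
  assumes f: "f \<in> L2"
  shows "AE x in lborel. fourier_inv (\<lambda>\<xi>. echar (v \<bullet> \<xi>) * f \<xi>) x = fourier_inv f (x - v)"
proof -
  have m: "(\<lambda>\<xi>. echar (v \<bullet> \<xi>) * f \<xi>) \<in> L2" by (intro L2_bounded_mult f) auto
  have "AE x in lborel. fourier_inv f (x + (- v)) = fourier f (- (x + (- v)))"
    by (rule AE_lborel_shift[OF fourier_inv_AE[OF f]])
  with fourier_inv_AE[OF m] AE_lborel_reflect[OF fourier_modulate[OF f, of v]]
  show ?thesis by eventually_elim (simp add: algebra_simps)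
qed

section \<open>Maximal averages along a translation\<close>

locale translation_averages =
  fixes a :: "real \<times> real \<Rightarrow> real" and v :: "real \<times> real"
  assumes a_meas [measurable]: "a \<in> borel_measurable borel" and a_nonneg: "\<And>x. 0 \<le> a x"
begin

definition S :: "nat \<Rightarrow> real \<times> real \<Rightarrow> real" where
  "S k x = (\<Sum>l<k. a (x + real l *\<^sub>R v))"

definition F :: "nat \<Rightarrow> real \<times> real \<Rightarrow> real" where
  "F n x = Max ((\<lambda>k. S k x / real k) ` {1..Suc n})"

definition h :: "nat \<Rightarrow> real \<Rightarrow> real \<times> real \<Rightarrow> real" where
  "h n t x = Max ((\<lambda>k. S k x - real k * t) ` {0..Suc n})"

lemma S_0 [simp]: "S 0 x = 0"
  by (simp add: S_def)

lemma S_Suc: "S (Suc k) x = a x + S k (x + v)"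
  unfolding S_def by (subst sum.lessThan_Suc_shift) (simp add: algebra_simps scaleR_add_left)

lemma S_nonneg: "0 \<le> S k x"
  by (simp add: S_def sum_nonneg a_nonneg)

lemma S_measurable [measurable]: "S k \<in> borel_measurable borel"
  unfolding S_def by measurable

lemma F_measurable [measurable]: "F n \<in> borel_measurable borel"
  unfolding F_def by measurable

lemma F_nonneg: "0 \<le> F n x"
proof -
  have "0 \<le> S 1 x / real 1" by (simp add: S_nonneg)
  also have "\<dots> \<le> F n x" unfolding F_def by (intro Max_ge image_eqI[of _ _ 1]) auto
  finally show ?thesis .
qed

lemma h_ge: "k \<le> Suc n \<Longrightarrow> S k x - real k * t \<le> h n t x"
  unfolding h_def by (intro Max_ge) auto

lemma h_nonneg: "0 \<le> h n t x"
  using h_ge[of 0 n x t] by simp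

text \<open>The pointwise form of Hopf's maximal ergodic lemma: the maximiser in \<open>h n t x\<close> uses the
  first summand \<open>a x\<close> exactly where the maximal average reaches the level \<open>t\<close>.\<close>

lemma hopf_pointwise:
  assumes "0 \<le> t"
  shows "h n t x + t * indicator {0..F n x} t \<le> a x * indicator {0..F n x} t + h n t (x + v)"
proof (cases "t \<le> F n x")
  case True
  have "F n x \<in> (\<lambda>k. S k x / real k) ` {1..Suc n}"
    unfolding F_def by (intro Max_in) auto
  then obtain k where k: "1 \<le> k" "k \<le> Suc n" "F n x = S k x / real k" by auto
  have k0: "0 \<le> S k x - real k * t" using True k by (simp add: field_simps)
  have "h n t x \<in> (\<lambda>k. S k x - real k * t) ` {0..Suc n}"
    unfolding h_def by (intro Max_in) auto
  then obtain j where j: "j \<le> Suc n" "h n t x = S j x - real j * t" by auto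
  obtain i where i: "1 \<le> i" "i \<le> Suc n" "h n t x \<le> S i x - real i * t"
  proof (cases "j = 0")
    case True
    then show ?thesis using that[of k] k k0 j by simp
  next
    case False
    then show ?thesis using that[of j] j by simp
  qed
  obtain m where m: "i = Suc m" using i(1) by (cases i) auto
  have "h n t x + t \<le> a x + (S m (x + v) - real m * t)"
    using i(3) by (simp add: m S_Suc algebra_simps)
  also have "\<dots> \<le> a x + h n t (x + v)"
    using i(2) m by (intro add_left_mono h_ge) auto
  finally show ?thesis using True assms by simp
next
  case False
  have "S k x - real k * t \<le> 0" if "k \<le> Suc n" for k
  proof (cases "k = 0")
    case False
    then have "S k x / real k \<le> F n x"
      unfolding F_def using that by (intro Max_ge) auto
    with \<open>\<not> t \<le> F n x\<close> have "S k x / real k \<le> t" by simp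
    then show ?thesis using False by (simp add: field_simps)
  qed simp
  then have "h n t x \<le> 0" unfolding h_def by (intro Max.boundedI) auto
  then show ?thesis using False h_nonneg[of n t "x + v"] by simp
qed

text \<open>Integration over all levels \<open>t\<close> turns Hopf's lemma into an L2 statement in
  one stroke, in place of a weak-type bound and its distribution function: the term \<open>t\<close>
  contributes \<open>F\<^sup>2 / 2\<close> and the term \<open>a\<close> contributes
  \<open>a * F\<close>.\<close>

definition \<Psi> :: "nat \<Rightarrow> real \<times> real \<Rightarrow> ennreal" where
  "\<Psi> n x = (\<integral>\<^sup>+t. ennreal (h n t x) * indicator {0..} t \<partial>lborel)"

lemma h_measurable [measurable]: "(\<lambda>(t, x). h n t x) \<in> borel_measurable (borel \<Otimes>\<^sub>M borel)"
  unfolding h_def by measurable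

lemma h_measurable1 [measurable]: "(\<lambda>t. h n t x) \<in> borel_measurable borel"
  unfolding h_def by measurable

lemma \<Psi>_measurable [measurable]: "\<Psi> n \<in> borel_measurable borel"
  unfolding \<Psi>_def by measurable

lemma nn_integral_id_Icc: 
  assumes "0 \<le> c" shows "(\<integral>\<^sup>+t. ennreal t * indicator {0..c} t \<partial>lborel) = ennreal (c\<^sup>2 / 2)"
proof -
  have "((\<lambda>t. t\<^sup>2 / 2) has_real_derivative x) (at x)" for x :: real
    by (auto intro!: derivative_eq_intros)
  then show ?thesis
    using nn_integral_FTC_Icc[of "\<lambda>t. t" 0 c "\<lambda>t. t\<^sup>2 / 2"] assms by simp
qed

lemma \<Psi>_ineq: "\<Psi> n x + ennreal ((F n x)\<^sup>2 / 2) \<le> ennreal (a x * F n x) + \<Psi> n (x + v)"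
proof -
  have "\<Psi> n x + ennreal ((F n x)\<^sup>2 / 2)
     = (\<integral>\<^sup>+t. ennreal (h n t x) * indicator {0..} t + ennreal t * indicator {0..F n x} t \<partial>lborel)"
    unfolding \<Psi>_def nn_integral_id_Icc[OF F_nonneg, symmetric] by (simp add: nn_integral_add)
  also have "\<dots> \<le> (\<integral>\<^sup>+t. ennreal (a x) * indicator {0..F n x} t + ennreal (h n t (x + v)) * indicator {0..} t \<partial>lborel)"
  proof (rule nn_integral_mono)
    fix t :: real
    show "ennreal (h n t x) * indicator {0..} t + ennreal t * indicator {0..F n x} t
       \<le> ennreal (a x) * indicator {0..F n x} t + ennreal (h n t (x + v)) * indicator {0..} t"
    proof (cases "0 \<le> t")
      case True
      from hopf_pointwise[OF this, of n x] True h_nonneg a_nonneg show ?thesis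
        by (auto simp: indicator_def ennreal_plus[symmetric] ennreal_leI simp del: ennreal_plus split: if_splits)
    qed (simp add: indicator_def)
  qed
  also have "\<dots> = ennreal (a x) * ennreal (F n x) + \<Psi> n (x + v)"
    using F_nonneg[of n x] by (simp add: nn_integral_add nn_integral_cmult \<Psi>_def)
  finally show ?thesis by (simp add: ennreal_mult a_nonneg F_nonneg)
qed

lemma nn_integral_S_square_finite:
  assumes "(\<integral>\<^sup>+x. ennreal ((a x)\<^sup>2) \<partial>lborel) < \<infinity>"
  shows "(\<integral>\<^sup>+x. ennreal ((S k x)\<^sup>2) \<partial>lborel) < \<infinity>"
proof -
  have "(\<integral>\<^sup>+x. ennreal ((S k x)\<^sup>2) \<partial>lborel) \<le> (\<integral>\<^sup>+x. ennreal (real k) * (\<Sum>l<k. ennreal ((a (x + real l *\<^sub>R v))\<^sup>2)) \<partial>lborel)"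
  proof (rule nn_integral_mono)
    fix x
    have "(S k x)\<^sup>2 \<le> real (card {..<k}) * (\<Sum>l<k. (a (x + real l *\<^sub>R v))\<^sup>2)"
      using Cauchy_Schwarz_ineq_sum[of "\<lambda>_. 1" "\<lambda>l. a (x + real l *\<^sub>R v)" "{..<k}"]
      by (simp add: S_def)
    then show "ennreal ((S k x)\<^sup>2) \<le> ennreal (real k) * (\<Sum>l<k. ennreal ((a (x + real l *\<^sub>R v))\<^sup>2))"
      by (simp add: sum_ennreal sum_nonneg ennreal_leI flip: ennreal_mult)
  qed
  also have "\<dots> = ennreal (real k) * (\<Sum>l<k. \<integral>\<^sup>+x. ennreal ((a (x + real l *\<^sub>R v))\<^sup>2) \<partial>lborel)"
    by (simp add: nn_integral_cmult nn_integral_sum del: sum_ennreal)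
  also have "\<dots> = ennreal (real k) * (\<Sum>l<k. \<integral>\<^sup>+x. ennreal ((a x)\<^sup>2) \<partial>lborel)"
    by (intro arg_cong2[where f = "(*)"] sum.cong refl nn_integral_lborel_shift[where f = "\<lambda>x. ennreal ((a x)\<^sup>2)"]) simp
  also have "\<dots> < \<infinity>" using assms by (simp add: ennreal_mult_less_top of_nat_less_top)
  finally show ?thesis .
qed

text \<open>Finiteness permits cancelling the integral of \<open>\<Psi> n\<close> from both sides of
  the integrated inequality.\<close>

lemma \<Psi>_finite:
  assumes "(\<integral>\<^sup>+x. ennreal ((a x)\<^sup>2) \<partial>lborel) < \<infinity>"
  shows "(\<integral>\<^sup>+x. \<Psi> n x \<partial>lborel) < \<infinity>"
proof -
  have "\<Psi> n x \<le> (\<Sum>k\<le>Suc n. ennreal ((S k x)\<^sup>2))" for x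
  proof -
    have "\<Psi> n x \<le> (\<integral>\<^sup>+t. (\<Sum>k\<le>Suc n. ennreal (S k x) * indicator {0..S k x} t) \<partial>lborel)"
      unfolding \<Psi>_def
    proof (rule nn_integral_mono)
      fix t :: real
      have "h n t x \<in> (\<lambda>k. S k x - real k * t) ` {0..Suc n}"
        unfolding h_def by (intro Max_in) auto
      then obtain k where k: "k \<le> Suc n" "h n t x = S k x - real k * t" by auto
      \<comment> \<open>A positive value requires \<open>k \<ge> 1\<close>, and then
        \<open>t \<le> k * t < S k x\<close>, so the level lies in
        \<open>{0..S k x}\<close>.\<close>
      have "ennreal (h n t x) * indicator {0..} t \<le> ennreal (S k x) * indicator {0..S k x} t"
      proof (cases "0 \<le> t \<and> 0 < h n t x")
        case True
        then have "k \<noteq> 0" using k(2) by (auto intro: gr0I)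
        then have "1 * t \<le> real k * t" using True by (intro mult_right_mono) auto
        with True k show ?thesis by (auto simp: indicator_def intro!: ennreal_leI)
      next
        case False
        then show ?thesis using h_nonneg[of n t x] by (auto simp: indicator_def)
      qed
      also have "\<dots> \<le> (\<Sum>k\<le>Suc n. ennreal (S k x) * indicator {0..S k x} t)"
        using k(1) by (intro member_le_sum) auto
      finally show "ennreal (h n t x) * indicator {0..} t \<le> (\<Sum>k\<le>Suc n. ennreal (S k x) * indicator {0..S k x} t)" .
    qed
    also have "\<dots> = (\<Sum>k\<le>Suc n. ennreal (S k x) * ennreal (S k x))"
      by (subst nn_integral_sum) (simp_all add: nn_integral_cmult S_nonneg del: sum.atMost_Suc)
    finally show ?thesis by (simp add: power2_eq_square ennreal_mult S_nonneg del: sum.atMost_Suc)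
  qed
  then have "(\<integral>\<^sup>+x. \<Psi> n x \<partial>lborel) \<le> (\<integral>\<^sup>+x. (\<Sum>k\<le>Suc n. ennreal ((S k x)\<^sup>2)) \<partial>lborel)"
    by (intro nn_integral_mono) auto
  also have "\<dots> = (\<Sum>k\<le>Suc n. \<integral>\<^sup>+x. ennreal ((S k x)\<^sup>2) \<partial>lborel)"
    by (rule nn_integral_sum) simp
  also have "\<dots> < \<infinity>" using nn_integral_S_square_finite[OF assms] by (simp add: ennreal_sum_less_top del: sum.atMost_Suc)
  finally show ?thesis .
qed

text \<open>Young's inequality \<open>a * F \<le> a\<^sup>2 + F\<^sup>2 / 4\<close> leaves
  \<open>F\<^sup>2 / 4\<close> on the left. After integration the terms with \<open>\<Psi>\<close>
  at \<open>x\<close> and at \<open>x + v\<close> agree and cancel. The 4 is the square of the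
  classical L2 constant 2.\<close>

lemma maximal_averages_finite:
  assumes fin: "(\<integral>\<^sup>+x. ennreal ((a x)\<^sup>2) \<partial>lborel) < \<infinity>"
  shows "(\<integral>\<^sup>+x. ennreal ((F n x)\<^sup>2) \<partial>lborel) \<le> 4 * (\<integral>\<^sup>+x. ennreal ((a x)\<^sup>2) \<partial>lborel)"
proof -
  have pw: "ennreal ((F n x)\<^sup>2 / 4) + \<Psi> n x \<le> ennreal ((a x)\<^sup>2) + \<Psi> n (x + v)" for x
  proof -
    have "0 \<le> (a x - F n x / 2)\<^sup>2" by simp
    then have le: "a x * F n x \<le> (a x)\<^sup>2 + (F n x)\<^sup>2 / 4"
      by (simp add: power2_diff power_divide)
    have "ennreal ((F n x)\<^sup>2 / 2) = ennreal ((F n x)\<^sup>2 / 4) + ennreal ((F n x)\<^sup>2 / 4)"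
      by (subst ennreal_plus[symmetric]) auto
    then have "ennreal ((F n x)\<^sup>2 / 4) + (ennreal ((F n x)\<^sup>2 / 4) + \<Psi> n x) = \<Psi> n x + ennreal ((F n x)\<^sup>2 / 2)"
      by (simp only: ac_simps)
    also have "\<dots> \<le> ennreal (a x * F n x) + \<Psi> n (x + v)" by (rule \<Psi>_ineq)
    also have "\<dots> \<le> ennreal ((a x)\<^sup>2 + (F n x)\<^sup>2 / 4) + \<Psi> n (x + v)"
      by (intro add_right_mono ennreal_leI le)
    also have "\<dots> = ennreal ((F n x)\<^sup>2 / 4) + (ennreal ((a x)\<^sup>2) + \<Psi> n (x + v))"
      by (subst ennreal_plus) (auto simp only: ac_simps zero_le_power2 zero_le_divide_iff)
    finally show ?thesis by (simp add: ennreal_add_left_cancel_le)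
  qed
  have "(\<integral>\<^sup>+x. \<Psi> n x \<partial>lborel) + (\<integral>\<^sup>+x. ennreal ((F n x)\<^sup>2 / 4) \<partial>lborel)
     = (\<integral>\<^sup>+x. ennreal ((F n x)\<^sup>2 / 4) + \<Psi> n x \<partial>lborel)"
    by (simp add: nn_integral_add add.commute)
  also have "\<dots> \<le> (\<integral>\<^sup>+x. ennreal ((a x)\<^sup>2) + \<Psi> n (x + v) \<partial>lborel)"
    by (intro nn_integral_mono pw)
  also have "\<dots> = (\<integral>\<^sup>+x. \<Psi> n (x + v) \<partial>lborel) + (\<integral>\<^sup>+x. ennreal ((a x)\<^sup>2) \<partial>lborel)"
    by (simp add: nn_integral_add add.commute)
  also have "(\<integral>\<^sup>+x. \<Psi> n (x + v) \<partial>lborel) = (\<integral>\<^sup>+x. \<Psi> n x \<partial>lborel)"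
    by (rule nn_integral_lborel_shift) simp
  finally have "(\<integral>\<^sup>+x. ennreal ((F n x)\<^sup>2 / 4) \<partial>lborel) \<le> (\<integral>\<^sup>+x. ennreal ((a x)\<^sup>2) \<partial>lborel)"
    using \<Psi>_finite[OF fin, of n] by (auto simp: ennreal_add_left_cancel_le)
  then have "4 * (\<integral>\<^sup>+x. ennreal ((F n x)\<^sup>2 / 4) \<partial>lborel) \<le> 4 * (\<integral>\<^sup>+x. ennreal ((a x)\<^sup>2) \<partial>lborel)"
    by (rule mult_left_mono) simp
  also have "4 * (\<integral>\<^sup>+x. ennreal ((F n x)\<^sup>2 / 4) \<partial>lborel) = (\<integral>\<^sup>+x. 4 * ennreal ((F n x)\<^sup>2 / 4) \<partial>lborel)"
    by (simp add: nn_integral_cmult)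
  also have "\<dots> = (\<integral>\<^sup>+x. ennreal ((F n x)\<^sup>2) \<partial>lborel)"
    by (intro nn_integral_cong) (simp flip: ennreal_numeral ennreal_mult)
  finally show ?thesis .
qed

lemma maximal_averages_SUP:
  assumes fin: "(\<integral>\<^sup>+x. ennreal ((a x)\<^sup>2) \<partial>lborel) < \<infinity>"
  shows "(\<integral>\<^sup>+x. (SUP k. ennreal ((S (Suc k) x / real (Suc k))\<^sup>2)) \<partial>lborel) \<le> 4 * (\<integral>\<^sup>+x. ennreal ((a x)\<^sup>2) \<partial>lborel)"
proof -
  have inc: "incseq (\<lambda>n x. ennreal ((F n x)\<^sup>2))"
  proof (rule incseq_SucI, rule le_funI, intro ennreal_leI power_mono F_nonneg)
    fix n x show "F n x \<le> F (Suc n) x"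
      unfolding F_def by (intro Max_mono) auto
  qed
  have "(\<integral>\<^sup>+x. (SUP k. ennreal ((S (Suc k) x / real (Suc k))\<^sup>2)) \<partial>lborel) \<le> (\<integral>\<^sup>+x. (SUP n. ennreal ((F n x)\<^sup>2)) \<partial>lborel)"
  proof (intro nn_integral_mono SUP_mono')
    fix x k
    have "S (Suc k) x / real (Suc k) \<le> F k x"
      unfolding F_def by (intro Max_ge) (auto simp del: of_nat_Suc)
    then show "ennreal ((S (Suc k) x / real (Suc k))\<^sup>2) \<le> ennreal ((F k x)\<^sup>2)"
      by (intro ennreal_leI power_mono divide_nonneg_nonneg S_nonneg) auto
  qed
  also have "\<dots> = (SUP n. \<integral>\<^sup>+x. ennreal ((F n x)\<^sup>2) \<partial>lborel)"
    by (rule nn_integral_monotone_convergence_SUP[OF inc]) simp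
  also have "\<dots> \<le> 4 * (\<integral>\<^sup>+x. ennreal ((a x)\<^sup>2) \<partial>lborel)"
    by (intro SUP_least maximal_averages_finite fin)
  finally show ?thesis .
qed

end

text \<open>Admits infinite values: if the square of \<open>u\<close> is integrable they occupy a
  null set, and its countably many translates are null as well.\<close>

lemma maximal_averages:
  fixes u :: "real \<times> real \<Rightarrow> ennreal"
  assumes [measurable]: "u \<in> borel_measurable borel"
  shows "(\<integral>\<^sup>+x. (SUP k. ((\<Sum>l<Suc k. u (x + real l *\<^sub>R v)) / of_nat (Suc k))\<^sup>2) \<partial>lborel)
      \<le> 4 * (\<integral>\<^sup>+x. (u x)\<^sup>2 \<partial>lborel)"
proof (cases "(\<integral>\<^sup>+x. (u x)\<^sup>2 \<partial>lborel) < \<infinity>")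
  case True
  define a where "a = (\<lambda>x. enn2real (u x))"
  interpret translation_averages a v
    by unfold_locales (auto simp: a_def)
  have "AE x in lborel. (u x)\<^sup>2 \<noteq> \<infinity>"
    using True by (intro nn_integral_PInf_AE) auto
  then have ua: "AE x in lborel. u x = ennreal (a x)"
    by eventually_elim (auto simp: a_def less_top power2_eq_square ennreal_mult_eq_top_iff)
  have "AE x in lborel. \<forall>l::nat. u (x + real l *\<^sub>R v) = ennreal (a (x + real l *\<^sub>R v))"
    unfolding AE_all_countable using AE_lborel_shift[OF ua] by blast
  then have "(\<integral>\<^sup>+x. (SUP k. ((\<Sum>l<Suc k. u (x + real l *\<^sub>R v)) / of_nat (Suc k))\<^sup>2) \<partial>lborel)
    = (\<integral>\<^sup>+x. (SUP k. ennreal ((S (Suc k) x / real (Suc k))\<^sup>2)) \<partial>lborel)"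
  proof (intro nn_integral_cong_AE, eventually_elim)
    fix x assume eq: "\<forall>l::nat. u (x + real l *\<^sub>R v) = ennreal (a (x + real l *\<^sub>R v))"
    have "(\<Sum>l<Suc k. u (x + real l *\<^sub>R v)) / of_nat (Suc k) = ennreal (S (Suc k) x / real (Suc k))" for k
    proof -
      have "(\<Sum>l<Suc k. u (x + real l *\<^sub>R v)) = ennreal (S (Suc k) x)"
        unfolding S_def using eq by (simp add: sum_ennreal a_nonneg del: sum.lessThan_Suc)
      then show ?thesis
        by (simp add: divide_ennreal[symmetric] S_nonneg ennreal_of_nat_eq_real_of_nat del: of_nat_Suc)
    qed
    then show "(SUP k. ((\<Sum>l<Suc k. u (x + real l *\<^sub>R v)) / of_nat (Suc k))\<^sup>2)
        = (SUP k. ennreal ((S (Suc k) x / real (Suc k))\<^sup>2))"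
      by (simp add: ennreal_power S_nonneg del: of_nat_Suc sum.lessThan_Suc)
  qed
  also have "\<dots> \<le> 4 * (\<integral>\<^sup>+x. ennreal ((a x)\<^sup>2) \<partial>lborel)"
  proof (rule maximal_averages_SUP)
    have "(\<integral>\<^sup>+x. ennreal ((a x)\<^sup>2) \<partial>lborel) \<le> (\<integral>\<^sup>+x. (u x)\<^sup>2 \<partial>lborel)"
      using ua by (intro nn_integral_mono_AE) (auto simp: ennreal_power a_nonneg)
    from this True show "(\<integral>\<^sup>+x. ennreal ((a x)\<^sup>2) \<partial>lborel) < \<infinity>" by (rule le_less_trans)
  qed
  also have "(\<integral>\<^sup>+x. ennreal ((a x)\<^sup>2) \<partial>lborel) = (\<integral>\<^sup>+x. (u x)\<^sup>2 \<partial>lborel)"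
    using ua by (intro nn_integral_cong_AE) (auto simp: ennreal_power a_nonneg)
  finally show ?thesis .
qed (simp add: ennreal_mult_top less_top[symmetric])

section \<open>Maximal functions of frequency cut-offs\<close>

definition cutoff :: "(real \<times> real) set \<Rightarrow> (real \<times> real \<Rightarrow> complex) \<Rightarrow> real \<times> real \<Rightarrow> complex" where
  "cutoff A g = (\<lambda>\<xi>. indicator A \<xi> * g \<xi>)"

lemma cutoff_L2: "A \<in> sets borel \<Longrightarrow> g \<in> L2 \<Longrightarrow> cutoff A g \<in> L2"
  unfolding cutoff_def by (rule L2_bounded_mult) (auto simp: indicator_def)

lemma cutoff_cutoff: "cutoff A (cutoff B g) = cutoff (A \<inter> B) g"
  by (auto simp: cutoff_def indicator_def)

lemma cutoff_empty: "cutoff {} g = (\<lambda>_. 0)"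
  by (auto simp: cutoff_def)

lemma cutoff_mult: "cutoff A (\<lambda>\<xi>. m \<xi> * g \<xi>) = (\<lambda>\<xi>. m \<xi> * cutoff A g \<xi>)"
  by (auto simp: cutoff_def)

lemma L2_sq_cutoff_Un:
  assumes "A \<in> sets borel" "B \<in> sets borel" "A \<inter> B = {}" and [measurable]: "g \<in> L2"
  shows "L2_sq (cutoff A g) + L2_sq (cutoff B g) = L2_sq (cutoff (A \<union> B) g)"
proof -
  note [measurable] = cutoff_L2[OF assms(1,4)] cutoff_L2[OF assms(2,4)]
  have "L2_sq (cutoff A g) + L2_sq (cutoff B g)
     = (\<integral>\<^sup>+x. sq_abs (cutoff A g x) + sq_abs (cutoff B g x) \<partial>lborel)"
    unfolding L2_sq_def by (rule nn_integral_add[symmetric]) measurable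
  also have "\<dots> = L2_sq (cutoff (A \<union> B) g)"
    unfolding L2_sq_def using assms(3)
    by (intro nn_integral_cong) (auto simp: cutoff_def indicator_def)
  finally show ?thesis .
qed

lemma L2_sq_cutoff_le: "L2_sq (cutoff A g) \<le> L2_sq g"
  by (rule L2_sq_mono) (auto simp: cutoff_def indicator_def)

definition maxfun :: "('i::countable \<Rightarrow> (real \<times> real) set) \<Rightarrow> (real \<times> real \<Rightarrow> complex) \<Rightarrow> real \<times> real \<Rightarrow> ennreal" where
  "maxfun W g x = (SUP i. sq_abs (fourier_inv (cutoff (W i) g) x))"

text \<open>Here \<open>g\<close> is a function of frequency and ranges over all of L2, so a further
  cut-off may be absorbed into it; this makes the bound stable under iteration. \<open>B\<close>
  bounds the square of the operator norm.\<close>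

definition max_bounded :: "('i::countable \<Rightarrow> (real \<times> real) set) \<Rightarrow> real \<Rightarrow> bool" where
  "max_bounded W B \<longleftrightarrow> (\<forall>i. W i \<in> sets borel) \<and> 0 \<le> B \<and>
     (\<forall>g\<in>L2. (\<integral>\<^sup>+x. maxfun W g x \<partial>lborel) \<le> ennreal B * L2_sq g)"

lemma max_boundedD:
  assumes "max_bounded W B"
  shows "W i \<in> sets borel" "0 \<le> B" "g \<in> L2 \<Longrightarrow> (\<integral>\<^sup>+x. maxfun W g x \<partial>lborel) \<le> ennreal B * L2_sq g"
  using assms by (auto simp: max_bounded_def)

lemma maxfun_measurable [measurable]:
  assumes "\<And>i. W i \<in> sets borel" "g \<in> L2"
  shows "maxfun W g \<in> borel_measurable borel"
proof -
  have [measurable]: "fourier_inv (cutoff (W i) g) \<in> borel_measurable borel" for i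
    by (intro L2_measurable fourier_inv_in_L2 cutoff_L2 assms)
  show ?thesis unfolding maxfun_def by measurable
qed

text \<open>The start of the iteration, a single operator without cut-off; the constant is that of
  \<open>L2_sq_fourier_inv_le\<close>.\<close>

lemma max_bounded_single: "max_bounded (\<lambda>_::unit. UNIV) 4"
proof -
  have "(\<integral>\<^sup>+x. maxfun (\<lambda>_::unit. UNIV) g x \<partial>lborel) \<le> ennreal 4 * L2_sq g" if "g \<in> L2" for g
    using L2_sq_fourier_inv_le[OF that] by (simp add: maxfun_def cutoff_def L2_sq_def)
  then show ?thesis by (auto simp: max_bounded_def)
qed

text \<open>The weight \<open>t\<close> is the point: with \<open>t = 1\<close> the constant of the
  dyadic recursion would double at each level, while a weight growing with the level yields
  quadratic growth.\<close>

lemma square_add_le: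
  fixes p q t :: real
  assumes "t > 0"
  shows "(p + q)\<^sup>2 \<le> (1 + t) * p\<^sup>2 + (1 + 1 / t) * q\<^sup>2"
proof -
  have "0 \<le> (t * p - q)\<^sup>2 / t" using assms by simp
  also have "\<dots> = (1 + t) * p\<^sup>2 + (1 + 1 / t) * q\<^sup>2 - (p + q)\<^sup>2"
    using assms by (simp add: field_simps power2_eq_square)
  finally show ?thesis by simp
qed

lemma maxfun_add:
  assumes W: "\<And>i. W i \<in> sets borel" and fg: "f \<in> L2" "g \<in> L2" and t: "t > 0"
  shows "AE x in lborel. maxfun W (\<lambda>\<xi>. f \<xi> + g \<xi>) x \<le> ennreal (1 + t) * maxfun W f x + ennreal (1 + 1 / t) * maxfun W g x"
proof -
  have "AE x in lborel. \<forall>i. fourier_inv (cutoff (W i) (\<lambda>\<xi>. f \<xi> + g \<xi>)) x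
      = fourier_inv (cutoff (W i) f) x + fourier_inv (cutoff (W i) g) x"
    unfolding AE_all_countable
  proof
    fix i
    have "cutoff (W i) (\<lambda>\<xi>. f \<xi> + g \<xi>) = (\<lambda>\<xi>. cutoff (W i) f \<xi> + cutoff (W i) g \<xi>)"
      by (simp add: cutoff_def distrib_left)
    then show "AE x in lborel. fourier_inv (cutoff (W i) (\<lambda>\<xi>. f \<xi> + g \<xi>)) x
      = fourier_inv (cutoff (W i) f) x + fourier_inv (cutoff (W i) g) x"
      using fourier_inv_add[OF cutoff_L2[OF W fg(1)] cutoff_L2[OF W fg(2)]] by simp
  qed
  then show ?thesis
  proof eventually_elim
    fix x assume eq: "\<forall>i. fourier_inv (cutoff (W i) (\<lambda>\<xi>. f \<xi> + g \<xi>)) x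
      = fourier_inv (cutoff (W i) f) x + fourier_inv (cutoff (W i) g) x"
    show "maxfun W (\<lambda>\<xi>. f \<xi> + g \<xi>) x \<le> ennreal (1 + t) * maxfun W f x + ennreal (1 + 1 / t) * maxfun W g x"
      unfolding maxfun_def[of W "\<lambda>\<xi>. f \<xi> + g \<xi>"]
    proof (rule SUP_least)
      fix i
      let ?p = "cmod (fourier_inv (cutoff (W i) f) x)" and ?q = "cmod (fourier_inv (cutoff (W i) g) x)"
      have "(cmod (fourier_inv (cutoff (W i) f) x + fourier_inv (cutoff (W i) g) x))\<^sup>2 \<le> (?p + ?q)\<^sup>2"
        by (intro power_mono norm_triangle_ineq) simp
      also have "\<dots> \<le> (1 + t) * ?p\<^sup>2 + (1 + 1 / t) * ?q\<^sup>2" by (rule square_add_le[OF t])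
      finally have "sq_abs (fourier_inv (cutoff (W i) (\<lambda>\<xi>. f \<xi> + g \<xi>)) x)
          \<le> ennreal ((1 + t) * ?p\<^sup>2 + (1 + 1 / t) * ?q\<^sup>2)"
        using eq by (simp add: ennreal_leI)
      also have "\<dots> = ennreal (1 + t) * ennreal (?p\<^sup>2) + ennreal (1 + 1 / t) * ennreal (?q\<^sup>2)"
        using t by (subst ennreal_plus) (auto simp: ennreal_mult)
      also have "\<dots> \<le> ennreal (1 + t) * maxfun W f x + ennreal (1 + 1 / t) * maxfun W g x"
        unfolding maxfun_def by (intro add_mono mult_left_mono SUP_upper2[where i = i]) auto
      finally show "sq_abs (fourier_inv (cutoff (W i) (\<lambda>\<xi>. f \<xi> + g \<xi>)) x)
        \<le> ennreal (1 + t) * maxfun W f x + ennreal (1 + 1 / t) * maxfun W g x" .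
    qed
  qed
qed

lemma maxfun_add2:
  assumes "\<And>i. W i \<in> sets borel" "f \<in> L2" "g \<in> L2"
  shows "AE x in lborel. maxfun W (\<lambda>\<xi>. f \<xi> + g \<xi>) x \<le> 2 * maxfun W f x + 2 * maxfun W g x"
  using maxfun_add[OF assms, of 1] by simp

lemma maxfun_diff2:
  assumes W: "\<And>i. W i \<in> sets borel" and fg: "f \<in> L2" "g \<in> L2"
  shows "AE x in lborel. maxfun W (\<lambda>\<xi>. f \<xi> - g \<xi>) x \<le> 2 * maxfun W f x + 2 * maxfun W g x"
proof -
  have "AE x in lborel. \<forall>i. fourier_inv (cutoff (W i) (\<lambda>\<xi>. (-1) * g \<xi>)) x = (-1) * fourier_inv (cutoff (W i) g) x"
    unfolding AE_all_countable cutoff_mult using fourier_inv_mult[OF cutoff_L2[OF W fg(2)], where c = "-1"] by blast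
  then have "AE x in lborel. maxfun W (\<lambda>\<xi>. (-1) * g \<xi>) x = maxfun W g x"
    by eventually_elim (simp add: maxfun_def)
  with maxfun_add2[of W, OF W fg(1) L2_mult[OF fg(2), of "-1"]] show ?thesis
    by eventually_elim simp
qed

text \<open>The Rademacher--Menshov argument, with the two halves of the range recombined at the cost
  of one more unit in the norm (hence \<open>(m + 1)\<^sup>2\<close> for the squares).\<close>

lemma rademacher_menshov:
  fixes W :: "'i::countable \<Rightarrow> (real \<times> real) set"
  assumes W: "max_bounded W B" and V: "decseq V" "\<And>n. V n \<in> sets borel" and g: "g \<in> L2"
  shows "(\<integral>\<^sup>+x. (SUP n\<in>{a..a + 2 ^ m}. maxfun W (cutoff (V a - V n) g) x) \<partial>lborel)
     \<le> ennreal ((real m + 1)\<^sup>2 * B) * L2_sq (cutoff (V a - V (a + 2 ^ m)) g)"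
proof (induction m arbitrary: a)
  case 0
  have m[measurable]: "maxfun W (cutoff (V a - V n) g) \<in> borel_measurable borel" for n
    by (intro maxfun_measurable cutoff_L2 max_boundedD[OF W] sets.Diff V g)
  have "{a..a + 2 ^ 0} = {a, Suc a}" by auto
  then have "(\<integral>\<^sup>+x. (SUP n\<in>{a..a + 2 ^ 0}. maxfun W (cutoff (V a - V n) g) x) \<partial>lborel)
      \<le> (\<integral>\<^sup>+x. maxfun W (cutoff (V a - V a) g) x + maxfun W (cutoff (V a - V (Suc a)) g) x \<partial>lborel)"
    by (intro nn_integral_mono) auto
  also have "\<dots> = (\<integral>\<^sup>+x. maxfun W (cutoff (V a - V a) g) x \<partial>lborel) + (\<integral>\<^sup>+x. maxfun W (cutoff (V a - V (Suc a)) g) x \<partial>lborel)"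
    using m[of a] m[of "Suc a"] by (intro nn_integral_add) simp_all
  also have "\<dots> \<le> ennreal B * L2_sq (cutoff (V a - V a) g) + ennreal B * L2_sq (cutoff (V a - V (Suc a)) g)"
    by (intro add_mono max_boundedD[OF W] cutoff_L2 sets.Diff V g)
  also have "L2_sq (cutoff (V a - V a) g) = 0" by (simp add: cutoff_empty L2_sq_def)
  finally show ?case by simp
next
  case (Suc m)
  define b c where "b = a + 2 ^ m" and "c = a + 2 ^ Suc m"
  have bc: "a \<le> b" "b \<le> c" "c = b + 2 ^ m" by (auto simp: b_def c_def)
  \<comment> \<open>With this weight the recursion closes exactly: \<open>(1 + t) * B + (1 + 1 / t)
    * (t\<^sup>2 * B) = (t + 1)\<^sup>2 * B\<close>.\<close>
  define t where "t = real m + 1"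
  have t: "t > 0" by (simp add: t_def)
  note Wb = max_boundedD(1)[OF W]
  have L2: "cutoff (V i - V j) g \<in> L2" for i j
    by (intro cutoff_L2 sets.Diff V g)
  have m[measurable]: "maxfun W (cutoff (V i - V j) g) \<in> borel_measurable borel" for i j
    by (intro maxfun_measurable L2 Wb)
  define X1 where "X1 = (\<lambda>x. SUP n\<in>{a..b}. maxfun W (cutoff (V a - V n) g) x)"
  define X2 where "X2 = (\<lambda>x. SUP n\<in>{b..c}. maxfun W (cutoff (V b - V n) g) x)"
  have X[measurable]: "X1 \<in> borel_measurable borel" "X2 \<in> borel_measurable borel"
    unfolding X1_def X2_def by (intro borel_measurable_SUP; simp)+
  have "AE x in lborel. \<forall>n. b \<le> n \<longrightarrow> maxfun W (cutoff (V a - V n) g) x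
      \<le> ennreal (1 + t) * maxfun W (cutoff (V a - V b) g) x + ennreal (1 + 1 / t) * maxfun W (cutoff (V b - V n) g) x"
    unfolding AE_all_countable
  proof
    fix n
    show "AE x in lborel. b \<le> n \<longrightarrow> maxfun W (cutoff (V a - V n) g) x
      \<le> ennreal (1 + t) * maxfun W (cutoff (V a - V b) g) x + ennreal (1 + 1 / t) * maxfun W (cutoff (V b - V n) g) x"
    proof (cases "b \<le> n")
      case True
      with decseqD[OF V(1), of b n] decseqD[OF V(1), of a b] bc
      have "cutoff (V a - V n) g = (\<lambda>\<xi>. cutoff (V a - V b) g \<xi> + cutoff (V b - V n) g \<xi>)"
        by (auto simp: cutoff_def indicator_def fun_eq_iff)
      then show ?thesis
        using maxfun_add[OF Wb L2[of a b] L2[of b n] t] by (simp add: True)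
    qed simp
  qed
  then have "AE x in lborel. (SUP n\<in>{a..c}. maxfun W (cutoff (V a - V n) g) x)
     \<le> ennreal (1 + t) * maxfun W (cutoff (V a - V b) g) x + ennreal (1 + 1 / t) * (X1 x + X2 x)"
  proof eventually_elim
    fix x assume le: "\<forall>n. b \<le> n \<longrightarrow> maxfun W (cutoff (V a - V n) g) x
      \<le> ennreal (1 + t) * maxfun W (cutoff (V a - V b) g) x + ennreal (1 + 1 / t) * maxfun W (cutoff (V b - V n) g) x"
    show "(SUP n\<in>{a..c}. maxfun W (cutoff (V a - V n) g) x)
     \<le> ennreal (1 + t) * maxfun W (cutoff (V a - V b) g) x + ennreal (1 + 1 / t) * (X1 x + X2 x)"
    proof (rule SUP_least)
      fix n assume n: "n \<in> {a..c}"
      show "maxfun W (cutoff (V a - V n) g) x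
       \<le> ennreal (1 + t) * maxfun W (cutoff (V a - V b) g) x + ennreal (1 + 1 / t) * (X1 x + X2 x)"
      proof (cases "b \<le> n")
        case True
        have "maxfun W (cutoff (V b - V n) g) x \<le> X1 x + X2 x"
          unfolding X2_def using n True by (intro add_increasing SUP_upper) auto
        then have "ennreal (1 + t) * maxfun W (cutoff (V a - V b) g) x + ennreal (1 + 1 / t) * maxfun W (cutoff (V b - V n) g) x
          \<le> ennreal (1 + t) * maxfun W (cutoff (V a - V b) g) x + ennreal (1 + 1 / t) * (X1 x + X2 x)"
          by (intro add_left_mono mult_left_mono) auto
        with le True show ?thesis by (meson order_trans)
      next
        case False
        have "maxfun W (cutoff (V a - V n) g) x \<le> X1 x"
          unfolding X1_def using n False by (intro SUP_upper) auto
        also have "\<dots> \<le> 1 * (X1 x + X2 x)" by simp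
        also have "\<dots> \<le> ennreal (1 + 1 / t) * (X1 x + X2 x)"
          using t by (intro mult_right_mono) (auto simp flip: ennreal_1 intro!: ennreal_leI)
        also have "\<dots> \<le> ennreal (1 + t) * maxfun W (cutoff (V a - V b) g) x + ennreal (1 + 1 / t) * (X1 x + X2 x)"
          by simp
        finally show ?thesis .
      qed
    qed
  qed
  then have "(\<integral>\<^sup>+x. (SUP n\<in>{a..c}. maxfun W (cutoff (V a - V n) g) x) \<partial>lborel)
    \<le> (\<integral>\<^sup>+x. ennreal (1 + t) * maxfun W (cutoff (V a - V b) g) x + ennreal (1 + 1 / t) * (X1 x + X2 x) \<partial>lborel)"
    by (rule nn_integral_mono_AE)
  also have "\<dots> = ennreal (1 + t) * (\<integral>\<^sup>+x. maxfun W (cutoff (V a - V b) g) x \<partial>lborel)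
      + ennreal (1 + 1 / t) * ((\<integral>\<^sup>+x. X1 x \<partial>lborel) + (\<integral>\<^sup>+x. X2 x \<partial>lborel))"
    by (simp add: nn_integral_add nn_integral_cmult)
  also have "\<dots> \<le> ennreal (1 + t) * (ennreal B * L2_sq (cutoff (V a - V c) g))
      + ennreal (1 + 1 / t) * (ennreal (t\<^sup>2 * B) * L2_sq (cutoff (V a - V c) g))"
  proof (intro add_mono mult_left_mono)
    have sub: "V a - V b \<subseteq> V a - V c" using decseqD[OF V(1) bc(2)] by auto
    then have "cutoff (V a - V b) (cutoff (V a - V c) g) = cutoff (V a - V b) g"
      unfolding cutoff_cutoff by (simp add: Int_absorb2)
    then have "L2_sq (cutoff (V a - V b) g) \<le> L2_sq (cutoff (V a - V c) g)"
      using L2_sq_cutoff_le[of "V a - V b" "cutoff (V a - V c) g"] by simp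
    with max_boundedD(3)[OF W L2[of a b]]
    show "(\<integral>\<^sup>+x. maxfun W (cutoff (V a - V b) g) x \<partial>lborel) \<le> ennreal B * L2_sq (cutoff (V a - V c) g)"
      by (meson mult_left_mono order_trans zero_le)
    have "(\<integral>\<^sup>+x. X1 x \<partial>lborel) + (\<integral>\<^sup>+x. X2 x \<partial>lborel)
       \<le> ennreal (t\<^sup>2 * B) * L2_sq (cutoff (V a - V b) g) + ennreal (t\<^sup>2 * B) * L2_sq (cutoff (V b - V c) g)"
      using Suc[of a] Suc[of b] unfolding X1_def X2_def t_def bc(3) b_def by (rule add_mono)
    also have "\<dots> = ennreal (t\<^sup>2 * B) * (L2_sq (cutoff (V a - V b) g) + L2_sq (cutoff (V b - V c) g))"
      by (simp add: distrib_left)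
    \<comment> \<open>Disjoint frequency sets make the squared norms add up, so the two half ranges
      together are bounded by the whole range without a factor 2.\<close>
    also have "L2_sq (cutoff (V a - V b) g) + L2_sq (cutoff (V b - V c) g) = L2_sq (cutoff ((V a - V b) \<union> (V b - V c)) g)"
      by (intro L2_sq_cutoff_Un sets.Diff V g) auto
    also have "(V a - V b) \<union> (V b - V c) = V a - V c"
      using decseqD[OF V(1) bc(2)] decseqD[OF V(1) bc(1)] by auto
    finally show "(\<integral>\<^sup>+x. X1 x \<partial>lborel) + (\<integral>\<^sup>+x. X2 x \<partial>lborel) \<le> ennreal (t\<^sup>2 * B) * L2_sq (cutoff (V a - V c) g)" .
  qed auto
  also have "\<dots> = ennreal ((1 + t) * B + (1 + 1 / t) * (t\<^sup>2 * B)) * L2_sq (cutoff (V a - V c) g)"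
  proof -
    have "ennreal ((1 + t) * B + (1 + 1 / t) * (t\<^sup>2 * B))
        = ennreal (1 + t) * ennreal B + ennreal (1 + 1 / t) * ennreal (t\<^sup>2 * B)"
    proof -
      have 1: "ennreal (1 + t) * ennreal B = ennreal ((1 + t) * B)"
        "ennreal (1 + 1 / t) * ennreal (t\<^sup>2 * B) = ennreal ((1 + 1 / t) * (t\<^sup>2 * B))"
        by (rule ennreal_mult[symmetric]; use t max_boundedD(2)[OF W] in simp)+
      show ?thesis
        unfolding 1 by (rule ennreal_plus) (use t max_boundedD(2)[OF W] in auto)
    qed
    then show ?thesis by (simp only: distrib_right mult.assoc)
  qed
  also have "(1 + t) * B + (1 + 1 / t) * (t\<^sup>2 * B) = (real (Suc m) + 1)\<^sup>2 * B"
    using t by (simp add: t_def field_simps power2_eq_square)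
  finally show ?case unfolding c_def .
qed

section \<open>Multipliers of averages over translations\<close>

lemma norm_1_minus_echar: "cmod (1 - echar t) = 2 * \<bar>sin (pi * t)\<bar>"
proof -
  have "(cmod (1 - echar t))\<^sup>2 = (1 - cos (2 * pi * t))\<^sup>2 + (sin (2 * pi * t))\<^sup>2"
    by (simp add: echar_cis cmod_power2)
  also have "\<dots> = 2 - 2 * cos (2 * pi * t)"
    using sin_cos_squared_add[of "2 * pi * t"] by (simp add: power2_diff)
  also have "\<dots> = (2 * \<bar>sin (pi * t)\<bar>)\<^sup>2"
    using cos_double_sin[of "pi * t"] by (simp add: power_mult_distrib mult.assoc)
  finally show ?thesis by (rule power2_eq_imp_eq) auto
qed

lemma norm_1_minus_echar_le: "cmod (1 - echar t) \<le> 8 * \<bar>t\<bar>"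
proof -
  have "\<bar>sin (pi * t)\<bar> \<le> pi * \<bar>t\<bar>" using abs_sin_x_le_abs_x[of "pi * t"] by (simp add: abs_mult)
  also have "\<dots> \<le> 4 * \<bar>t\<bar>" using pi_less_4 by (intro mult_right_mono) auto
  finally show ?thesis by (simp add: norm_1_minus_echar)
qed

text \<open>Up to \<open>x = 2\<close> the cubic Taylor bound gives
  \<open>sin x \<ge> x - x ^ 3 / 6 \<ge> x / 3\<close>, and \<open>x = pi * \<bar>t\<bar>\<close> is
  at least \<open>3 * \<bar>t\<bar>\<close>.\<close>

lemma norm_1_minus_echar_ge:
  assumes "\<bar>t\<bar> \<le> 1 / 2"
  shows "2 * \<bar>t\<bar> \<le> cmod (1 - echar t)"
proof -
  define x where "x = pi * \<bar>t\<bar>"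
  have x0: "0 \<le> x" by (simp add: x_def)
  have "x \<le> 4 * (1 / 2)" unfolding x_def using assms pi_less_4 by (intro mult_mono) auto
  then have x2: "x \<le> 2" by simp
  have "\<bar>sin x - (\<Sum>m<3. sin_coeff m * x ^ m)\<bar> \<le> inverse (fact 3) * \<bar>x\<bar> ^ 3"
    by (rule Maclaurin_sin_bound)
  then have "\<bar>sin x - x\<bar> \<le> x ^ 3 / 6"
    using x0 by (simp add: numeral_3_eq_3 sin_coeff_def fact_numeral)
  then have "x - x ^ 3 / 6 \<le> sin x" by linarith
  moreover have "x ^ 3 = x * x\<^sup>2" by (simp add: power2_eq_square power3_eq_cube)
  moreover have "x * x\<^sup>2 \<le> x * 2\<^sup>2" using x0 x2 by (intro mult_left_mono power_mono)
  ultimately have "x / 3 \<le> sin x" by simp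
  moreover have "\<bar>t\<bar> \<le> x / 3" unfolding x_def using mult_right_mono[of 3 pi "\<bar>t\<bar>"] pi_gt3 by simp
  moreover have "\<bar>sin (pi * t)\<bar> = \<bar>sin x\<bar>" by (cases "0 \<le> t") (auto simp: x_def)
  ultimately show ?thesis by (simp add: norm_1_minus_echar)
qed

lemma echar_of_nat_mult: "echar (real l * t) = echar t ^ l"
  by (induction l) (auto simp: distrib_right echar_add)

text \<open>The multiplier of the mean of \<open>L\<close> consecutive translates: up to a phase, a
  normalised Dirichlet kernel.\<close>

definition avg_mult :: "nat \<Rightarrow> real \<Rightarrow> complex" where
  "avg_mult L s = (\<Sum>l<L. echar (real l * s)) / of_nat L"

text \<open>The geometric sum has a bounded numerator, so the multiplier is small once
  \<open>L * \<bar>s\<bar>\<close> is large. By \<open>norm_1_minus_avg_mult_le\<close> it is close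
  to 1 when \<open>L * \<bar>s\<bar>\<close> is small. Together they compare it with a cut-off at
  \<open>\<bar>s\<bar>\<close> about \<open>1 / L\<close>.\<close>

lemma norm_avg_mult_le: 
  assumes "\<bar>s\<bar> \<le> 1 / 2" "s \<noteq> 0" "L > 0"
  shows "cmod (avg_mult L s) \<le> 1 / (real L * \<bar>s\<bar>)"
proof -
  have "(1 - echar s) * (\<Sum>l<L. echar (real l * s)) = 1 - echar (real L * s)"
    unfolding echar_of_nat_mult by (rule one_diff_power_eq[symmetric])
  then have "cmod (1 - echar s) * cmod (\<Sum>l<L. echar (real l * s)) = cmod (1 - echar (real L * s))"
    by (simp flip: norm_mult)
  also have "\<dots> \<le> 2" using norm_triangle_ineq4[of 1 "echar (real L * s)"] by simp
  finally have "cmod (1 - echar s) * cmod (\<Sum>l<L. echar (real l * s)) \<le> 2" .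
  moreover have "2 * \<bar>s\<bar> * cmod (\<Sum>l<L. echar (real l * s)) \<le> cmod (1 - echar s) * cmod (\<Sum>l<L. echar (real l * s))"
    using norm_1_minus_echar_ge[OF assms(1)] by (rule mult_right_mono) simp
  ultimately have "\<bar>s\<bar> * cmod (\<Sum>l<L. echar (real l * s)) \<le> 1" by simp
  then show ?thesis using assms by (simp add: avg_mult_def norm_divide field_simps)
qed

lemma norm_1_minus_avg_mult_le:
  assumes "L > 0"
  shows "cmod (1 - avg_mult L s) \<le> 8 * (real L * \<bar>s\<bar>)"
proof -
  have "1 - avg_mult L s = (\<Sum>l<L. 1 - echar (real l * s)) / of_nat L"
    using assms by (simp add: avg_mult_def sum_subtractf diff_divide_distrib)
  then have "cmod (1 - avg_mult L s) = cmod (\<Sum>l<L. 1 - echar (real l * s)) / real L"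
    by (simp add: norm_divide)
  also have "\<dots> \<le> (\<Sum>l<L. 8 * (real L * \<bar>s\<bar>)) / real L"
  proof (intro divide_right_mono sum_norm_le)
    fix l assume "l \<in> {..<L}"
    have "cmod (1 - echar (real l * s)) \<le> 8 * (real l * \<bar>s\<bar>)"
      using norm_1_minus_echar_le[of "real l * s"] by (simp add: abs_mult)
    also have "\<dots> \<le> 8 * (real L * \<bar>s\<bar>)" using \<open>l \<in> {..<L}\<close> by (intro mult_left_mono mult_right_mono) auto
    finally show "cmod (1 - echar (real l * s)) \<le> 8 * (real L * \<bar>s\<bar>)" .
  qed simp
  also have "\<dots> = 8 * (real L * \<bar>s\<bar>)" using assms by simp
  finally show ?thesis .
qed

text \<open>Each term is dominated by an increment of the bounded function
  \<open>y\<^sup>2 / (1 + y\<^sup>2)\<close> along \<open>y = 2 ^ r * \<bar>s\<bar>\<close>, so that the sum over the scales telescopes.\<close>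

lemma square_function_bound:
  fixes s c :: real
  assumes s: "\<bar>s\<bar> \<le> 1 / 2" and c: "1 / 4 < c" "c \<le> 1 / 2"
  shows "(\<Sum>r<R. (cmod ((if \<bar>s\<bar> < c / 2 ^ r then 1 else 0) - avg_mult (2 ^ r) s))\<^sup>2) \<le> 120"
proof -
  define \<phi> where "\<phi> = (\<lambda>r::nat. (2 ^ r * \<bar>s\<bar>)\<^sup>2 / (1 + (2 ^ r * \<bar>s\<bar>)\<^sup>2))"
  \<comment> \<open>The constant 120 is dictated by the region beyond the cut-off: there
    \<open>z \<ge> 1 / 16\<close> gives \<open>(1 + 4 * z) * (1 + z) \<le> 340 * z\<^sup>2\<close>,
    which has to stay below \<open>3 * 120 * z\<^sup>2\<close>. Inside, \<open>z \<le> 1 / 4\<close>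
    leaves more room.\<close>
  have "(cmod ((if \<bar>s\<bar> < c / 2 ^ r then 1 else 0) - avg_mult (2 ^ r) s))\<^sup>2 \<le> 120 * (\<phi> (Suc r) - \<phi> r)" for r
  proof -
    define z where "z = (2 ^ r * \<bar>s\<bar>)\<^sup>2"
    have z0: "0 \<le> z" by (simp add: z_def)
    have "(2 ^ Suc r * \<bar>s\<bar>)\<^sup>2 = 4 * z" by (simp add: z_def power_mult_distrib)
    then have \<phi>: "\<phi> (Suc r) - \<phi> r = 4 * z / (1 + 4 * z) - z / (1 + z)"
      by (simp add: \<phi>_def z_def)
    also have "\<dots> = 3 * z / ((1 + 4 * z) * (1 + z))"
      using z0 by (simp add: field_simps)
    finally have \<phi>: "120 * (\<phi> (Suc r) - \<phi> r) = 360 * z / ((1 + 4 * z) * (1 + z))" by simp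
    have pos: "0 < (1 + 4 * z) * (1 + z)" using z0 by simp
    show ?thesis
    proof (cases "\<bar>s\<bar> < c / 2 ^ r")
      case True
      then have "2 ^ r * \<bar>s\<bar> \<le> 1 / 2" using c by (simp add: field_simps)
      then have "z \<le> (1 / 2)\<^sup>2" unfolding z_def by (intro power_mono) auto
      then have z4: "z \<le> 1 / 4" by (simp add: power2_eq_square)
      have "(cmod (1 - avg_mult (2 ^ r) s))\<^sup>2 \<le> (8 * (2 ^ r * \<bar>s\<bar>))\<^sup>2"
        using norm_1_minus_avg_mult_le[of "2 ^ r" s] by (intro power_mono) auto
      also have "\<dots> = 64 * z" by (simp add: z_def power_mult_distrib)
      also have "\<dots> \<le> 360 * z / ((1 + 4 * z) * (1 + z))"
      proof -
        have "(1 + 4 * z) * (1 + z) \<le> (1 + 4 * (1 / 4)) * (1 + 1 / 4)"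
          using z0 z4 by (intro mult_mono) auto
        then have "z * ((1 + 4 * z) * (1 + z)) \<le> z * (5 / 2)" using z0 by (intro mult_left_mono) auto
        then have "64 * (z * ((1 + 4 * z) * (1 + z))) \<le> 64 * (z * (5 / 2))" by (rule mult_left_mono) simp
        also have "\<dots> \<le> 360 * z" using z0 by simp
        finally have "64 * z * ((1 + 4 * z) * (1 + z)) \<le> 360 * z" by (simp only: mult.assoc)
        then show ?thesis using pos by (simp add: pos_le_divide_eq)
      qed
      finally show ?thesis using True unfolding \<phi> by simp
    next
      case False
      then have ge: "1 / 4 \<le> 2 ^ r * \<bar>s\<bar>" using c by (simp add: field_simps)
      then have "(1 / 4)\<^sup>2 \<le> z" unfolding z_def by (intro power_mono) auto
      then have z16: "1 \<le> 16 * z" by (simp add: power2_eq_square)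
      have s0: "s \<noteq> 0" using ge by auto
      have "(cmod (avg_mult (2 ^ r) s))\<^sup>2 \<le> (1 / (2 ^ r * \<bar>s\<bar>))\<^sup>2"
        using norm_avg_mult_le[OF s s0, of "2 ^ r"] by (intro power_mono) auto
      also have "\<dots> = 1 / z" by (simp add: z_def power_divide)
      also have "\<dots> \<le> 360 * z / ((1 + 4 * z) * (1 + z))"
      proof -
        have "1 * 1 \<le> (16 * z) * (16 * z)" using z16 by (intro mult_mono) auto
        moreover have "z * 1 \<le> z * (16 * z)" using z16 z0 by (intro mult_left_mono) auto
        ultimately have "(1 + 4 * z) * (1 + z) \<le> 360 * z * z" by (simp add: algebra_simps)
        then show ?thesis using pos z16 by (simp add: divide_simps mult_ac)
      qed
      finally show ?thesis using False unfolding \<phi> by simp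
    qed
  qed
  then have "(\<Sum>r<R. (cmod ((if \<bar>s\<bar> < c / 2 ^ r then 1 else 0) - avg_mult (2 ^ r) s))\<^sup>2) \<le> (\<Sum>r<R. 120 * (\<phi> (Suc r) - \<phi> r))"
    by (intro sum_mono)
  also have "\<dots> = 120 * (\<phi> R - \<phi> 0)"
    by (simp only: sum_distrib_left[symmetric] sum_lessThan_telescope)
  also have "\<dots> \<le> 120 * 1"
  proof (intro mult_left_mono)
    have "\<phi> R \<le> 1" unfolding \<phi>_def by (intro divide_le_eq_1_pos[THEN iffD2]) (auto intro: add_pos_nonneg)
    moreover have "0 \<le> \<phi> 0" by (simp add: \<phi>_def)
    ultimately show "\<phi> R - \<phi> 0 \<le> 1" by simp
  qed simp
  finally show ?thesis by simp
qed

section \<open>Periodic strips around a lattice\<close>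

definition near_grid :: "real \<times> real \<Rightarrow> nat \<Rightarrow> nat \<Rightarrow> (real \<times> real) set" where
  "near_grid e Q n = {\<xi>. \<exists>a::int. \<bar>e \<bullet> \<xi> - of_int a / real Q\<bar> < 1 / 2 ^ (n + 1)}"

text \<open>Signed: the value differs from \<open>t\<close> by an integer, so it may replace
  \<open>t\<close> inside \<open>echar\<close>, and it stays in the range of \<open>s\<close> for
  which the multiplier estimates hold.\<close>

definition dist_int :: "real \<Rightarrow> real" where
  "dist_int t = t - of_int (round t)"

lemma abs_dist_int_le: "\<bar>dist_int t\<bar> \<le> 1 / 2"
  using of_int_round_abs_le[of t] by (simp add: dist_int_def abs_minus_commute)

lemma echar_int: "echar (of_int a) = 1"
proof -
  have "echar (of_int a) = cis (2 * pi * of_int (- a))" by (simp add: echar_cis mult_ac)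
  then show ?thesis by (simp only: cis_multiple_2pi Ints_of_int)
qed

lemma echar_dist_int: "echar (real l * dist_int t) = echar (real l * t)"
proof -
  have "real l * t = real l * dist_int t + of_int (int l * round t)"
    by (simp add: dist_int_def algebra_simps)
  then show ?thesis by (simp only: echar_add echar_int mult_1_right)
qed

text \<open>Rescaling by \<open>Q\<close> turns the lattice into the integers, where the nearest one
  decides membership.\<close>

lemma near_grid_iff:
  assumes Q: "Q \<ge> 1"
  shows "\<xi> \<in> near_grid e Q n \<longleftrightarrow> \<bar>dist_int (real Q * (e \<bullet> \<xi>))\<bar> < real Q / 2 ^ (n + 1)"
proof -
  have eq: "\<bar>e \<bullet> \<xi> - of_int a / real Q\<bar> < 1 / 2 ^ (n + 1)
      \<longleftrightarrow> \<bar>real Q * (e \<bullet> \<xi>) - of_int a\<bar> < real Q / 2 ^ (n + 1)" for a :: int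
  proof -
    have "real Q * (e \<bullet> \<xi>) - of_int a = real Q * (e \<bullet> \<xi> - of_int a / real Q)"
      using Q by (simp add: field_simps)
    then have "\<bar>real Q * (e \<bullet> \<xi>) - of_int a\<bar> = real Q * \<bar>e \<bullet> \<xi> - of_int a / real Q\<bar>"
      by (simp add: abs_mult)
    then show ?thesis using Q by (simp add: pos_less_divide_eq field_simps)
  qed
  show ?thesis
  proof
    assume "\<xi> \<in> near_grid e Q n"
    then obtain a :: int where "\<bar>real Q * (e \<bullet> \<xi>) - of_int a\<bar> < real Q / 2 ^ (n + 1)"
      unfolding near_grid_def mem_Collect_eq eq by blast
    with round_diff_minimal[of "real Q * (e \<bullet> \<xi>)" a]
    show "\<bar>dist_int (real Q * (e \<bullet> \<xi>))\<bar> < real Q / 2 ^ (n + 1)"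
      by (simp add: dist_int_def)
  next
    assume "\<bar>dist_int (real Q * (e \<bullet> \<xi>))\<bar> < real Q / 2 ^ (n + 1)"
    then show "\<xi> \<in> near_grid e Q n"
      unfolding near_grid_def mem_Collect_eq eq dist_int_def by blast
  qed
qed

lemma near_grid_measurable [measurable]: "near_grid e Q n \<in> sets borel"
proof -
  have "near_grid e Q n = (\<Union>a::int. {\<xi>. \<bar>e \<bullet> \<xi> - of_int a / real Q\<bar> < 1 / 2 ^ (n + 1)})"
    by (auto simp: near_grid_def)
  also have "\<dots> \<in> sets borel" by measurable
  finally show ?thesis .
qed

text \<open>Both claims share one induction, since additivity of \<open>fourier_inv\<close> is
  available only for functions known to be in L2.\<close>

lemma sum_fourier_inv_modulate:
  assumes f: "f \<in> L2" and I: "finite I"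
  shows "AE x in lborel. fourier_inv (\<lambda>\<xi>. (\<Sum>l\<in>I. echar (v l \<bullet> \<xi>)) * f \<xi>) x = (\<Sum>l\<in>I. fourier_inv f (x - v l))"
    and "(\<lambda>\<xi>. (\<Sum>l\<in>I. echar (v l \<bullet> \<xi>)) * f \<xi>) \<in> L2"
  using I
proof (induction I rule: finite_induct)
  case empty
  {
    case 1
    have "AE x in lborel. fourier_inv (\<lambda>\<xi>. 0 * f \<xi>) x = 0 * fourier_inv f x"
      by (rule fourier_inv_mult[OF f])
    then show ?case by simp
  next
    case 2
    show ?case using L2_mult[OF f, of 0] by simp
  }
next
  case (insert j I)
  have m: "(\<lambda>\<xi>. echar (v j \<bullet> \<xi>) * f \<xi>) \<in> L2" by (intro L2_bounded_mult f) auto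
  have eq: "(\<lambda>\<xi>. (\<Sum>l\<in>insert j I. echar (v l \<bullet> \<xi>)) * f \<xi>)
      = (\<lambda>\<xi>. echar (v j \<bullet> \<xi>) * f \<xi> + (\<Sum>l\<in>I. echar (v l \<bullet> \<xi>)) * f \<xi>)"
    using insert by (simp add: distrib_right)
  {
    case 1
    show ?case
      unfolding eq using insert(3) fourier_inv_modulate[OF f, of "v j"] fourier_inv_add[OF m insert(4)]
      by eventually_elim (use insert in simp)
  next
    case 2
    show ?case unfolding eq by (intro L2_add m insert)
  }
qed

text \<open>Beyond the scale of the grid the cut-offs to \<open>near_grid\<close> are compared with the averages
  over translations by multiples of \<open>Q\<close>, whose multipliers have the same period \<open>1 / Q\<close>.\<close>

lemma max_bounded_large_scales:
  fixes W :: "'i::countable \<Rightarrow> (real \<times> real) set"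
  assumes W: "max_bounded W B" and Q: "Q \<le> 2 ^ n0" "2 ^ n0 < 2 * Q" and g: "g \<in> L2"
  shows "(\<integral>\<^sup>+x. (SUP r. maxfun W (cutoff (near_grid e Q (n0 + r)) g) x) \<partial>lborel) \<le> ennreal (248 * B) * L2_sq g"
proof -
  have Q1: "Q \<ge> 1" using Q(2) by (cases Q) auto
  note Wb = max_boundedD(1)[OF W]
  define T where "T = (\<lambda>r. near_grid e Q (n0 + r))"
  define th where "th = (\<lambda>\<xi>. dist_int (real Q * (e \<bullet> \<xi>)))"
  have th_meas[measurable]: "th \<in> borel_measurable borel"
    unfolding th_def dist_int_def round_def by measurable
  \<comment> \<open>The half-width of the strips at scale \<open>n0\<close> in units of the lattice
    spacing \<open>1 / Q\<close>. The two bounds on \<open>Q\<close> place it in the range demanded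
    by \<open>square_function_bound\<close>.\<close>
  define c where "c = real Q / 2 ^ (n0 + 1)"
  have "real Q \<le> real (2 ^ n0)" "real (2 ^ n0) < real (2 * Q)" using Q by (simp_all only: of_nat_le_iff of_nat_less_iff)
  then have c: "1 / 4 < c" "c \<le> 1 / 2" by (simp_all add: c_def field_simps)
  have T_iff: "\<xi> \<in> T r \<longleftrightarrow> \<bar>th \<xi>\<bar> < c / 2 ^ r" for \<xi> r
    unfolding T_def near_grid_iff[OF Q1] th_def c_def by (simp add: power_add mult_ac)
  define m where "m = (\<lambda>r \<xi>. avg_mult (2 ^ r) (th \<xi>))"
  define d where "d = (\<lambda>r \<xi>. (if \<bar>th \<xi>\<bar> < c / 2 ^ r then 1 else 0) - m r \<xi>)"
  have m_meas[measurable]: "m r \<in> borel_measurable borel" for r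
    unfolding m_def avg_mult_def by measurable
  have d_meas[measurable]: "d r \<in> borel_measurable borel" for r
    unfolding d_def by measurable
  \<comment> \<open>The characters of these translations depend on
    \<open>Q * (e \<bullet> \<xi>)\<close> only modulo 1, so \<open>m r\<close> is the multiplier of
    a mean of \<open>2 ^ r\<close> of them.\<close>
  define v where "v = (\<lambda>l::nat. (real l * real Q) *\<^sub>R e)"
  have m_eq: "m r \<xi> * f \<xi> = (1 / 2 ^ r) * ((\<Sum>l<2 ^ r. echar (v l \<bullet> \<xi>)) * f \<xi>)" for r \<xi> f
  proof -
    have "(\<Sum>l<2 ^ r. echar (real l * th \<xi>)) = (\<Sum>l<2 ^ r. echar (v l \<bullet> \<xi>))"
      unfolding th_def echar_dist_int v_def by (simp add: mult.assoc)
    then show ?thesis by (simp add: m_def avg_mult_def)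
  qed
  have m_L2: "(\<lambda>\<xi>. m r \<xi> * f \<xi>) \<in> L2" if "f \<in> L2" for f r
    unfolding m_eq by (intro L2_mult sum_fourier_inv_modulate that) simp
  have T_meas[measurable]: "T r \<in> sets borel" for r by (simp add: T_def)
  have d_eq: "d r \<xi> * g \<xi> = cutoff (T r) g \<xi> - m r \<xi> * g \<xi>" for r \<xi>
    by (simp add: d_def cutoff_def T_iff indicator_def left_diff_distrib)
  have d_L2: "(\<lambda>\<xi>. d r \<xi> * g \<xi>) \<in> L2" for r
    unfolding d_eq by (intro L2_diff cutoff_L2 m_L2 g) simp
  have T_split: "cutoff (T r) g = (\<lambda>\<xi>. m r \<xi> * g \<xi> + d r \<xi> * g \<xi>)" for r
    unfolding d_eq by simp
  note [measurable] = maxfun_measurable[OF Wb m_L2[OF g]] maxfun_measurable[OF Wb d_L2] maxfun_measurable[OF Wb g]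
  \<comment> \<open>The root of the squared maximal function dominates the operators of all
    \<open>W i\<close> at once, so one scalar maximal inequality for \<open>u\<close> serves every
    cut-off.\<close>
  define u where "u = (\<lambda>x. esqrt (maxfun W g x))"
  have u2: "(u x)\<^sup>2 = maxfun W g x" for x by (simp add: u_def esqrt_power2)
  have u_meas[measurable]: "u \<in> borel_measurable borel"
    unfolding u_def esqrt_def by measurable
  \<comment> \<open>The minus sign is that of the translation \<open>x - v\<close> in
    \<open>fourier_inv_modulate\<close>.\<close>
  define M where "M = (\<lambda>x. SUP k. ((\<Sum>l<Suc k. u (x + real l *\<^sub>R (- (real Q *\<^sub>R e)))) / of_nat (Suc k))\<^sup>2)"
  have M_meas[measurable]: "M \<in> borel_measurable borel"
    unfolding M_def by measurable
  have IM: "(\<integral>\<^sup>+x. M x \<partial>lborel) \<le> 4 * (ennreal B * L2_sq g)"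
  proof -
    have "(\<integral>\<^sup>+x. M x \<partial>lborel) \<le> 4 * (\<integral>\<^sup>+x. (u x)\<^sup>2 \<partial>lborel)"
      unfolding M_def by (rule maximal_averages) measurable
    also have "\<dots> \<le> 4 * (ennreal B * L2_sq g)"
      unfolding u2 by (intro mult_left_mono max_boundedD(3)[OF W g]) simp
    finally show ?thesis .
  qed
  have "AE x in lborel. \<forall>r i. fourier_inv (cutoff (W i) (\<lambda>\<xi>. m r \<xi> * g \<xi>)) x
      = (1 / 2 ^ r) * (\<Sum>l<2 ^ r. fourier_inv (cutoff (W i) g) (x - v l))"
    unfolding AE_all_countable
  proof (intro allI)
    fix r i
    have L: "cutoff (W i) g \<in> L2" by (intro cutoff_L2 Wb g)
    have "AE x in lborel. fourier_inv (\<lambda>\<xi>. (1 / 2 ^ r) * ((\<Sum>l<2 ^ r. echar (v l \<bullet> \<xi>)) * cutoff (W i) g \<xi>)) x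
       = (1 / 2 ^ r) * fourier_inv (\<lambda>\<xi>. (\<Sum>l<2 ^ r. echar (v l \<bullet> \<xi>)) * cutoff (W i) g \<xi>) x"
      by (intro fourier_inv_mult sum_fourier_inv_modulate L) simp
    moreover have "AE x in lborel. fourier_inv (\<lambda>\<xi>. (\<Sum>l<2 ^ r. echar (v l \<bullet> \<xi>)) * cutoff (W i) g \<xi>) x
       = (\<Sum>l<2 ^ r. fourier_inv (cutoff (W i) g) (x - v l))"
      by (intro sum_fourier_inv_modulate L) simp
    ultimately show "AE x in lborel. fourier_inv (cutoff (W i) (\<lambda>\<xi>. m r \<xi> * g \<xi>)) x
      = (1 / 2 ^ r) * (\<Sum>l<2 ^ r. fourier_inv (cutoff (W i) g) (x - v l))"
      unfolding cutoff_mult m_eq by eventually_elim simp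
  qed
  then have AEm: "AE x in lborel. \<forall>r. maxfun W (\<lambda>\<xi>. m r \<xi> * g \<xi>) x \<le> M x"
  proof eventually_elim
    fix x assume eq: "\<forall>r i. fourier_inv (cutoff (W i) (\<lambda>\<xi>. m r \<xi> * g \<xi>)) x
      = (1 / 2 ^ r) * (\<Sum>l<2 ^ r. fourier_inv (cutoff (W i) g) (x - v l))"
    have "sq_abs (fourier_inv (cutoff (W i) (\<lambda>\<xi>. m r \<xi> * g \<xi>)) x) \<le> M x" for r i
    proof -
      obtain k where k: "2 ^ r = Suc k" by (metis not0_implies_Suc power_not_zero zero_neq_numeral)
      have k': "(2::real) ^ r = real (Suc k)" by (metis k of_nat_numeral of_nat_power)
      let ?h = "\<lambda>l. cmod (fourier_inv (cutoff (W i) g) (x - v l))"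
      have le: "ennreal (?h l) \<le> u (x + real l *\<^sub>R (- (real Q *\<^sub>R e)))" for l
      proof -
        have "esqrt (ennreal ((?h l)\<^sup>2)) \<le> u (x - v l)"
          unfolding u_def maxfun_def by (intro esqrt_mono SUP_upper) simp
        also have "esqrt (ennreal ((?h l)\<^sup>2)) = ennreal (?h l)"
          by (metis ennreal_power esqrt_power2_ennreal norm_ge_zero)
        finally show ?thesis by (simp add: v_def)
      qed
      have "cmod (fourier_inv (cutoff (W i) (\<lambda>\<xi>. m r \<xi> * g \<xi>)) x) \<le> (\<Sum>l<2 ^ r. ?h l) / 2 ^ r"
        unfolding eq[rule_format] norm_mult
        using norm_sum[of "\<lambda>l. fourier_inv (cutoff (W i) g) (x - v l)" "{..<2 ^ r}"]
        by (simp add: norm_divide norm_power divide_right_mono)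
      also have "\<dots> = (\<Sum>l<Suc k. ?h l) / real (Suc k)"
        unfolding k' k ..
      finally have "ennreal (cmod (fourier_inv (cutoff (W i) (\<lambda>\<xi>. m r \<xi> * g \<xi>)) x)) \<le> ennreal ((\<Sum>l<Suc k. ?h l) / real (Suc k))"
        by (rule ennreal_leI)
      also have "\<dots> = (\<Sum>l<Suc k. ennreal (?h l)) / of_nat (Suc k)"
        by (simp add: divide_ennreal[symmetric] sum_nonneg sum_ennreal ennreal_of_nat_eq_real_of_nat del: of_nat_Suc sum.lessThan_Suc)
      also have "\<dots> \<le> (\<Sum>l<Suc k. u (x + real l *\<^sub>R (- (real Q *\<^sub>R e)))) / of_nat (Suc k)"
        by (intro divide_right_mono_ennreal sum_mono le)
      finally have "(ennreal (cmod (fourier_inv (cutoff (W i) (\<lambda>\<xi>. m r \<xi> * g \<xi>)) x)))\<^sup>2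
          \<le> ((\<Sum>l<Suc k. u (x + real l *\<^sub>R (- (real Q *\<^sub>R e)))) / of_nat (Suc k))\<^sup>2"
        by (intro power_mono) auto
      also have "\<dots> \<le> M x" unfolding M_def by (rule SUP_upper) simp
      finally show ?thesis by (simp add: ennreal_power)
    qed
    then show "\<forall>r. maxfun W (\<lambda>\<xi>. m r \<xi> * g \<xi>) x \<le> M x"
      unfolding maxfun_def by (intro allI SUP_least)
  qed
  have AEs: "AE x in lborel. \<forall>r. maxfun W (cutoff (T r) g) x \<le> 2 * maxfun W (\<lambda>\<xi>. m r \<xi> * g \<xi>) x + 2 * maxfun W (\<lambda>\<xi>. d r \<xi> * g \<xi>) x"
    unfolding AE_all_countable T_split using maxfun_add2[of W, OF Wb m_L2[OF g] d_L2] by blast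
  have "AE x in lborel. (SUP r. maxfun W (cutoff (T r) g) x) \<le> 2 * M x + 2 * (\<Sum>r. maxfun W (\<lambda>\<xi>. d r \<xi> * g \<xi>) x)"
    using AEm AEs
  proof eventually_elim
    fix x assume 1: "\<forall>r. maxfun W (\<lambda>\<xi>. m r \<xi> * g \<xi>) x \<le> M x"
      and 2: "\<forall>r. maxfun W (cutoff (T r) g) x \<le> 2 * maxfun W (\<lambda>\<xi>. m r \<xi> * g \<xi>) x + 2 * maxfun W (\<lambda>\<xi>. d r \<xi> * g \<xi>) x"
    show "(SUP r. maxfun W (cutoff (T r) g) x) \<le> 2 * M x + 2 * (\<Sum>r. maxfun W (\<lambda>\<xi>. d r \<xi> * g \<xi>) x)"
    proof (rule SUP_least)
      fix r
      \<comment> \<open>For the differences \<open>d r\<close> the supremum over scales is replaced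
        by the sum, which the square function estimate controls.\<close>
      have "maxfun W (\<lambda>\<xi>. d r \<xi> * g \<xi>) x \<le> (\<Sum>r. maxfun W (\<lambda>\<xi>. d r \<xi> * g \<xi>) x)"
        using sum_le_suminf[of "\<lambda>r. maxfun W (\<lambda>\<xi>. d r \<xi> * g \<xi>) x" "{r}"] by simp
      then have "2 * maxfun W (\<lambda>\<xi>. m r \<xi> * g \<xi>) x + 2 * maxfun W (\<lambda>\<xi>. d r \<xi> * g \<xi>) x
        \<le> 2 * M x + 2 * (\<Sum>r. maxfun W (\<lambda>\<xi>. d r \<xi> * g \<xi>) x)"
        using 1 by (intro add_mono mult_left_mono) auto
      with 2 show "maxfun W (cutoff (T r) g) x \<le> 2 * M x + 2 * (\<Sum>r. maxfun W (\<lambda>\<xi>. d r \<xi> * g \<xi>) x)"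
        by (meson order_trans)
    qed
  qed
  then have "(\<integral>\<^sup>+x. (SUP r. maxfun W (cutoff (T r) g) x) \<partial>lborel)
      \<le> (\<integral>\<^sup>+x. 2 * M x + 2 * (\<Sum>r. maxfun W (\<lambda>\<xi>. d r \<xi> * g \<xi>) x) \<partial>lborel)"
    by (rule nn_integral_mono_AE)
  also have "\<dots> = 2 * (\<integral>\<^sup>+x. M x \<partial>lborel) + 2 * (\<Sum>r. \<integral>\<^sup>+x. maxfun W (\<lambda>\<xi>. d r \<xi> * g \<xi>) x \<partial>lborel)"
    by (simp add: nn_integral_add nn_integral_cmult nn_integral_suminf)
  also have "\<dots> \<le> 2 * (4 * (ennreal B * L2_sq g)) + 2 * (\<Sum>r. ennreal B * L2_sq (\<lambda>\<xi>. d r \<xi> * g \<xi>))"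
    by (intro add_mono mult_left_mono IM suminf_le max_boundedD(3)[OF W d_L2]) auto
  also have "(\<Sum>r. ennreal B * L2_sq (\<lambda>\<xi>. d r \<xi> * g \<xi>)) = ennreal B * (\<Sum>r. L2_sq (\<lambda>\<xi>. d r \<xi> * g \<xi>))"
    by (rule ennreal_suminf_cmult)
  also have "(\<Sum>r. L2_sq (\<lambda>\<xi>. d r \<xi> * g \<xi>)) = (\<integral>\<^sup>+\<xi>. (\<Sum>r. sq_abs (d r \<xi> * g \<xi>)) \<partial>lborel)"
    unfolding L2_sq_def using L2_measurable[OF g] by (intro nn_integral_suminf[symmetric]) measurable
  also have "2 * (4 * (ennreal B * L2_sq g)) + 2 * (ennreal B * (\<integral>\<^sup>+\<xi>. (\<Sum>r. sq_abs (d r \<xi> * g \<xi>)) \<partial>lborel))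
     \<le> 2 * (4 * (ennreal B * L2_sq g)) + 2 * (ennreal B * (120 * L2_sq g))"
  proof (intro add_left_mono mult_left_mono)
    have "(\<integral>\<^sup>+\<xi>. (\<Sum>r. sq_abs (d r \<xi> * g \<xi>)) \<partial>lborel) \<le> (\<integral>\<^sup>+\<xi>. 120 * sq_abs (g \<xi>) \<partial>lborel)"
    proof (rule nn_integral_mono)
      fix \<xi>
      show "(\<Sum>r. sq_abs (d r \<xi> * g \<xi>)) \<le> 120 * sq_abs (g \<xi>)"
      proof (rule suminf_le_const)
        fix R
        have "(\<Sum>r<R. (cmod (d r \<xi>))\<^sup>2) \<le> 120"
          unfolding d_def m_def by (rule square_function_bound[OF _ c]) (simp only: th_def abs_dist_int_le)
        from mult_right_mono[OF this, of "(cmod (g \<xi>))\<^sup>2"]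
        have "(\<Sum>r<R. (cmod (d r \<xi> * g \<xi>))\<^sup>2) \<le> 120 * (cmod (g \<xi>))\<^sup>2"
          by (simp add: norm_mult power_mult_distrib sum_distrib_right)
        from ennreal_leI[OF this]
        show "(\<Sum>r<R. sq_abs (d r \<xi> * g \<xi>)) \<le> 120 * sq_abs (g \<xi>)"
          by (simp add: sum_ennreal ennreal_mult)
      qed simp
    qed
    also have "\<dots> = 120 * L2_sq g" unfolding L2_sq_def using L2_measurable[OF g] by (intro nn_integral_cmult) measurable
    finally show "(\<integral>\<^sup>+\<xi>. (\<Sum>r. sq_abs (d r \<xi> * g \<xi>)) \<partial>lborel) \<le> 120 * L2_sq g" .
  qed auto
  \<comment> \<open>\<open>8 = 2 * 4\<close> comes from the maximal averages,
    \<open>240 = 2 * 120\<close> from the square function.\<close>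
  also have "\<dots> = (8 + 240) * (ennreal B * L2_sq g)"
    by (simp only: distrib_right) (simp add: mult_ac)
  also have "\<dots> = ennreal (248 * B) * L2_sq g"
    using max_boundedD(2)[OF W] by (simp add: ennreal_mult mult.assoc)
  finally show ?thesis by (simp add: T_def)
qed

text \<open>The scales are split at \<open>2 ^ m\<close>. This is the length of a dyadic range for
  \<open>rademacher_menshov\<close> and, by the bounds on \<open>Q\<close>, the scale at which the
  strips become comparable to the lattice spacing. The constant majorises
  \<open>2 + 2 * (m + 1)\<^sup>2 + 248\<close>.\<close>

lemma max_bounded_nested:
  fixes W :: "'i::countable \<Rightarrow> (real \<times> real) set"
  assumes W: "max_bounded W B" and V: "decseq V" "\<And>n. V n \<in> sets borel"
    and Q: "Q \<le> 2 ^ (2 ^ m)" "2 ^ (2 ^ m) < 2 * Q"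
    and VT: "\<And>r. V (2 ^ m + r) = near_grid e Q (2 ^ m + r) \<inter> V (2 ^ m)"
  shows "max_bounded (\<lambda>(n, i). V n \<inter> W i) (252 * (real m + 1)\<^sup>2 * B)"
  unfolding max_bounded_def
proof (intro conjI allI ballI)
  note Wb = max_boundedD(1)[OF W] and B0 = max_boundedD(2)[OF W]
  show "(case p of (n, i) \<Rightarrow> V n \<inter> W i) \<in> sets borel" for p
    using V(2) Wb by (auto split: prod.split)
  show "0 \<le> 252 * (real m + 1)\<^sup>2 * B" using B0 by simp
  fix g assume g: "g \<in> L2"
  let ?n0 = "2 ^ m :: nat"
  have VL: "cutoff (V n) g \<in> L2" for n by (intro cutoff_L2 V g)
  have DL: "cutoff (V i - V j) g \<in> L2" for i j by (intro cutoff_L2 V sets.Diff g)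
  note [measurable] = maxfun_measurable[OF Wb VL] maxfun_measurable[OF Wb DL]
  define X where "X = (\<lambda>x. SUP n\<in>{0..?n0}. maxfun W (cutoff (V 0 - V n) g) x)"
  define Y where "Y = (\<lambda>x. SUP r. maxfun W (cutoff (near_grid e Q (?n0 + r)) (cutoff (V ?n0) g)) x)"
  have GL: "cutoff (near_grid e Q (?n0 + r)) (cutoff (V ?n0) g) \<in> L2" for r
    by (intro cutoff_L2 VL near_grid_measurable)
  note [measurable] = maxfun_measurable[OF Wb GL]
  have X_meas[measurable]: "X \<in> borel_measurable borel" unfolding X_def by measurable
  have Y_meas[measurable]: "Y \<in> borel_measurable borel" unfolding Y_def by measurable
  \<comment> \<open>The Rademacher--Menshov bound controls increments from \<open>V 0\<close>, so
    the cut-off to \<open>V n\<close> is written as that to \<open>V 0\<close> minus an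
    increment.\<close>
  have "AE x in lborel. \<forall>n. maxfun W (cutoff (V n) g) x \<le> 2 * maxfun W (cutoff (V 0) g) x + 2 * maxfun W (cutoff (V 0 - V n) g) x"
    unfolding AE_all_countable
  proof
    fix n
    have "cutoff (V n) g = (\<lambda>\<xi>. cutoff (V 0) g \<xi> - cutoff (V 0 - V n) g \<xi>)"
      using decseqD[OF V(1), of 0 n] by (auto simp: cutoff_def indicator_def fun_eq_iff)
    then show "AE x in lborel. maxfun W (cutoff (V n) g) x \<le> 2 * maxfun W (cutoff (V 0) g) x + 2 * maxfun W (cutoff (V 0 - V n) g) x"
      using maxfun_diff2[of W, OF Wb VL[of 0] DL[of 0 n]] by simp
  qed
  then have "AE x in lborel. maxfun (\<lambda>(n, i). V n \<inter> W i) g x \<le> 2 * maxfun W (cutoff (V 0) g) x + (2 * X x + Y x)"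
  proof eventually_elim
    fix x assume le: "\<forall>n. maxfun W (cutoff (V n) g) x \<le> 2 * maxfun W (cutoff (V 0) g) x + 2 * maxfun W (cutoff (V 0 - V n) g) x"
    have "maxfun W (cutoff (V n) g) x \<le> 2 * maxfun W (cutoff (V 0) g) x + (2 * X x + Y x)" for n :: nat
    proof (cases "n \<le> ?n0")
      case True
      have "maxfun W (cutoff (V 0 - V n) g) x \<le> X x" unfolding X_def using True by (intro SUP_upper) auto
      then have "2 * maxfun W (cutoff (V 0) g) x + 2 * maxfun W (cutoff (V 0 - V n) g) x
        \<le> 2 * maxfun W (cutoff (V 0) g) x + (2 * X x + Y x)"
        by (intro add_left_mono add_increasing2 mult_left_mono) auto
      with le show ?thesis by (meson order_trans)
    next
      case False
      then obtain r where r: "n = ?n0 + r" using le_Suc_ex[of ?n0 n] by auto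
      \<comment> \<open>Beyond the splitting scale \<open>V n\<close> is a periodic strip set cut
        down to the fixed set \<open>V ?n0\<close>, which is absorbed into the function.\<close>
      have "maxfun W (cutoff (V n) g) x \<le> Y x"
        unfolding Y_def r cutoff_cutoff VT[symmetric] by (rule SUP_upper) simp
      also have "\<dots> \<le> 2 * maxfun W (cutoff (V 0) g) x + (2 * X x + Y x)"
        by (intro add_increasing) auto
      finally show ?thesis .
    qed
    moreover have "maxfun (\<lambda>(n, i). V n \<inter> W i) g x \<le> (SUP n. maxfun W (cutoff (V n) g) x)"
      unfolding maxfun_def[of "\<lambda>(n, i). V n \<inter> W i"]
    proof (rule SUP_least)
      fix p :: "nat \<times> 'i"
      obtain n i where p: "p = (n, i)" by (cases p)
      have "sq_abs (fourier_inv (cutoff (V n \<inter> W i) g) x) \<le> maxfun W (cutoff (V n) g) x"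
        unfolding maxfun_def cutoff_cutoff by (rule SUP_upper2[where i = i]) (auto simp: Int_commute)
      also have "\<dots> \<le> (SUP n. maxfun W (cutoff (V n) g) x)" by (rule SUP_upper) simp
      finally show "sq_abs (fourier_inv (cutoff (case p of (n, i) \<Rightarrow> V n \<inter> W i) g) x)
        \<le> (SUP n. maxfun W (cutoff (V n) g) x)" by (simp add: p)
    qed
    ultimately show "maxfun (\<lambda>(n, i). V n \<inter> W i) g x \<le> 2 * maxfun W (cutoff (V 0) g) x + (2 * X x + Y x)"
      by (meson SUP_least order_trans)
  qed
  then have "(\<integral>\<^sup>+x. maxfun (\<lambda>(n, i). V n \<inter> W i) g x \<partial>lborel)
      \<le> (\<integral>\<^sup>+x. 2 * maxfun W (cutoff (V 0) g) x + (2 * X x + Y x) \<partial>lborel)"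
    by (rule nn_integral_mono_AE)
  also have "\<dots> = 2 * (\<integral>\<^sup>+x. maxfun W (cutoff (V 0) g) x \<partial>lborel) + (2 * (\<integral>\<^sup>+x. X x \<partial>lborel) + (\<integral>\<^sup>+x. Y x \<partial>lborel))"
    by (simp add: nn_integral_add nn_integral_cmult)
  also have "\<dots> \<le> 2 * (ennreal B * L2_sq g) + (2 * (ennreal ((real m + 1)\<^sup>2 * B) * L2_sq g) + ennreal (248 * B) * L2_sq g)"
  proof (intro add_mono mult_left_mono)
    show "(\<integral>\<^sup>+x. maxfun W (cutoff (V 0) g) x \<partial>lborel) \<le> ennreal B * L2_sq g"
      by (rule order_trans[OF max_boundedD(3)[OF W VL] mult_left_mono[OF L2_sq_cutoff_le]]) simp
    have "(\<integral>\<^sup>+x. X x \<partial>lborel) \<le> ennreal ((real m + 1)\<^sup>2 * B) * L2_sq (cutoff (V 0 - V (0 + 2 ^ m)) g)"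
      using rademacher_menshov[OF W V g, of 0 m] by (simp add: X_def)
    also have "\<dots> \<le> ennreal ((real m + 1)\<^sup>2 * B) * L2_sq g"
      by (rule mult_left_mono[OF L2_sq_cutoff_le]) simp
    finally show "(\<integral>\<^sup>+x. X x \<partial>lborel) \<le> ennreal ((real m + 1)\<^sup>2 * B) * L2_sq g" .
    have "(\<integral>\<^sup>+x. Y x \<partial>lborel) \<le> ennreal (248 * B) * L2_sq (cutoff (V ?n0) g)"
      unfolding Y_def by (rule max_bounded_large_scales[OF W Q VL])
    also have "\<dots> \<le> ennreal (248 * B) * L2_sq g"
      by (rule mult_left_mono[OF L2_sq_cutoff_le]) simp
    finally show "(\<integral>\<^sup>+x. Y x \<partial>lborel) \<le> ennreal (248 * B) * L2_sq g" .
  qed auto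
  also have "\<dots> = ennreal (2 * B + (2 * ((real m + 1)\<^sup>2 * B) + 248 * B)) * L2_sq g"
  proof -
    have 1: "2 * (ennreal B * L2_sq g) = ennreal (2 * B) * L2_sq g"
      "2 * (ennreal ((real m + 1)\<^sup>2 * B) * L2_sq g) = ennreal (2 * ((real m + 1)\<^sup>2 * B)) * L2_sq g"
      using B0 by (simp_all add: ennreal_mult mult.assoc)
    have 2: "ennreal (2 * B + (2 * ((real m + 1)\<^sup>2 * B) + 248 * B))
      = ennreal (2 * B) + (ennreal (2 * ((real m + 1)\<^sup>2 * B)) + ennreal (248 * B))"
      using B0 by (subst ennreal_plus, simp, simp, subst ennreal_plus) auto
    show ?thesis unfolding 1 2 by (simp only: distrib_right)
  qed
  also have "\<dots> \<le> ennreal (252 * (real m + 1)\<^sup>2 * B) * L2_sq g"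
  proof (intro mult_right_mono ennreal_leI)
    have "1 \<le> (real m + 1)\<^sup>2" by simp
    from mult_right_mono[OF this B0] show "2 * B + (2 * ((real m + 1)\<^sup>2 * B) + 248 * B) \<le> 252 * (real m + 1)\<^sup>2 * B"
      using B0 by (simp add: mult_ac)
  qed simp
  finally show "(\<integral>\<^sup>+x. maxfun (\<lambda>(n, i). V n \<inter> W i) g x \<partial>lborel) \<le> ennreal (252 * (real m + 1)\<^sup>2 * B) * L2_sq g" .
qed

section \<open>The oscillation inequality\<close>

definition freq_sets :: "(real \<times> real) set \<Rightarrow> nat \<Rightarrow> nat \<Rightarrow> (real \<times> real) set" where
  "freq_sets \<Lambda> n1 n2 = (\<Union>l\<in>\<Lambda>. R_rect l n1 n2)"

lemma mem_R_rect:
  "\<xi> \<in> R_rect l n1 n2 \<longleftrightarrow> \<bar>fst \<xi> - fst l\<bar> < 1 / 2 ^ (n1 + 1) \<and> \<bar>snd \<xi> - snd l\<bar> < 1 / 2 ^ (n2 + 1)"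
proof -
  have "\<xi> \<in> R_rect l n1 n2 \<longleftrightarrow> \<xi> - l \<in> A_int n1 \<times> A_int n2"
  proof
    assume "\<xi> - l \<in> A_int n1 \<times> A_int n2"
    moreover have "\<xi> = l + (\<xi> - l)" by simp
    ultimately show "\<xi> \<in> R_rect l n1 n2" unfolding R_rect_def by (rule rev_image_eqI)
  qed (auto simp: R_rect_def)
  also have "\<dots> \<longleftrightarrow> \<bar>fst \<xi> - fst l\<bar> < 1 / 2 ^ (n1 + 1) \<and> \<bar>snd \<xi> - snd l\<bar> < 1 / 2 ^ (n2 + 1)"
    by (cases \<xi>; cases l) (auto simp: A_int_def abs_less_iff)
  finally show ?thesis .
qed

lemma R_rect_measurable [measurable]: "R_rect l n1 n2 \<in> sets borel"
proof -
  have "R_rect l n1 n2 = {\<xi>. \<bar>fst \<xi> - fst l\<bar> < 1 / 2 ^ (n1 + 1) \<and> \<bar>snd \<xi> - snd l\<bar> < 1 / 2 ^ (n2 + 1)}"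
    using mem_R_rect by blast
  also have "\<dots> \<in> sets borel" by measurable
  finally show ?thesis .
qed

lemma R_rect_mono: "m1 \<le> n1 \<Longrightarrow> m2 \<le> n2 \<Longrightarrow> R_rect l n1 n2 \<subseteq> R_rect l m1 m2"
proof
  fix \<xi> assume m: "m1 \<le> n1" "m2 \<le> n2" and \<xi>: "\<xi> \<in> R_rect l n1 n2"
  have "1 / 2 ^ (n1 + 1) \<le> (1::real) / 2 ^ (m1 + 1)" "1 / 2 ^ (n2 + 1) \<le> (1::real) / 2 ^ (m2 + 1)"
    using m by (intro divide_left_mono power_increasing; simp)+
  with \<xi> show "\<xi> \<in> R_rect l m1 m2" unfolding mem_R_rect by linarith
qed

text \<open>Rectangles lie in the open unit squares around their centres, and two such squares are
  disjoint when the centres are at distance at least 1 in the maximum norm.\<close>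

lemma R_rect_unique:
  assumes "separated \<Lambda>" "l \<in> \<Lambda>" "l' \<in> \<Lambda>" "\<xi> \<in> R_rect l n1 n2" "\<xi> \<in> R_rect l' m1 m2"
  shows "l = l'"
proof (rule ccontr)
  assume "l \<noteq> l'"
  with assms have "1 \<le> max \<bar>fst l - fst l'\<bar> \<bar>snd l - snd l'\<bar>" by (auto simp: separated_def)
  moreover have "\<xi> \<in> R_rect l 0 0" "\<xi> \<in> R_rect l' 0 0"
    using assms(4,5) R_rect_mono[of 0 _ 0] by blast+
  then have "\<bar>fst \<xi> - fst l\<bar> < 1 / 2" "\<bar>snd \<xi> - snd l\<bar> < 1 / 2"
    "\<bar>fst \<xi> - fst l'\<bar> < 1 / 2" "\<bar>snd \<xi> - snd l'\<bar> < 1 / 2"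
    by (simp_all add: mem_R_rect)
  then have "\<bar>fst l - fst l'\<bar> < 1" "\<bar>snd l - snd l'\<bar> < 1" by linarith+
  ultimately show False by simp
qed

lemma freq_sets_measurable: "finite \<Lambda> \<Longrightarrow> freq_sets \<Lambda> n1 n2 \<in> sets borel"
  unfolding freq_sets_def by (intro sets.finite_UN) auto

lemma freq_sets_mono: "m1 \<le> n1 \<Longrightarrow> m2 \<le> n2 \<Longrightarrow> freq_sets \<Lambda> n1 n2 \<subseteq> freq_sets \<Lambda> m1 m2"
  unfolding freq_sets_def using R_rect_mono by (intro UN_mono) auto

text \<open>A point of both sets lies in rectangles around two centres. By
  \<open>R_rect_unique\<close> these coincide, so the two coordinate conditions refer to the same
  centre.\<close>

lemma freq_sets_Int:
  assumes "separated \<Lambda>"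
  shows "freq_sets \<Lambda> n1 n2 = freq_sets \<Lambda> n1 0 \<inter> freq_sets \<Lambda> 0 n2"
proof
  show "freq_sets \<Lambda> n1 n2 \<subseteq> freq_sets \<Lambda> n1 0 \<inter> freq_sets \<Lambda> 0 n2"
    using freq_sets_mono[of n1 n1 0 n2] freq_sets_mono[of 0 n1 n2 n2] by simp
  show "freq_sets \<Lambda> n1 0 \<inter> freq_sets \<Lambda> 0 n2 \<subseteq> freq_sets \<Lambda> n1 n2"
  proof
    fix \<xi> assume "\<xi> \<in> freq_sets \<Lambda> n1 0 \<inter> freq_sets \<Lambda> 0 n2"
    then obtain l l' where l: "l \<in> \<Lambda>" "\<xi> \<in> R_rect l n1 0" "l' \<in> \<Lambda>" "\<xi> \<in> R_rect l' 0 n2"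
      by (auto simp: freq_sets_def)
    then have "l = l'" using R_rect_unique[OF assms] by blast
    with l show "\<xi> \<in> freq_sets \<Lambda> n1 n2" by (auto simp: freq_sets_def mem_R_rect)
  qed
qed

text \<open>The rectangles are disjoint, so the sum of their indicators is the indicator of the
  union; additivity of \<open>fourier_inv\<close> is applied one rectangle at a time.\<close>

lemma multi_freq_proj_AE:
  assumes fin: "finite \<Lambda>" and sep: "separated \<Lambda>" and f: "f \<in> L2"
  shows "AE x in lborel. multi_freq_proj \<Lambda> f n1 n2 x = fourier_inv (cutoff (freq_sets \<Lambda> n1 n2) (fourier f)) x"
  using fin sep
proof (induction \<Lambda> rule: finite_induct)
  case empty
  have "AE x in lborel. fourier_inv (\<lambda>\<xi>. 0 * fourier f \<xi>) x = 0 * fourier_inv (fourier f) x"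
    by (intro fourier_inv_mult fourier_in_L2 f)
  then show ?case by (simp add: multi_freq_proj_def freq_sets_def cutoff_empty)
next
  case (insert l \<Lambda>)
  have sep: "separated \<Lambda>" using insert(4) by (auto simp: separated_def)
  have "R_rect l n1 n2 \<inter> freq_sets \<Lambda> n1 n2 = {}"
    using R_rect_unique[OF insert(4), of l] insert(2) unfolding freq_sets_def by blast
  then have eq: "cutoff (freq_sets (insert l \<Lambda>) n1 n2) (fourier f)
      = (\<lambda>\<xi>. cutoff (R_rect l n1 n2) (fourier f) \<xi> + cutoff (freq_sets \<Lambda> n1 n2) (fourier f) \<xi>)"
    by (auto simp: cutoff_def freq_sets_def indicator_def fun_eq_iff)
  have "AE x in lborel. fourier_inv (cutoff (freq_sets (insert l \<Lambda>) n1 n2) (fourier f)) x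
     = fourier_inv (cutoff (R_rect l n1 n2) (fourier f)) x + fourier_inv (cutoff (freq_sets \<Lambda> n1 n2) (fourier f)) x"
    unfolding eq by (intro fourier_inv_add cutoff_L2 R_rect_measurable freq_sets_measurable insert fourier_in_L2 f)
  with insert(3)[OF sep] show ?case
    by eventually_elim (simp add: multi_freq_proj_def insert(1,2) cutoff_def)
qed

text \<open>Replacing \<open>Q\<close> by \<open>Q * P\<close> refines the lattice, so that
  \<open>\<Lambda>\<close> stays on it, and brings the spacing within a factor 2 of
  \<open>1 / 2 ^ n\<close>, as \<open>max_bounded_large_scales\<close> demands.\<close>

lemma dyadic_multiple:
  assumes "Q \<ge> 1" "Q \<le> 2 ^ n"
  obtains P where "P \<ge> 1" "Q * P \<le> 2 ^ n" "2 ^ n < 2 * (Q * P :: nat)"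
proof
  let ?P = "2 ^ n div Q"
  show P1: "?P \<ge> 1" using assms by (simp add: Suc_leI div_greater_zero_iff)
  show "Q * ?P \<le> 2 ^ n" by simp
  have "2 ^ n = Q * ?P + 2 ^ n mod Q" by simp
  moreover have "2 ^ n mod Q < Q" using assms by simp
  moreover have "Q * 1 \<le> Q * ?P" using P1 by (rule mult_le_mono2)
  ultimately show "2 ^ n < 2 * (Q * ?P)" by linarith
qed

lemma grid_points_eq:
  assumes Q: "Q \<ge> 1" "Q \<le> 2 ^ n" and a: "\<bar>x - of_int a / real Q\<bar> < 1 / 2 ^ (n + 1)"
    and b: "\<bar>x - of_int b / real Q\<bar> < 1 / 2 ^ (n + 1)"
  shows "a = b"
proof -
  have "\<bar>of_int a / real Q - of_int b / real Q\<bar> < 1 / 2 ^ (n + 1) + 1 / 2 ^ (n + 1)"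
    using a b by linarith
  also have "\<dots> = 1 / 2 ^ n" by (simp add: field_simps)
  also have "\<dots> \<le> 1 / real Q"
  proof (rule divide_left_mono)
    have "real Q \<le> real (2 ^ n)" using Q by (simp only: of_nat_le_iff)
    then show "real Q \<le> 2 ^ n" by simp
  qed (use Q in auto)
  finally have "\<bar>of_int (a - b) :: real\<bar> < 1"
    using Q by (simp add: diff_divide_distrib[symmetric] divide_less_cancel)
  then have "\<bar>a - b\<bar> < 1" by linarith
  then show ?thesis by simp
qed

text \<open>A point of \<open>V n\<close> that is near some lattice point at a finer scale is near
  both that point and its own centre at scale \<open>n\<close>, and \<open>grid_points_eq\<close>
  identifies the two. The condition \<open>\<Phi>\<close>, which stands for the other coordinate, is
  then inherited from the centre.\<close>

lemma nested_near_grid: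
  assumes Q: "Q \<ge> 1" "Q * P \<le> 2 ^ n" "P \<ge> 1"
    and \<Lambda>: "\<And>l. l \<in> \<Lambda> \<Longrightarrow> \<exists>a::int. e \<bullet> l = of_int a / real Q"
    and V: "\<And>k \<xi>. \<xi> \<in> V k \<longleftrightarrow> (\<exists>l\<in>\<Lambda>. \<bar>e \<bullet> \<xi> - e \<bullet> l\<bar> < 1 / 2 ^ (k + 1) \<and> \<Phi> l \<xi>)"
  shows "V (n + r) = near_grid e (Q * P) (n + r) \<inter> V n"
proof -
  have \<Lambda>': "\<exists>a::int. e \<bullet> l = of_int a / real (Q * P)" if l: "l \<in> \<Lambda>" for l
  proof -
    obtain a :: int where "e \<bullet> l = of_int a / real Q" using \<Lambda>[OF l] by blast
    then have "e \<bullet> l = of_int (a * int P) / real (Q * P)" using Q by simp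
    then show ?thesis by blast
  qed
  have QP: "Q * P \<ge> 1" using Q by simp
  have mono: "1 / 2 ^ (n + r + 1) \<le> (1::real) / 2 ^ (n + 1)"
    by (intro divide_left_mono power_increasing) auto
  show ?thesis
  proof (intro set_eqI iffI)
    fix \<xi> assume "\<xi> \<in> V (n + r)"
    then obtain l where l: "l \<in> \<Lambda>" "\<bar>e \<bullet> \<xi> - e \<bullet> l\<bar> < 1 / 2 ^ (n + r + 1)" "\<Phi> l \<xi>" unfolding V by blast
    obtain a :: int where a: "e \<bullet> l = of_int a / real (Q * P)" using \<Lambda>'[OF l(1)] by blast
    have "\<xi> \<in> near_grid e (Q * P) (n + r)" unfolding near_grid_def using l(2) a by auto
    moreover have "\<xi> \<in> V n" unfolding V using l mono by (intro bexI[of _ l]) linarith+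
    ultimately show "\<xi> \<in> near_grid e (Q * P) (n + r) \<inter> V n" by blast
  next
    fix \<xi> assume "\<xi> \<in> near_grid e (Q * P) (n + r) \<inter> V n"
    then obtain b :: int and l where b: "\<bar>e \<bullet> \<xi> - of_int b / real (Q * P)\<bar> < 1 / 2 ^ (n + r + 1)"
      and l: "l \<in> \<Lambda>" "\<bar>e \<bullet> \<xi> - e \<bullet> l\<bar> < 1 / 2 ^ (n + 1)" "\<Phi> l \<xi>" unfolding V near_grid_def Int_iff mem_Collect_eq by blast
    obtain a :: int where a: "e \<bullet> l = of_int a / real (Q * P)" using \<Lambda>'[OF l(1)] by blast
    have "a = b"
      by (rule grid_points_eq[OF QP Q(2), of "e \<bullet> \<xi>"]) (use l(2) a b mono in linarith)+
    with a b l show "\<xi> \<in> V (n + r)" unfolding V by (intro bexI[of _ l]) auto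
  qed
qed

lemma max_bounded_freq_sets:
  assumes W: "max_bounded W B" and fin: "finite \<Lambda>"
    and e: "\<And>k \<xi>. \<xi> \<in> V k \<longleftrightarrow> (\<exists>l\<in>\<Lambda>. \<bar>e \<bullet> \<xi> - e \<bullet> l\<bar> < 1 / 2 ^ (k + 1) \<and> \<Phi> l \<xi>)"
    and V: "decseq V" "\<And>n. V n \<in> sets borel"
    and \<Lambda>: "\<And>l. l \<in> \<Lambda> \<Longrightarrow> \<exists>a::int. e \<bullet> l = of_int a / real Q"
    and Q: "Q \<ge> 1" "Q \<le> 2 ^ (2 ^ m)"
  shows "max_bounded (\<lambda>(n, i). V n \<inter> W i) (252 * (real m + 1)\<^sup>2 * B)"
proof -
  obtain P where P: "P \<ge> 1" "Q * P \<le> 2 ^ (2 ^ m)" "2 ^ (2 ^ m) < 2 * (Q * P)"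
    using dyadic_multiple[OF Q] by blast
  show ?thesis
    by (rule max_bounded_nested[OF W V P(2,3) nested_near_grid[OF Q(1) P(2,1) \<Lambda> e]])
qed

section \<open>Orthogonal blocks and the oscillation\<close>

lemma suminf_blocks_le:
  assumes V: "decseq V" "\<And>n. V n \<in> sets borel" and g: "g \<in> L2" and N: "mono N"
  shows "(\<Sum>k. L2_sq (cutoff (V (N k) - V (N (Suc k))) g)) \<le> L2_sq g"
proof (rule suminf_le_const)
  fix K
  \<comment> \<open>Increments of a decreasing sequence of sets are disjoint, so the sum of the
    squared norms telescopes.\<close>
  have "(\<Sum>k<K. L2_sq (cutoff (V (N k) - V (N (Suc k))) g)) = L2_sq (cutoff (V (N 0) - V (N K)) g)"
  proof (induction K)
    case 0
    show ?case by (simp add: cutoff_empty L2_sq_def)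
  next
    case (Suc K)
    have "(V (N 0) - V (N K)) \<union> (V (N K) - V (N (Suc K))) = V (N 0) - V (N (Suc K))"
      using decseqD[OF V(1) monoD[OF N, of 0 K]] decseqD[OF V(1) monoD[OF N, of K "Suc K"]] by auto
    moreover have "L2_sq (cutoff (V (N 0) - V (N K)) g) + L2_sq (cutoff (V (N K) - V (N (Suc K))) g)
       = L2_sq (cutoff ((V (N 0) - V (N K)) \<union> (V (N K) - V (N (Suc K)))) g)"
      by (intro L2_sq_cutoff_Un sets.Diff V g) auto
    ultimately show ?case using Suc by simp
  qed
  then show "(\<Sum>k<K. L2_sq (cutoff (V (N k) - V (N (Suc k))) g)) \<le> L2_sq g"
    using L2_sq_cutoff_le by simp
qed simp

text \<open>On a block, \<open>P\<^bsub>n1\<^esub> R\<^bsub>n2\<^esub> - P\<^bsub>N\<^esub> R\<^bsub>N\<^esub>\<close> only sees the parts of \<open>g\<close> on which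
  \<open>P\<close> or \<open>R\<close> changes within the block, and these parts are orthogonal for different blocks.\<close>

lemma oscillation_le_maximal:
  assumes Z: "max_bounded (\<lambda>(n, i). V n \<inter> Y i) B" and Y: "\<And>n. Y (n, ()) = W n"
    and V: "decseq V" "\<And>n. V n \<in> sets borel" and W: "decseq W" "\<And>n. W n \<in> sets borel"
    and g: "g \<in> L2" and N: "mono N"
  shows "(\<integral>\<^sup>+x. (\<Sum>k. SUP (n1, n2) \<in> {N k..N (Suc k)} \<times> {N k..N (Suc k)}.
     sq_abs (fourier_inv (cutoff (V n1 \<inter> W n2) g) x - fourier_inv (cutoff (V (N k) \<inter> W (N k)) g) x)) \<partial>lborel)
     \<le> ennreal (16 * B) * L2_sq g"
proof -
  let ?Z = "\<lambda>(n, i). V n \<inter> Y i" and ?I = "\<lambda>k. {N k..N (Suc k)} \<times> {N k..N (Suc k)}"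
  let ?D = "\<lambda>k x (n1, n2). sq_abs (fourier_inv (cutoff (V n1 \<inter> W n2) g) x
    - fourier_inv (cutoff (V (N k) \<inter> W (N k)) g) x)"
  note Zb = max_boundedD(1)[OF Z]
  define h h' where "h = (\<lambda>k. cutoff (V (N k) - V (N (Suc k))) g)" and "h' = (\<lambda>k. cutoff (W (N k) - W (N (Suc k))) g)"
  have hL: "h k \<in> L2" "h' k \<in> L2" for k
    unfolding h_def h'_def by (intro cutoff_L2 sets.Diff V W g)+
  \<comment> \<open>The trailing \<open>()\<close> is the index of the trivial family with which the
    iteration starts.\<close>
  have max_Z: "sq_abs (fourier_inv (cutoff (V a \<inter> W b) f) x) \<le> maxfun ?Z f x" for a b f x
    unfolding maxfun_def by (rule SUP_upper2[where i = "(a, (b, ()))"]) (auto simp: Y)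
  have "AE x in lborel. \<forall>k n1 n2. n1 \<in> {N k..N (Suc k)} \<longrightarrow> n2 \<in> {N k..N (Suc k)} \<longrightarrow>
     fourier_inv (cutoff (V n1 \<inter> W n2) g) x - fourier_inv (cutoff (V (N k) \<inter> W (N k)) g) x
     = (fourier_inv (cutoff (V n1 \<inter> W n2) (h k)) x - fourier_inv (cutoff (V (N k) \<inter> W n2) (h k)) x)
     + (fourier_inv (cutoff (V (N k) \<inter> W n2) (h' k)) x - fourier_inv (cutoff (V (N k) \<inter> W (N k)) (h' k)) x)"
    unfolding AE_all_countable
  proof (intro allI)
    fix k n1 n2
    let ?c = "\<lambda>a b f. cutoff (V a \<inter> W b) f"
    have cL: "?c a b f \<in> L2" if "f \<in> L2" for a b f by (intro cutoff_L2 sets.Int V W that)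
    show "AE x in lborel. n1 \<in> {N k..N (Suc k)} \<longrightarrow> n2 \<in> {N k..N (Suc k)} \<longrightarrow>
     fourier_inv (?c n1 n2 g) x - fourier_inv (?c (N k) (N k) g) x
     = (fourier_inv (?c n1 n2 (h k)) x - fourier_inv (?c (N k) n2 (h k)) x)
     + (fourier_inv (?c (N k) n2 (h' k)) x - fourier_inv (?c (N k) (N k) (h' k)) x)"
    proof (cases "n1 \<in> {N k..N (Suc k)} \<and> n2 \<in> {N k..N (Suc k)}")
      case True
      then have sub: "V n1 \<subseteq> V (N k)" "V (N (Suc k)) \<subseteq> V n1" "W n2 \<subseteq> W (N k)" "W (N (Suc k)) \<subseteq> W n2"
        using V(1) W(1) by (auto simp: decseq_def)
      \<comment> \<open>One coordinate changes at a time: first \<open>V\<close> with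
        \<open>W n2\<close> fixed, then \<open>W\<close> with \<open>V (N k)\<close> fixed. The
        first difference lives on \<open>V (N k) - V (N (Suc k))\<close>, the second on
        \<open>W (N k) - W (N (Suc k))\<close>, so \<open>g\<close> may be replaced by
        \<open>h k\<close> and by \<open>h' k\<close>.\<close>
      then have eq: "(\<lambda>\<xi>. ?c n1 n2 g \<xi> - ?c (N k) (N k) g \<xi>)
         = (\<lambda>\<xi>. (?c n1 n2 (h k) \<xi> - ?c (N k) n2 (h k) \<xi>) + (?c (N k) n2 (h' k) \<xi> - ?c (N k) (N k) (h' k) \<xi>))"
        by (auto simp: h_def h'_def cutoff_def indicator_def fun_eq_iff)
      have 1: "AE x in lborel. fourier_inv (\<lambda>\<xi>. ?c n1 n2 g \<xi> - ?c (N k) (N k) g \<xi>) x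
          = fourier_inv (?c n1 n2 g) x - fourier_inv (?c (N k) (N k) g) x"
        by (intro fourier_inv_diff cL g)
      have 2: "AE x in lborel. fourier_inv (\<lambda>\<xi>. ?c n1 n2 (h k) \<xi> - ?c (N k) n2 (h k) \<xi>) x
          = fourier_inv (?c n1 n2 (h k)) x - fourier_inv (?c (N k) n2 (h k)) x"
        by (intro fourier_inv_diff cL hL)
      have 3: "AE x in lborel. fourier_inv (\<lambda>\<xi>. ?c (N k) n2 (h' k) \<xi> - ?c (N k) (N k) (h' k) \<xi>) x
          = fourier_inv (?c (N k) n2 (h' k)) x - fourier_inv (?c (N k) (N k) (h' k)) x"
        by (intro fourier_inv_diff cL hL)
      have 4: "AE x in lborel. fourier_inv (\<lambda>\<xi>. (?c n1 n2 (h k) \<xi> - ?c (N k) n2 (h k) \<xi>) + (?c (N k) n2 (h' k) \<xi> - ?c (N k) (N k) (h' k) \<xi>)) x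
          = fourier_inv (\<lambda>\<xi>. ?c n1 n2 (h k) \<xi> - ?c (N k) n2 (h k) \<xi>) x
           + fourier_inv (\<lambda>\<xi>. ?c (N k) n2 (h' k) \<xi> - ?c (N k) (N k) (h' k) \<xi>) x"
        by (intro fourier_inv_add L2_diff cL hL)
      show ?thesis using 1 2 3 4 unfolding eq by eventually_elim metis
    qed auto
  qed
  then have "AE x in lborel. (\<Sum>k. SUP p\<in>?I k. ?D k x p)
     \<le> (\<Sum>k. 8 * maxfun ?Z (h k) x + 8 * maxfun ?Z (h' k) x)"
  proof eventually_elim
    fix x assume eq: "\<forall>k n1 n2. n1 \<in> {N k..N (Suc k)} \<longrightarrow> n2 \<in> {N k..N (Suc k)} \<longrightarrow>
     fourier_inv (cutoff (V n1 \<inter> W n2) g) x - fourier_inv (cutoff (V (N k) \<inter> W (N k)) g) x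
     = (fourier_inv (cutoff (V n1 \<inter> W n2) (h k)) x - fourier_inv (cutoff (V (N k) \<inter> W n2) (h k)) x)
     + (fourier_inv (cutoff (V (N k) \<inter> W n2) (h' k)) x - fourier_inv (cutoff (V (N k) \<inter> W (N k)) (h' k)) x)"
    \<comment> \<open>Each of the four squares has weight 4. The two operators on \<open>h k\<close>
      share one bound, and so do those on \<open>h' k\<close>, hence 8 for each maximal
      function.\<close>
    have four: "sq_abs ((p - q) + (r - s)) \<le> 8 * X + 8 * X'"
      if "sq_abs p \<le> X" "sq_abs q \<le> X" "sq_abs r \<le> X'" "sq_abs s \<le> X'"
      for p q r s X X'
    proof -
      have sq: "(u + w)\<^sup>2 \<le> 2 * u\<^sup>2 + 2 * w\<^sup>2" for u w :: real
        using square_add_le[of 1 u w] by simp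
      have "(cmod ((p - q) + (r - s)))\<^sup>2 \<le> ((cmod p + cmod q) + (cmod r + cmod s))\<^sup>2"
        by (intro power_mono norm_triangle_le add_mono norm_triangle_ineq4) auto
      also have "\<dots> \<le> 2 * (cmod p + cmod q)\<^sup>2 + 2 * (cmod r + cmod s)\<^sup>2" by (rule sq)
      also have "\<dots> \<le> 2 * (2 * (cmod p)\<^sup>2 + 2 * (cmod q)\<^sup>2) + 2 * (2 * (cmod r)\<^sup>2 + 2 * (cmod s)\<^sup>2)"
        by (intro add_mono mult_left_mono sq) auto
      finally have "sq_abs ((p - q) + (r - s))
          \<le> ennreal (4 * (cmod p)\<^sup>2 + 4 * (cmod q)\<^sup>2 + (4 * (cmod r)\<^sup>2 + 4 * (cmod s)\<^sup>2))"
        by (intro ennreal_leI) simp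
      also have "\<dots> = 4 * sq_abs p + 4 * sq_abs q + (4 * sq_abs r + 4 * sq_abs s)"
        by (simp add: ennreal_mult)
      also have "\<dots> \<le> 4 * X + 4 * X + (4 * X' + 4 * X')"
        by (intro add_mono mult_left_mono that) auto
      also have "\<dots> = (4 + 4) * X + (4 + 4) * X'" by (simp only: distrib_right)
      finally show ?thesis by simp
    qed
    show "(\<Sum>k. SUP p\<in>?I k. ?D k x p)
     \<le> (\<Sum>k. 8 * maxfun ?Z (h k) x + 8 * maxfun ?Z (h' k) x)"
    proof (intro suminf_le SUP_least)
      fix k p assume p: "p \<in> ?I k"
      obtain n1 n2 where p': "p = (n1, n2)" by (cases p)
      have "sq_abs (fourier_inv (cutoff (V n1 \<inter> W n2) g) x - fourier_inv (cutoff (V (N k) \<inter> W (N k)) g) x)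
        \<le> 8 * maxfun ?Z (h k) x + 8 * maxfun ?Z (h' k) x"
        using p p' by (subst eq[rule_format]) (auto intro!: four max_Z)
      then show "?D k x p \<le> 8 * maxfun ?Z (h k) x + 8 * maxfun ?Z (h' k) x" by (simp add: p')
    qed auto
  qed
  then have "(\<integral>\<^sup>+x. (\<Sum>k. SUP p\<in>?I k. ?D k x p) \<partial>lborel)
    \<le> (\<integral>\<^sup>+x. (\<Sum>k. 8 * maxfun ?Z (h k) x + 8 * maxfun ?Z (h' k) x) \<partial>lborel)"
    by (rule nn_integral_mono_AE)
  also have "\<dots> = (\<Sum>k. \<integral>\<^sup>+x. 8 * maxfun ?Z (h k) x + 8 * maxfun ?Z (h' k) x \<partial>lborel)"
  proof (rule nn_integral_suminf)
    fix k
    note [measurable] = maxfun_measurable[of ?Z, OF Zb hL(1)[of k]] maxfun_measurable[of ?Z, OF Zb hL(2)[of k]]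
    show "(\<lambda>x. 8 * maxfun ?Z (h k) x + 8 * maxfun ?Z (h' k) x) \<in> borel_measurable lborel" by simp
  qed
  also have "\<dots> \<le> (\<Sum>k. ennreal (8 * B) * (L2_sq (h k) + L2_sq (h' k)))"
  proof (intro suminf_le)
    fix k
    have "(\<integral>\<^sup>+x. 8 * maxfun ?Z (h k) x + 8 * maxfun ?Z (h' k) x \<partial>lborel)
      = 8 * (\<integral>\<^sup>+x. maxfun ?Z (h k) x \<partial>lborel) + 8 * (\<integral>\<^sup>+x. maxfun ?Z (h' k) x \<partial>lborel)"
      using maxfun_measurable[of ?Z, OF Zb hL(1)[of k]] maxfun_measurable[of ?Z, OF Zb hL(2)[of k]]
      by (simp add: nn_integral_add nn_integral_cmult)
    also have "\<dots> \<le> 8 * (ennreal B * L2_sq (h k)) + 8 * (ennreal B * L2_sq (h' k))"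
      by (intro add_mono mult_left_mono max_boundedD(3)[OF Z] hL) auto
    also have "\<dots> = ennreal (8 * B) * (L2_sq (h k) + L2_sq (h' k))"
      using max_boundedD(2)[OF Z] by (simp add: ennreal_mult distrib_left mult.assoc)
    finally show "(\<integral>\<^sup>+x. 8 * maxfun ?Z (h k) x + 8 * maxfun ?Z (h' k) x \<partial>lborel) \<le> ennreal (8 * B) * (L2_sq (h k) + L2_sq (h' k))" .
  qed auto
  also have "\<dots> = ennreal (8 * B) * ((\<Sum>k. L2_sq (h k)) + (\<Sum>k. L2_sq (h' k)))"
    by (simp add: suminf_add)
  also have "\<dots> \<le> ennreal (8 * B) * (L2_sq g + L2_sq g)"
    unfolding h_def h'_def by (intro mult_left_mono add_mono suminf_blocks_le V W g N) auto
  also have "\<dots> = ennreal (8 * B) * (2 * L2_sq g)" by (simp only: mult_2)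
  also have "\<dots> = ennreal (16 * B) * L2_sq g"
  proof -
    have "ennreal (16 * B) = ennreal (8 * B) * ennreal 2"
      using max_boundedD(2)[OF Z] by (subst ennreal_mult[symmetric]) auto
    then show ?thesis by (simp only: mult.assoc ennreal_numeral)
  qed
  finally show ?thesis .
qed

section \<open>Numerical bounds for the iterated logarithm\<close>

lemma abs_ln_half_ln_ge:
  assumes "k \<ge> (2::nat)"
  shows "ln (real k) > 0" "1 / 50 \<le> \<bar>ln (ln (real k) / 2)\<bar>"
proof -
  show pos: "ln (real k) > 0" using assms by simp
  have "2718 / 1000 \<le> 5837465777 / 2147483648 - inverse (2 ^ 32 :: real)" by simp
  also have "\<dots> \<le> exp 1" using e_approx_32 by linarith
  finally have e: "2718 / 1000 \<le> (exp 1 :: real)" "(exp 1 :: real) \<le> 272 / 100"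
    using e_less_272 by simp_all
  have e2: "(exp 1 :: real)\<^sup>2 \<le> (272 / 100)\<^sup>2" "(2718 / 1000)\<^sup>2 \<le> (exp 1 :: real)\<^sup>2"
    using e by (intro power_mono; simp)+
  have le2: "ln ((exp 1 :: real)\<^sup>2) = 2" by (simp add: ln_realpow)
  show "1 / 50 \<le> \<bar>ln (ln (real k) / 2)\<bar>"
  \<comment> \<open>The quantity vanishes when \<open>ln k = 2\<close>, which happens between 7 and
    8. The decimal bounds for \<open>exp 1\<close> leave a gap on either side, and
    \<open>ln x \<le> x - 1\<close> turns it into the bound \<open>1 / 50\<close>.\<close>
  proof (cases "k \<le> 7")
    case True
    have "ln (real k / (exp 1)\<^sup>2) \<le> real k / (exp 1)\<^sup>2 - 1"
      using assms by (intro ln_le_minus_one) simp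
    also have "\<dots> \<le> 7 / (2718 / 1000)\<^sup>2 - 1"
      using True e2(2) by (intro diff_right_mono frac_le) auto
    also have "\<dots> \<le> - 5 / 100" by (simp add: power2_eq_square)
    finally have "ln (real k) - 2 \<le> - 5 / 100"
      using assms le2 by (simp add: ln_div)
    then have "ln (real k) / 2 \<le> 975 / 1000" by simp
    moreover have "ln (ln (real k) / 2) \<le> ln (real k) / 2 - 1"
      using pos by (intro ln_le_minus_one) simp
    ultimately have "ln (ln (real k) / 2) \<le> - 25 / 1000" by simp
    then show ?thesis by simp
  next
    case False
    then have k8: "8 \<le> real k" by simp
    have "1 - (exp 1)\<^sup>2 / real k \<ge> 1 - (272 / 100)\<^sup>2 / 8"
      using k8 e2(1) by (intro diff_left_mono frac_le) auto
    moreover have "(1 :: real) - (272 / 100)\<^sup>2 / 8 \<ge> 7 / 100" by (simp add: power2_eq_square)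
    moreover have "ln ((exp 1)\<^sup>2 / real k) \<le> (exp 1)\<^sup>2 / real k - 1"
      using k8 by (intro ln_le_minus_one) simp
    moreover have "ln ((exp 1)\<^sup>2 / real k) = 2 - ln (real k)"
      using k8 le2 by (simp add: ln_div)
    ultimately have l: "1035 / 1000 \<le> ln (real k) / 2" by simp
    have "ln (1035 / 1000 :: real) \<le> ln (ln (real k) / 2)" using l by (subst ln_le_cancel_iff) auto
    moreover have "ln (1000 / 1035 :: real) \<le> 1000 / 1035 - 1" by (intro ln_le_minus_one) simp
    moreover have "ln (1000 / 1035 :: real) = - ln (1035 / 1000)" by (simp add: ln_div)
    ultimately have "1 / 50 \<le> ln (ln (real k) / 2)" by simp
    then show ?thesis by simp
  qed
qed

text \<open>Only \<open>Q * sqrt n = 1\<close> gives \<open>-\<infinity>\<close>; no value is \<open>0\<close>, since \<open>e\<^sup>2\<close> is not an integer.\<close>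

lemma loglog_bound:
  assumes Q: "Q \<ge> 1" and n: "n \<ge> (1::nat)"
  obtains m where "Q \<le> 2 ^ (2 ^ m)" 
    "loglog (real Q * sqrt (real n)) = -\<infinity> \<or> (\<exists>y. loglog (real Q * sqrt (real n)) = ereal y \<and> y \<noteq> 0 \<and> real m + 1 \<le> 10000 * y\<^sup>2)"
proof -
  define k where "k = Q\<^sup>2 * n"
  define x where "x = real Q * sqrt (real n)"
  have x: "x = sqrt (real k)"
    by (simp add: x_def k_def real_sqrt_mult)
  have k1: "k \<ge> 1" using Q n by (simp add: k_def)
  have "Q < 2 ^ Q" by (rule less_exp)
  also have "(2::nat) ^ Q \<le> 2 ^ (2 ^ Q)" by (intro power_increasing less_imp_le less_exp) simp
  finally have ex: "\<exists>m. Q \<le> 2 ^ (2 ^ m)" by (intro exI[of _ Q]) simp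
  \<comment> \<open>For \<open>m > 0\<close> minimality gives \<open>2 ^ (2 ^ (m - 1)) < Q\<close>,
    so \<open>m\<close> is at most about the double logarithm of \<open>Q\<close>.\<close>
  define m where "m = (LEAST m. Q \<le> 2 ^ (2 ^ m))"
  have m: "Q \<le> 2 ^ (2 ^ m)" unfolding m_def by (rule LeastI_ex[OF ex])
  have "loglog x = -\<infinity> \<or> (\<exists>y. loglog x = ereal y \<and> y \<noteq> 0 \<and> real m + 1 \<le> 10000 * y\<^sup>2)"
  proof (cases "k = 1")
    case True
    then have "x = 1" by (simp add: x)
    then show ?thesis by (simp add: loglog_def eln_def)
  next
    case False
    with k1 have k2: "k \<ge> 2" by simp
    define y where "y = ln (ln (real k) / 2)"
    have lnx: "ln x = ln (real k) / 2" using k2 by (simp add: x ln_sqrt)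
    have y50: "1 / 50 \<le> \<bar>y\<bar>" and pos: "0 < ln (real k)"
      using abs_ln_half_ln_ge[OF k2] by (simp_all add: y_def)
    have x0: "x > 0" using k2 by (simp add: x)
    have "loglog x = ereal y"
      using x0 pos by (simp add: loglog_def eln_def lnx y_def)
    moreover have "y \<noteq> 0" using y50 by auto
    moreover have "real m + 1 \<le> 10000 * y\<^sup>2"
    \<comment> \<open>\<open>10000 = 4 * 50\<^sup>2\<close> covers \<open>m \<le> 3\<close> by the
      uniform lower bound alone. For larger \<open>m\<close> the iterated logarithm is at least
      \<open>(m - 1) * ln 2 + ln (ln 2)\<close>, which exceeds \<open>(m + 1) / 4\<close>.\<close>
    proof (cases "m \<le> 3")
      case True
      have "(1 / 50)\<^sup>2 \<le> \<bar>y\<bar>\<^sup>2" using y50 by (intro power_mono) auto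
      then have "4 \<le> 10000 * y\<^sup>2" by (simp add: power2_eq_square)
      with True show ?thesis by simp
    next
      case False
      then obtain j where j: "m = Suc j" "j \<ge> 3" by (cases m) auto
      have "\<not> Q \<le> 2 ^ (2 ^ j)" using j(1) unfolding m_def by (intro not_less_Least) simp
      then have "(2 :: nat) ^ (2 ^ j) \<le> Q" by simp
      then have "real (2 ^ (2 ^ j)) \<le> real Q" by (simp only: of_nat_le_iff)
      also have "\<dots> \<le> x"
      proof -
        have "1 \<le> sqrt (real n)" using n by simp
        then have "real Q * 1 \<le> real Q * sqrt (real n)" by (intro mult_left_mono) auto
        then show ?thesis by (simp add: x_def)
      qed
      finally have "(2::real) ^ (2 ^ j) \<le> x" by simp
      then have "ln ((2::real) ^ (2 ^ j)) \<le> ln x" using x0 by (subst ln_le_cancel_iff) auto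
      then have "2 ^ j * ln 2 \<le> ln x" by (simp add: ln_realpow)
      then have "ln (2 ^ j * ln 2) \<le> y"
        using pos unfolding y_def lnx by (subst ln_le_cancel_iff) auto
      moreover have "ln (2 ^ j * ln 2) = real j * ln 2 + ln (ln (2::real))"
        by (simp add: ln_mult ln_realpow)
      moreover have "real j * (2 / 3) \<le> real j * ln 2"
        using ln2_ge_two_thirds by (intro mult_left_mono) auto
      moreover have "- 1 / 2 \<le> ln (ln (2::real))"
      proof -
        have "ln (1 / ln (2::real)) \<le> 1 / ln 2 - 1" by (intro ln_le_minus_one) simp
        also have "1 / ln (2::real) \<le> 1 / (2 / 3)"
          using ln2_ge_two_thirds by (intro divide_left_mono) auto
        finally show ?thesis by (simp add: ln_div)
      qed
      ultimately have "real j * (2 / 3) - 1 / 2 \<le> y" by simp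
      then have y4: "(real m + 1) / 4 \<le> y" using j by simp
      have "1 * (real m + 1) \<le> (10000 / 16) * (real m + 1) * (real m + 1)"
        by (intro mult_right_mono) auto
      also have "\<dots> = 10000 * ((real m + 1) / 4)\<^sup>2" by (simp add: power2_eq_square)
      also have "\<dots> \<le> 10000 * y\<^sup>2" using y4 by (intro mult_left_mono power_mono) auto
      finally show ?thesis by simp
    qed
    ultimately show ?thesis by blast
  qed
  with m show ?thesis using that unfolding x_def by blast
qed

text \<open>In \<open>ereal\<close> the product of 0 and an infinity is 0; this is why
  \<open>loglog_bound\<close> records that the finite values are nonzero.\<close>

lemma ereal_mult_square_infinite:
  fixes s t :: ereal
  assumes "s \<noteq> 0" "t \<noteq> 0" "s = -\<infinity> \<or> t = -\<infinity>"
  shows "(s * t)\<^sup>2 = \<infinity>"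
proof -
  have "s \<noteq> 0 \<Longrightarrow> t \<noteq> 0 \<Longrightarrow> s = -\<infinity> \<or> t = -\<infinity> \<Longrightarrow> s * t = \<infinity> \<or> s * t = -\<infinity>"
    by (cases s; cases t) (auto simp: zero_ereal_def)
  moreover have "z\<^sup>2 = \<infinity>" if "z = \<infinity> \<or> z = -\<infinity>" for z :: ereal
    using that by (auto simp: power2_eq_square)
  ultimately show ?thesis using assms by blast
qed

lemma loglog_factor_bound:
  fixes s t :: ereal and a b c :: real
  assumes s: "s = -\<infinity> \<or> (\<exists>y. s = ereal y \<and> y \<noteq> 0 \<and> a \<le> c * y\<^sup>2)"
    and t: "t = -\<infinity> \<or> (\<exists>y. t = ereal y \<and> y \<noteq> 0 \<and> b \<le> c * y\<^sup>2)"
    and ab: "0 \<le> a" "0 \<le> b" "0 < c" "0 \<le> K"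
  shows "ennreal (K * a * b) \<le> ennreal (K * c\<^sup>2 + 1) * e2ennreal ((s * t)\<^sup>2)"
proof -
  have top: "ennreal (K * a * b) \<le> ennreal (K * c\<^sup>2 + 1) * e2ennreal \<infinity>"
  proof -
    \<comment> \<open>The added 1 keeps the constant positive when \<open>K = 0\<close>, since 0
      times infinity is 0 in \<open>ennreal\<close> too.\<close>
    have "0 < K * c\<^sup>2 + 1" using ab by (intro add_nonneg_pos) auto
    then show ?thesis by (simp add: ennreal_mult_top)
  qed
  show ?thesis
  proof (cases "s = -\<infinity> \<or> t = -\<infinity>")
    case True
    have "s \<noteq> 0" "t \<noteq> 0" using s t by auto
    then have "(s * t)\<^sup>2 = \<infinity>" using True by (rule ereal_mult_square_infinite)
    then show ?thesis using top by simp
  next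
    case False
    then obtain y z where y: "s = ereal y" "a \<le> c * y\<^sup>2" and z: "t = ereal z" "b \<le> c * z\<^sup>2"
      using s t by blast
    have "K * (a * b) \<le> K * ((c * y\<^sup>2) * (c * z\<^sup>2))" using y z ab by (intro mult_left_mono mult_mono) auto
    also have "\<dots> = K * c\<^sup>2 * (y * z)\<^sup>2" by (simp add: power2_eq_square)
    also have "\<dots> \<le> (K * c\<^sup>2 + 1) * (y * z)\<^sup>2" by (intro mult_right_mono) auto
    finally have "ennreal (K * a * b) \<le> ennreal ((K * c\<^sup>2 + 1) * (y * z)\<^sup>2)" by (intro ennreal_leI) (simp add: mult.assoc)
    also have "\<dots> = ennreal (K * c\<^sup>2 + 1) * e2ennreal ((s * t)\<^sup>2)"
      using ab by (simp add: y z ennreal_mult e2ennreal_ereal)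
    finally show ?thesis .
  qed
qed

text \<open>The one-parameter bound is applied to the trivial family in the second coordinate, then
  to the result in the first. The constant is the root of
  \<open>16 * 252\<^sup>2 * 4 * 4 = 4032\<^sup>2\<close>, with one 4 from the trivial family and one
  from transforming \<open>f\<close>.\<close>

lemma L2_oscillation_bound:
  assumes N: "mono N" and fin: "finite \<Lambda>" and sub: "\<Lambda> \<subseteq> freq_grid Q1 Q2" and sep: "separated \<Lambda>"
    and f: "f \<in> L2" and Q: "Q1 \<ge> 1" "Q1 \<le> 2 ^ (2 ^ m1)" "Q2 \<ge> 1" "Q2 \<le> 2 ^ (2 ^ m2)"
  shows "L2_enorm (\<lambda>x. oscillation N (\<lambda>n1 n2. multi_freq_proj \<Lambda> f n1 n2 x))
    \<le> ennreal (4032 * (real m1 + 1) * (real m2 + 1)) * L2_norm f"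
proof -
  define G where "G = fourier f"
  have G: "G \<in> L2" unfolding G_def by (rule fourier_in_L2[OF f])
  define V W where "V = (\<lambda>n. freq_sets \<Lambda> n 0)" and "W = (\<lambda>n. freq_sets \<Lambda> 0 n)"
  have V: "decseq V" "\<And>n. V n \<in> sets borel" and W: "decseq W" "\<And>n. W n \<in> sets borel"
    unfolding V_def W_def decseq_def using freq_sets_mono freq_sets_measurable[OF fin] by auto
  have \<Lambda>1: "\<exists>a::int. (1, 0) \<bullet> l = of_int a / real Q1" and \<Lambda>2: "\<exists>a::int. (0, 1) \<bullet> l = of_int a / real Q2"
    if "l \<in> \<Lambda>" for l
    using sub that by (auto simp: freq_grid_def)
  have Z2: "max_bounded (\<lambda>(n, i :: unit). W n \<inter> UNIV) (252 * (real m2 + 1)\<^sup>2 * 4)"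
    \<comment> \<open>\<open>\<Phi>\<close> is the condition in the first coordinate, which is held
      at scale 0 and hence has half-width \<open>1 / 2\<close>.\<close>
    by (rule max_bounded_freq_sets[OF max_bounded_single fin _ W \<Lambda>2 Q(3,4),
          where \<Phi> = "\<lambda>l \<xi>. \<bar>fst \<xi> - fst l\<bar> < 1 / 2"])
      (auto simp: W_def freq_sets_def mem_R_rect inner_prod_def)
  define B where "B = 252 * (real m1 + 1)\<^sup>2 * (252 * (real m2 + 1)\<^sup>2 * 4)"
  have Z: "max_bounded (\<lambda>(n, i). V n \<inter> (case i of (n, i :: unit) \<Rightarrow> W n \<inter> UNIV)) B"
    unfolding B_def
    by (rule max_bounded_freq_sets[OF Z2 fin _ V \<Lambda>1 Q(1,2),
          where \<Phi> = "\<lambda>l \<xi>. \<bar>snd \<xi> - snd l\<bar> < 1 / 2"])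
      (auto simp: V_def freq_sets_def mem_R_rect inner_prod_def)
  have "AE x in lborel. \<forall>n1 n2. multi_freq_proj \<Lambda> f n1 n2 x = fourier_inv (cutoff (V n1 \<inter> W n2) G) x"
    unfolding AE_all_countable V_def W_def G_def freq_sets_Int[OF sep, symmetric]
    using multi_freq_proj_AE[OF fin sep f] by blast
  then have "(\<integral>\<^sup>+x. (oscillation N (\<lambda>n1 n2. multi_freq_proj \<Lambda> f n1 n2 x))\<^sup>2 \<partial>lborel)
    = (\<integral>\<^sup>+x. (\<Sum>k. SUP (n1, n2) \<in> {N k..N (Suc k)} \<times> {N k..N (Suc k)}.
     sq_abs (fourier_inv (cutoff (V n1 \<inter> W n2) G) x - fourier_inv (cutoff (V (N k) \<inter> W (N k)) G) x)) \<partial>lborel)"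
    unfolding oscillation_def esqrt_power2 by (intro nn_integral_cong_AE) (auto elim!: eventually_mono)
  also have "\<dots> \<le> ennreal (16 * B) * L2_sq G"
    by (rule oscillation_le_maximal[OF Z _ V W G N]) simp
  also have "\<dots> \<le> ennreal (16 * B) * (4 * L2_sq f)"
    unfolding G_def by (intro mult_left_mono L2_sq_fourier_le f) simp
  also have "\<dots> = ennreal ((4032 * (real m1 + 1) * (real m2 + 1))\<^sup>2) * L2_sq f"
  proof -
    have "(4032 * (real m1 + 1) * (real m2 + 1))\<^sup>2 = 16 * B * 4"
      unfolding B_def power_mult_distrib by simp
    moreover have "ennreal (16 * B * 4) = ennreal (16 * B) * ennreal 4"
      by (rule ennreal_mult) (simp_all add: B_def)
    ultimately show ?thesis by (simp only: mult.assoc ennreal_numeral)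
  qed
  finally have "L2_enorm (\<lambda>x. oscillation N (\<lambda>n1 n2. multi_freq_proj \<Lambda> f n1 n2 x))
      \<le> esqrt (ennreal ((4032 * (real m1 + 1) * (real m2 + 1))\<^sup>2) * L2_sq f)"
    unfolding L2_enorm_def by (rule esqrt_mono)
  then show ?thesis unfolding esqrt_mult L2_norm_L2_sq by simp
qed

theorem theorem2:
  fixes N :: "nat \<Rightarrow> nat"
  assumes "lacunary N"
  shows "\<exists>C::real. C > 0 \<and>
    (\<forall>(Q1::nat) (Q2::nat) (\<Lambda>::(real \<times> real) set) (f::real \<times> real \<Rightarrow> complex).
       Q1 \<ge> 1 \<longrightarrow> Q2 \<ge> 1 \<longrightarrow> finite \<Lambda> \<longrightarrow> \<Lambda> \<subseteq> freq_grid Q1 Q2 \<longrightarrow> separated \<Lambda> \<longrightarrow> f \<in> L2 \<longrightarrow>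
       L2_enorm (\<lambda>x. oscillation N (\<lambda>n1 n2. multi_freq_proj \<Lambda> f n1 n2 x))
         \<le> ennreal C
            * e2ennreal ((loglog (real Q1 * sqrt (real (card \<Lambda>)))
                          * loglog (real Q2 * sqrt (real (card \<Lambda>))))\<^sup>2)
            * L2_norm f)"
\<comment> \<open>Two factors \<open>m + 1 \<le> 10000 * y\<^sup>2\<close> give
  \<open>10000\<^sup>2\<close>; the 1 is that of \<open>loglog_factor_bound\<close>.\<close>
proof (intro exI[of _ "4032 * 10000\<^sup>2 + 1"] conjI allI impI)
  fix Q1 Q2 :: nat and \<Lambda> :: "(real \<times> real) set" and f :: "real \<times> real \<Rightarrow> complex"
  assume Q: "Q1 \<ge> 1" "Q2 \<ge> 1" and fin: "finite \<Lambda>" and sub: "\<Lambda> \<subseteq> freq_grid Q1 Q2"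
    and sep: "separated \<Lambda>" and f: "f \<in> L2"
  have N: "mono N"
  proof (rule mono_iff_le_Suc[THEN iffD2], rule allI)
    fix k
    obtain \<tau> :: real where \<tau>: "\<tau> > 1" "\<And>k. \<tau> * real (N k) \<le> real (N (Suc k))"
      using assms by (auto simp: lacunary_def)
    have "1 * real (N k) \<le> \<tau> * real (N k)" using \<tau>(1) by (intro mult_right_mono) auto
    also have "\<dots> \<le> real (N (Suc k))" by (rule \<tau>(2))
    finally show "N k \<le> N (Suc k)" by simp
  qed
  show "L2_enorm (\<lambda>x. oscillation N (\<lambda>n1 n2. multi_freq_proj \<Lambda> f n1 n2 x))
         \<le> ennreal (4032 * 10000\<^sup>2 + 1)
            * e2ennreal ((loglog (real Q1 * sqrt (real (card \<Lambda>)))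
                          * loglog (real Q2 * sqrt (real (card \<Lambda>))))\<^sup>2)
            * L2_norm f"
  proof (cases "\<Lambda> = {}")
    \<comment> \<open>Without frequencies the operators vanish; \<open>loglog_bound\<close> takes
      over from cardinality 1 on.\<close>
    case True
    have "(SUP x\<in>A. 0 :: ennreal) = 0" for A :: "(nat \<times> nat) set"
      using SUP_bot[of A, where 'a = ennreal] by (simp add: bot_ennreal)
    with True show ?thesis by (simp add: multi_freq_proj_def oscillation_def L2_enorm_def)
  next
    case False
    then have n: "card \<Lambda> \<ge> 1" using fin by (simp add: Suc_leI card_gt_0_iff)
    obtain m1 where m1: "Q1 \<le> 2 ^ (2 ^ m1)"
      "loglog (real Q1 * sqrt (real (card \<Lambda>))) = -\<infinity> \<or> (\<exists>y. loglog (real Q1 * sqrt (real (card \<Lambda>))) = ereal y \<and> y \<noteq> 0 \<and> real m1 + 1 \<le> 10000 * y\<^sup>2)"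
      by (rule loglog_bound[OF Q(1) n])
    obtain m2 where m2: "Q2 \<le> 2 ^ (2 ^ m2)"
      "loglog (real Q2 * sqrt (real (card \<Lambda>))) = -\<infinity> \<or> (\<exists>y. loglog (real Q2 * sqrt (real (card \<Lambda>))) = ereal y \<and> y \<noteq> 0 \<and> real m2 + 1 \<le> 10000 * y\<^sup>2)"
      by (rule loglog_bound[OF Q(2) n])
    have "L2_enorm (\<lambda>x. oscillation N (\<lambda>n1 n2. multi_freq_proj \<Lambda> f n1 n2 x))
      \<le> ennreal (4032 * (real m1 + 1) * (real m2 + 1)) * L2_norm f"
      by (rule L2_oscillation_bound[OF N fin sub sep f Q(1) m1(1) Q(2) m2(1)])
    also have "\<dots> \<le> ennreal (4032 * 10000\<^sup>2 + 1)
            * e2ennreal ((loglog (real Q1 * sqrt (real (card \<Lambda>)))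
                          * loglog (real Q2 * sqrt (real (card \<Lambda>))))\<^sup>2)
            * L2_norm f"
      by (intro mult_right_mono loglog_factor_bound m1(2) m2(2)) auto
    finally show ?thesis .
  qed
qed simp

end
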